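(* Let $f \in L^1(\mathbb{R}^n)$ and $\lambda > 0$. Then $u_0 \in BV(\mathbb{R}^n)$ is a minimizer of $E(\cdot\,; f,\lambda)$ over $BV(\mathbb{R}^n)$ if and only if there exists $v \in \mathcal{V}(u_0)$ which additionally satisfies: (a) $\|\nabla\cdot v\|_{L^\infty(\mathbb{R}^n)} \le \lambda$; (b) $\nabla\cdot v = \lambda$ almost everywhere in $\{x : u_0(x) > f(x)\}$; (c) $\nabla\cdot v = -\lambda$ almost everywhere in $\{x : u_0(x) < f(x)\}$.
   Context: Let $\phi:\mathbb{R}^n\to[0,\infty)$ be convex and positively 1-homogeneous ($\phi(\alpha y)=\alpha\phi(y)$ for all $\alpha>0$, $y\in\mathbb{R}^n$) with $\phi(y)=0$ iff $y=0$; $\phi$ need not be even. The Wulff shape is $W_\phi=\{x\in\mathbb{R}^n : -x\cdot y\le\phi(y)\ \forall y\in\mathbb{R}^n\}$ (a convex compact set with $0$ in its interior). The anisotropic total variation of $u\in BV(\mathbb{R}^n)$ is $\mathrm{TV}_\phi(u)=\sup\{-\int_{\mathbb{R}^n} u\,\nabla\cdot\varphi : \varphi\in C^1_c(\mathbb{R}^n;\mathbb{R}^n),\ \varphi(x)\in -W_\phi\ \forall x\}$. For $f\in L^1(\mathbb{R}^n)$, $\lambda>0$, $u\in BV(\mathbb{R}^n)$, set $E(u;f,\lambda)=\mathrm{TV}_\phi(u)+\lambda\|u-f\|_{L^1(\mathbb{R}^n)}$. For $u\in BV(\mathbb{R}^n)$, $\mathcal{V}(u)$ is the set of all $v\in L^\infty(\mathbb{R}^n;\mathbb{R}^n)$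 such that (i) $v(x)\in -W_\phi$ for a.e. $x$, (ii) $v$ has a weak divergence $\nabla\cdot v\in L^\infty(\mathbb{R}^n)$, and (iii) $\mathrm{TV}_\phi(u)=-\int_{\mathbb{R}^n} u\,\nabla\cdot v$. *)

theory Defs
  imports "HOL-Analysis.Analysis"
begin

definition admissible_aniso :: "('a::euclidean_space \<Rightarrow> real) \<Rightarrow> bool" where
  "admissible_aniso \<phi> \<longleftrightarrow>
     convex_on UNIV \<phi> \<and> (\<forall>y. 0 \<le> \<phi> y) \<and>
     (\<forall>\<alpha> y. \<alpha> > 0 \<longrightarrow> \<phi> (\<alpha> *\<^sub>R y) = \<alpha> * \<phi> y) \<and>
     (\<forall>y. \<phi> y = 0 \<longleftrightarrow> y = 0)"

definition wulff :: "('a::euclidean_space \<Rightarrow> real) \<Rightarrow> 'a set" where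
  "wulff \<phi> = {x. \<forall>y. - (x \<bullet> y) \<le> \<phi> y}"

definition C1c :: "('a::euclidean_space \<Rightarrow> 'b::euclidean_space) \<Rightarrow> bool" where
  "C1c \<psi> \<longleftrightarrow>
     (\<exists>D :: 'a \<Rightarrow> 'a \<Rightarrow>\<^sub>L 'b. (\<forall>x. (\<psi> has_derivative blinfun_apply (D x)) (at x)) \<and>
        continuous_on UNIV D) \<and>
     compact (closure {x. \<psi> x \<noteq> 0})"

definition divergence :: "('a::euclidean_space \<Rightarrow> 'a) \<Rightarrow> 'a \<Rightarrow> real" where
  "divergence \<psi> x = (\<Sum>i\<in>Basis. frechet_derivative \<psi> (at x) i \<bullet> i)"

definition grad :: "('a::euclidean_space \<Rightarrow> real) \<Rightarrow> 'a \<Rightarrow> 'a" where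
  "grad g x = (\<Sum>i\<in>Basis. frechet_derivative g (at x) i *\<^sub>R i)"

definition TV_K :: "'a set \<Rightarrow> ('a::euclidean_space \<Rightarrow> real) \<Rightarrow> ereal" where
  "TV_K K u = (SUP \<psi>\<in>{\<psi>. C1c \<psi> \<and> (\<forall>x. \<psi> x \<in> K)}.
                 ereal (- (\<integral>x. u x * divergence \<psi> x \<partial>lebesgue)))"

definition TV_aniso :: "('a::euclidean_space \<Rightarrow> real) \<Rightarrow> ('a \<Rightarrow> real) \<Rightarrow> ereal" where
  "TV_aniso \<phi> u = TV_K (uminus ` wulff \<phi>) u"

definition BV :: "('a::euclidean_space \<Rightarrow> real) set" where
  "BV = {u. integrable lebesgue u \<and> TV_K (cball 0 1) u < \<infinity>}"

definition energy :: "('a::euclidean_space \<Rightarrow> real) \<Rightarrow> ('a \<Rightarrow> real) \<Rightarrow> ('a \<Rightarrow> real) \<Rightarrow> real \<Rightarrow> ereal" where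
  "energy \<phi> u f lam = TV_aniso \<phi> u + ereal (lam * (\<integral>x. \<bar>u x - f x\<bar> \<partial>lebesgue))"

definition is_minimizer :: "('a::euclidean_space \<Rightarrow> real) \<Rightarrow> ('a \<Rightarrow> real) \<Rightarrow> ('a \<Rightarrow> real) \<Rightarrow> real \<Rightarrow> bool" where
  "is_minimizer \<phi> u0 f lam \<longleftrightarrow> u0 \<in> BV \<and> (\<forall>u\<in>BV. energy \<phi> u0 f lam \<le> energy \<phi> u f lam)"

definition Linf :: "('a::euclidean_space \<Rightarrow> 'b::euclidean_space) \<Rightarrow> bool" where
  "Linf g \<longleftrightarrow> g \<in> borel_measurable lebesgue \<and> (\<exists>C. AE x in lebesgue. norm (g x) \<le> C)"

definition weak_divergence :: "('a::euclidean_space \<Rightarrow> 'a) \<Rightarrow> ('a \<Rightarrow> real) \<Rightarrow> bool" where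
  "weak_divergence v g \<longleftrightarrow>
     (\<forall>\<psi>::'a \<Rightarrow> real. C1c \<psi> \<longrightarrow>
        (\<integral>x. v x \<bullet> grad \<psi> x \<partial>lebesgue) = - (\<integral>x. g x * \<psi> x \<partial>lebesgue))"

definition calV :: "('a::euclidean_space \<Rightarrow> real) \<Rightarrow> ('a \<Rightarrow> real) \<Rightarrow> ('a \<Rightarrow> 'a) set" where
  "calV \<phi> u = {v. Linf v \<and> (AE x in lebesgue. v x \<in> uminus ` wulff \<phi>) \<and>
      (\<exists>g. weak_divergence v g \<and> Linf g \<and>
           TV_aniso \<phi> u = ereal (- (\<integral>x. u x * g x \<partial>lebesgue)))}"

end

theory Submission
  imports Defs "HOL-Library.Function_Algebras"
begin

text \<open>
  If \<open>v\<close> takes values in \<open>-W\<^sub>\<phi>\<close> and has bounded weak divergence \<open>g\<close>, then \<open>- \<integral> u g \<le> TV\<^sub>\<phi>(u)\<close> for every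
  integrable \<open>u\<close>: mollify \<open>v\<close>, cut off, and pass to the limit. Together with \<open>|g| \<le> lam\<close> this bounds
  every energy below by \<open>- \<integral> g f\<close>, and the conditions on \<open>v\<close> and \<open>g\<close> say that \<open>u\<^sub>0\<close> attains the bound.

  Conversely, let \<open>m\<close> be the minimal energy. For \<open>\<psi>\<close> of class \<open>C\<^sup>1\<^sub>c\<close> the energy is at most
  \<open>\<integral> \<phi>(\<nabla>\<psi>) + lam \<integral> |\<psi> - f|\<close>, so \<open>m\<close> is a lower bound for this convex functional on the subspace of pairs
  \<open>(\<nabla>\<psi>, \<psi>)\<close>. The Hahn-Banach theorem on \<open>L\<^sup>1\<close> and \<open>(L\<^sup>1)\<^sup>* = L\<^sup>\<infinity>\<close> yield a pair \<open>(v, g)\<close> with \<open>div v = g\<close>,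
  \<open>v \<in> -W\<^sub>\<phi>\<close>, \<open>|g| \<le> lam\<close> and \<open>m \<le> - \<integral> g f\<close>. Hence equality holds in both inequalities
  \<open>- \<integral> u\<^sub>0 g \<le> TV\<^sub>\<phi>(u\<^sub>0)\<close> and \<open>\<integral> g (u\<^sub>0 - f) \<le> lam \<integral> |u\<^sub>0 - f|\<close>. No smooth approximation of \<open>u\<^sub>0\<close> is needed,
  because \<open>m\<close> only has to be compared with the energies of test functions.
\<close>

subsection \<open>The Mazur-Orlicz theorem\<close>

text \<open>The inequality for \<open>m\<close> involves \<open>\<psi> - f\<close> and is affine in
  \<open>\<psi>\<close>, while a Hahn-Banach argument wants a sublinear functional and a cone.
  Multiplying \<open>f\<close> and \<open>m\<close> by a factor \<open>t \<ge> 0\<close> homogenises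
  it: rescaling \<open>\<psi>\<close> to \<open>\<psi> / t\<close> recovers the original inequality
  because \<open>\<phi>\<close> is positively homogeneous. The extension is purely algebraic:
  domination by \<open>\<integral> \<phi>(w) + lam \<integral> |k|\<close>, itself at most
  \<open>B \<integral> |w| + lam \<integral> |k|\<close>, already bounds the functional in L1, and
  the two summands produce the two pointwise constraints. It takes place on functions and not on
  classes modulo null sets, which is why function types are made real vector spaces and every
  functional carries the subspace on which it is controlled. The direction from \<open>v\<close> to
  minimality has an obstacle of its own: \<open>calV\<close> and the statement each quantify over a
  weak divergence, so two of them must be shown to agree when integrated against
  \<open>u0\<close>.\<close>

instantiation "fun" :: (type, real_vector) real_vector
begin
definition scaleR_fun where "scaleR_fun c f = (\<lambda>x. c *\<^sub>R f x)" for f :: "'a \<Rightarrow> 'b"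
instance
  by standard (auto simp: scaleR_fun_def fun_eq_iff algebra_simps)
end

text \<open>Homogeneity is demanded only as an inequality for \<open>c > 0\<close>, the form that
  the infima below deliver; equality follows by scaling back with \<open>1/c\<close>.\<close>

definition sublinear_on :: "'v::real_vector set \<Rightarrow> ('v \<Rightarrow> real) \<Rightarrow> bool" where
  "sublinear_on X p \<longleftrightarrow> (\<forall>x\<in>X. \<forall>y\<in>X. p (x + y) \<le> p x + p y) \<and>
     (\<forall>x\<in>X. \<forall>c>0. p (c *\<^sub>R x) \<le> c * p x)"

lemma sublinear_on_add: "sublinear_on X p \<Longrightarrow> x \<in> X \<Longrightarrow> y \<in> X \<Longrightarrow> p (x + y) \<le> p x + p y"
  by (simp add: sublinear_on_def)

lemma sublinear_on_zero:
  assumes "sublinear_on X p" "subspace X" shows "p 0 = 0"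
proof -
  have 0: "0 \<in> X" using assms(2) by (rule subspace_0)
  have "p 0 \<le> c * p 0" if "c > 0" for c
    using assms(1) 0 that unfolding sublinear_on_def by (metis scaleR_zero_right)
  \<comment> \<open>\<open>c = 2\<close> gives \<open>0 \<le> p 0\<close>, and
    \<open>c = 1/2\<close> gives \<open>p 0 \<le> 0\<close>.\<close>
  from this[of 2] this[of "1/2"] show ?thesis by simp
qed

lemma sublinear_on_scale:
  assumes p: "sublinear_on X p" and X: "subspace X" and x: "x \<in> X" and c: "c \<ge> 0"
  shows "p (c *\<^sub>R x) = c * p x"
proof (cases "c = 0")
  case True then show ?thesis using sublinear_on_zero[OF p X] by simp
next
  case False
  then have c: "c > 0" using c by simp
  have "p ((1/c) *\<^sub>R (c *\<^sub>R x)) \<le> (1/c) * p (c *\<^sub>R x)"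
    using p c subspace_scale[OF X x, of c] unfolding sublinear_on_def by (meson zero_less_divide_1_iff)
  then have "c * p x \<le> p (c *\<^sub>R x)" using c by (simp add: field_simps)
  moreover have "p (c *\<^sub>R x) \<le> c * p x" using p x c unfolding sublinear_on_def by blast
  ultimately show ?thesis by simp
qed

text \<open>Subadditivity applied to \<open>y = - x + (x + y)\<close>. This bound keeps the infima
  formed below finite.\<close>

lemma sublinear_on_lower:
  assumes p: "sublinear_on X p" and X: "subspace X" and "x \<in> X" "y \<in> X"
  shows "p y - p (- x) \<le> p (x + y)"
  using sublinear_on_add[OF p, of "- x" "x + y"] subspace_neg[OF X] subspace_add[OF X] assms(3,4)
  by simp

text \<open>An infimum of sublinear functionals need not be subadditive; \<open>add\<close> asks for
  one index that serves for two given ones. A chain satisfies this by comparison, a family indexed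
  by a cone by adding indices, and both cases occur below.\<close>

lemma sublinear_on_INF:
  fixes F :: "'i \<Rightarrow> 'v::real_vector \<Rightarrow> real"
  assumes I: "I \<noteq> {}"
    and bdd: "\<And>x. x \<in> X \<Longrightarrow> bdd_below ((\<lambda>i. F i x) ` I)"
    and X: "subspace X"
    and add: "\<And>i j x y. i \<in> I \<Longrightarrow> j \<in> I \<Longrightarrow> x \<in> X \<Longrightarrow> y \<in> X \<Longrightarrow> \<exists>k\<in>I. F k (x + y) \<le> F i x + F j y"
    and scale: "\<And>i x c. i \<in> I \<Longrightarrow> x \<in> X \<Longrightarrow> c > 0 \<Longrightarrow> \<exists>k\<in>I. F k (c *\<^sub>R x) \<le> c * F i x"
  shows "sublinear_on X (\<lambda>x. INF i\<in>I. F i x)"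
  unfolding sublinear_on_def
proof (intro conjI ballI allI impI)
  fix x y assume x: "x \<in> X" and y: "y \<in> X"
  have "(INF i\<in>I. F i (x + y)) \<le> F i x + F j y" if "i \<in> I" "j \<in> I" for i j
    using add[OF that x y] bdd[OF subspace_add[OF X x y]] by (meson cINF_lower2)
  then have "(INF i\<in>I. F i (x + y)) - F j y \<le> (INF i\<in>I. F i x)" if "j \<in> I" for j
    using that I by (intro cINF_greatest) (auto simp: field_simps)
  then have "(INF i\<in>I. F i (x + y)) - (INF i\<in>I. F i x) \<le> (INF i\<in>I. F i y)"
    using I by (intro cINF_greatest) (auto simp: algebra_simps)
  then show "(INF i\<in>I. F i (x + y)) \<le> (INF i\<in>I. F i x) + (INF i\<in>I. F i y)" by simp
next
  fix x and c :: real assume x: "x \<in> X" and c: "c > 0"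
  have "(INF i\<in>I. F i (c *\<^sub>R x)) \<le> c * F i x" if "i \<in> I" for i
    using scale[OF that x c] bdd[OF subspace_scale[OF X x]] by (meson cINF_lower2)
  then have "(INF i\<in>I. F i (c *\<^sub>R x)) / c \<le> (INF i\<in>I. F i x)"
    using I c by (intro cINF_greatest) (auto simp: field_simps)
  then show "(INF i\<in>I. F i (c *\<^sub>R x)) \<le> c * (INF i\<in>I. F i x)" using c by (simp add: field_simps)
qed

text \<open>Zorn's lemma, with pointwise smaller functionals counting as larger elements. The
  infimum of a chain stays finite because every sublinear \<open>q \<le> p\<close> satisfies
  \<open>q x \<ge> - p (- x)\<close>.\<close>

lemma sublinear_on_minimal:
  assumes p: "sublinear_on X p" and X: "subspace X"
  obtains q where "sublinear_on X q" "\<And>x. x \<in> X \<Longrightarrow> q x \<le> p x"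
    "\<And>r x. sublinear_on X r \<Longrightarrow> (\<And>x. x \<in> X \<Longrightarrow> r x \<le> q x) \<Longrightarrow> x \<in> X \<Longrightarrow> r x = q x"
proof -
  \<comment> \<open>Functionals are set to 0 off \<open>X\<close>, so that agreement on
    \<open>X\<close> is equality and the order is antisymmetric.\<close>
  define A where "A = {q. sublinear_on X q \<and> (\<forall>x\<in>X. q x \<le> p x) \<and> (\<forall>x. x \<notin> X \<longrightarrow> q x = 0)}"
  define P where "P = (\<lambda>q r :: 'a \<Rightarrow> real. \<forall>x\<in>X. r x \<le> q x)"
  have restr: "(\<lambda>x. if x \<in> X then r x else 0) \<in> A" if "sublinear_on X r" "\<forall>x\<in>X. r x \<le> p x" for r
    using that subspace_add[OF X] subspace_scale[OF X] unfolding A_def sublinear_on_def by simp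
  have lower: "- p (- x) \<le> q x" if "q \<in> A" "x \<in> X" for q x
    using that sublinear_on_lower[of X q x 0] sublinear_on_zero[of X q] X subspace_neg[OF X]
    unfolding A_def by (force simp: subspace_0)
  have "\<exists>m\<in>A. \<forall>a\<in>A. P m a \<longrightarrow> a = m"
  proof (rule predicate_Zorn)
    show "partial_order_on A (relation_of P A)"
      unfolding partial_order_on_def preorder_on_def refl_on_def trans_on_def antisym_def relation_of_def
    proof (auto simp: P_def)
      fix x y z :: "'a \<Rightarrow> real" and w assume "\<forall>w\<in>X. y w \<le> x w" "\<forall>w\<in>X. z w \<le> y w" "w \<in> X"
      then show "z w \<le> x w" by force
    next
      fix x y assume "x \<in> A" "y \<in> A" "\<forall>w\<in>X. y w \<le> x w" "\<forall>w\<in>X. x w \<le> y w"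
      then show "x = y" unfolding A_def fun_eq_iff mem_Collect_eq by (metis order_antisym)
    qed
  next
    fix C assume C: "C \<in> Chains (relation_of P A)"
    then have CA: "C \<subseteq> A" and tot: "\<And>a b. a \<in> C \<Longrightarrow> b \<in> C \<Longrightarrow> P a b \<or> P b a"
      unfolding Chains_def relation_of_def by auto
    show "\<exists>u\<in>A. \<forall>a\<in>C. P a u"
    proof (cases "C = {}")
      case True
      then show ?thesis using restr[OF p] by auto
    next
      case False
      have bdd: "bdd_below ((\<lambda>q. q x) ` C)" if "x \<in> X" for x
        using lower[OF _ that] CA by (intro bdd_belowI2[of _ "- p (- x)"]) auto
      have "sublinear_on X (\<lambda>x. INF q\<in>C. q x)"
      proof (rule sublinear_on_INF[OF False bdd X])
        fix q r x y assume qr: "q \<in> C" "r \<in> C" and xy: "x \<in> X" "y \<in> X"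
        then have "sublinear_on X q" "sublinear_on X r" using CA unfolding A_def by auto
        then have "q (x + y) \<le> q x + q y" "r (x + y) \<le> r x + r y"
          using xy by (auto intro: sublinear_on_add)
        \<comment> \<open>The pointwise smaller member of the pair serves as \<open>k\<close>:
          either \<open>q y\<close> may be replaced by \<open>r y\<close>, or \<open>r x\<close> by
          \<open>q x\<close>.\<close>
        moreover have "q y \<le> r y \<or> r x \<le> q x"
          using tot[OF qr] xy unfolding P_def by auto
        ultimately have "q (x + y) \<le> q x + r y \<or> r (x + y) \<le> q x + r y"
          by linarith
        then show "\<exists>k\<in>C. k (x + y) \<le> q x + r y"
          using qr by blast
      next
        fix q x and c :: real assume "q \<in> C" "x \<in> X" "c > 0"
        then show "\<exists>k\<in>C. k (c *\<^sub>R x) \<le> c * q x"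
          using CA unfolding A_def sublinear_on_def by blast
      qed
      moreover have "(INF q\<in>C. q x) \<le> q x" if "q \<in> C" "x \<in> X" for q x
        using that bdd by (meson cINF_lower)
      moreover have "(INF q\<in>C. q x) \<le> p x" if "x \<in> X" for x
      proof -
        obtain q where "q \<in> C" using False by auto
        then have "q x \<le> p x" using CA that unfolding A_def by auto
        then show ?thesis using calculation(2)[OF \<open>q \<in> C\<close> that] by simp
      qed
      ultimately show ?thesis
        by (intro bexI[OF _ restr]) (auto simp: P_def)
    qed
  qed
  then obtain m where m: "m \<in> A" "\<And>a. a \<in> A \<Longrightarrow> P m a \<Longrightarrow> a = m" by auto
  show ?thesis
  proof (rule that[of m])
    show "sublinear_on X m" using m(1) unfolding A_def by auto
    show mp: "m x \<le> p x" if "x \<in> X" for x using m(1) that unfolding A_def by auto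
    fix r x assume r: "sublinear_on X r" "\<And>x. x \<in> X \<Longrightarrow> r x \<le> m x" and x: "x \<in> X"
    then have "\<forall>x\<in>X. r x \<le> p x" using mp by force
    from m(2)[OF restr[OF r(1) this]] r(2) have "(\<lambda>x. if x \<in> X then r x else 0) = m"
      unfolding P_def by auto
    then show "r x = m x" using x by (auto simp: fun_eq_iff split: if_splits)
  qed
qed

text \<open>The functional \<open>x \<mapsto> inf\<^bsub>t \<ge> 0\<^esub> q (x + t y) - t q y\<close> is sublinear and below \<open>q\<close>, hence equal to \<open>q\<close>.\<close>
lemma sublinear_on_minimal_linear:
  assumes q: "sublinear_on X q" and X: "subspace X"
    and min: "\<And>r x. sublinear_on X r \<Longrightarrow> (\<And>x. x \<in> X \<Longrightarrow> r x \<le> q x) \<Longrightarrow> x \<in> X \<Longrightarrow> r x = q x"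
    and x: "x \<in> X" and y: "y \<in> X"
  shows "q (x + y) = q x + q y"
proof -
  define F where "F = (\<lambda>(t::real) x. q (x + t *\<^sub>R y) - t * q y)"
  have low: "- q (- x) \<le> F t x" if "t \<ge> 0" "x \<in> X" for t x
    using sublinear_on_lower[OF q X that(2) subspace_scale[OF X y, of t]]
      sublinear_on_scale[OF q X y that(1)] unfolding F_def by simp
  have bdd: "bdd_below ((\<lambda>t. F t x) ` {0..})" if "x \<in> X" for x
    using low[OF _ that] by (intro bdd_belowI2[of _ "- q (- x)"]) auto
  have sub: "sublinear_on X (\<lambda>x. INF t\<in>{0..}. F t x)"
  proof (rule sublinear_on_INF[OF _ bdd X])
    fix s t x z assume *: "s \<in> {0::real..}" "t \<in> {0::real..}" "x \<in> X" "z \<in> X"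
    have "q ((x + s *\<^sub>R y) + (z + t *\<^sub>R y)) \<le> q (x + s *\<^sub>R y) + q (z + t *\<^sub>R y)"
      using * y by (intro sublinear_on_add[OF q] subspace_add[OF X] subspace_scale[OF X])
    then show "\<exists>k\<in>{0..}. F k (x + z) \<le> F s x + F t z"
      using * by (intro bexI[of _ "s + t"]) (auto simp: F_def algebra_simps)
  next
    fix t x and c :: real assume *: "t \<in> {0::real..}" "x \<in> X" "c > 0"
    have "q (c *\<^sub>R (x + t *\<^sub>R y)) = c * q (x + t *\<^sub>R y)"
      using * y by (intro sublinear_on_scale[OF q X] subspace_add[OF X] subspace_scale[OF X]) auto
    then show "\<exists>k\<in>{0..}. F k (c *\<^sub>R x) \<le> c * F t x"
      using * by (intro bexI[of _ "c * t"]) (auto simp: F_def algebra_simps)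
  qed auto
  have le: "(INF t\<in>{0..}. F t x) \<le> q x" if "x \<in> X" for x
    using cINF_lower[OF bdd[OF that], of 0] by (simp add: F_def)
  \<comment> \<open>The member \<open>t = 1\<close> of the infimum is
    \<open>q (x + y) - q y\<close>, so minimality yields superadditivity.\<close>
  have "q x = (INF t\<in>{0..}. F t x)" using min[OF sub le x] by simp
  also have "\<dots> \<le> F 1 x" by (rule cINF_lower[OF bdd[OF x]]) simp
  finally have "q x + q y \<le> q (x + y)" by (simp add: F_def)
  with sublinear_on_add[OF q x y] show ?thesis by simp
qed

text \<open>Hahn-Banach with prescribed lower bounds on a convex cone. The infimum of
  \<open>p (x + s) - c\<close> over \<open>(s, c) \<in> S\<close> is sublinear because
  \<open>S\<close> is a cone, and finite because \<open>c \<le> p s\<close>. A linear functional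
  below it is below \<open>p\<close> by the element \<open>0\<close>, and its value at
  \<open>- s\<close> is at most \<open>p 0 - c = - c\<close>.\<close>

theorem mazur_orlicz:
  fixes p :: "'v::real_vector \<Rightarrow> real" and S :: "('v \<times> real) set"
  assumes p: "sublinear_on X p" and X: "subspace X"
    and S0: "0 \<in> S" and S_add: "\<And>a b. a \<in> S \<Longrightarrow> b \<in> S \<Longrightarrow> a + b \<in> S"
    and S_scale: "\<And>a c. a \<in> S \<Longrightarrow> c > 0 \<Longrightarrow> c *\<^sub>R a \<in> S"
    and SX: "\<And>s c. (s, c) \<in> S \<Longrightarrow> s \<in> X" and le: "\<And>s c. (s, c) \<in> S \<Longrightarrow> c \<le> p s"
  shows "\<exists>l. (\<forall>x\<in>X. \<forall>y\<in>X. l (x + y) = l x + l y) \<and> (\<forall>x\<in>X. \<forall>c. l (c *\<^sub>R x) = c * l x) \<and>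
    (\<forall>x\<in>X. l x \<le> p x) \<and> (\<forall>(s, c)\<in>S. c \<le> l s)"
proof -
  define F where "F = (\<lambda>a x. p (x + fst a) - snd a)"
  have low: "- p (- x) \<le> F a x" if "a \<in> S" "x \<in> X" for a x
    using sublinear_on_lower[OF p X that(2) SX[of "fst a" "snd a"]] le[of "fst a" "snd a"] that
    unfolding F_def by simp
  have bdd: "bdd_below ((\<lambda>a. F a x) ` S)" if "x \<in> X" for x
    using low[OF _ that] by (intro bdd_belowI2[of _ "- p (- x)"]) auto
  have fstX: "fst a \<in> X" if "a \<in> S" for a using SX[of "fst a" "snd a"] that by simp
  have sub: "sublinear_on X (\<lambda>x. INF a\<in>S. F a x)"
  proof (rule sublinear_on_INF[OF _ bdd X])
    fix a b x z assume *: "a \<in> S" "b \<in> S" "x \<in> X" "z \<in> X"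
    have "p ((x + fst a) + (z + fst b)) \<le> p (x + fst a) + p (z + fst b)"
      using * fstX by (intro sublinear_on_add[OF p] subspace_add[OF X])
    then show "\<exists>k\<in>S. F k (x + z) \<le> F a x + F b z"
      using * by (intro bexI[of _ "a + b"] S_add) (auto simp: F_def algebra_simps)
  next
    fix a x and c :: real assume *: "a \<in> S" "x \<in> X" "c > 0"
    have "p (c *\<^sub>R (x + fst a)) = c * p (x + fst a)"
      using * fstX by (intro sublinear_on_scale[OF p X] subspace_add[OF X]) auto
    then show "\<exists>k\<in>S. F k (c *\<^sub>R x) \<le> c * F a x"
      using * by (intro bexI[of _ "c *\<^sub>R a"] S_scale) (auto simp: F_def algebra_simps)
  qed (use S0 in auto)
  obtain q where q: "sublinear_on X q" "\<And>x. x \<in> X \<Longrightarrow> q x \<le> (INF a\<in>S. F a x)"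
    and min: "\<And>r x. sublinear_on X r \<Longrightarrow> (\<And>x. x \<in> X \<Longrightarrow> r x \<le> q x) \<Longrightarrow> x \<in> X \<Longrightarrow> r x = q x"
    using sublinear_on_minimal[OF sub X] by blast
  have qF: "q x \<le> F a x" if "x \<in> X" "a \<in> S" for x a
    using q(2)[OF that(1)] cINF_lower[OF bdd[OF that(1)] that(2)] by simp
  have add: "q (x + y) = q x + q y" if "x \<in> X" "y \<in> X" for x y
    by (rule sublinear_on_minimal_linear[OF q(1) X _ that]) (fact min)
  have neg: "q (- x) = - q x" if "x \<in> X" for x
    using add[OF that subspace_neg[OF X that]] sublinear_on_zero[OF q(1) X] by simp
  show ?thesis
  proof (intro exI[of _ q] conjI ballI allI)
    show "q (x + y) = q x + q y" if "x \<in> X" "y \<in> X" for x y using that by (rule add)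
    fix c x assume x: "x \<in> X"
    show "q (c *\<^sub>R x) = c * q x"
    proof (cases "c \<ge> 0")
      case True then show ?thesis by (rule sublinear_on_scale[OF q(1) X x])
    next
      case False
      then show ?thesis
        using sublinear_on_scale[OF q(1) X x, of "- c"] neg[OF subspace_scale[OF X x, of c]] by simp
    qed
  next
    fix x assume x: "x \<in> X"
    show "q x \<le> p x" using qF[OF x S0] by (simp add: F_def)
  next
    fix a assume "a \<in> S"
    then obtain s c where a: "a = (s, c)" and s: "(s, c) \<in> S" by (cases a) auto
    have "q (- s) \<le> F (s, c) (- s)" using s SX subspace_neg[OF X] by (intro qF) auto
    then show "case a of (s, c) \<Rightarrow> c \<le> q s"
      using neg[OF SX[OF s]] sublinear_on_zero[OF p X] by (simp add: F_def a)
  qed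
qed

subsection \<open>The dual of \<open>L\<^sup>1\<close>\<close>

text \<open>Adding \<open>C \<integral> f\<close> makes \<open>l\<close> positive, and an integrable weight \<open>\<rho> > 0\<close> turns it into a finite measure
  to which Radon-Nikodym applies.\<close>
lemma (in sigma_finite_measure) L1_dual_representation:
  fixes l :: "('a \<Rightarrow> real) \<Rightarrow> real"
  assumes add: "\<And>f g. integrable M f \<Longrightarrow> integrable M g \<Longrightarrow> l (\<lambda>x. f x + g x) = l f + l g"
    and scale: "\<And>c f. integrable M f \<Longrightarrow> l (\<lambda>x. c * f x) = c * l f"
    and bound: "\<And>f. integrable M f \<Longrightarrow> l f \<le> C * (\<integral>x. \<bar>f x\<bar> \<partial>M)"
    and C: "C \<ge> 0"
  obtains g where "g \<in> borel_measurable M" "AE x in M. \<bar>g x\<bar> \<le> C"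
    "\<And>f. integrable M f \<Longrightarrow> l f = (\<integral>x. g x * f x \<partial>M)"
proof -
  define L where "L f = l f + C * (\<integral>x. f x \<partial>M)" for f
  have L_add: "L (\<lambda>x. f x + g x) = L f + L g" if "integrable M f" "integrable M g" for f g
    using that by (simp add: L_def add algebra_simps)
  have L_scale: "L (\<lambda>x. c * f x) = c * L f" if "integrable M f" for c f
    using that by (simp add: L_def scale algebra_simps)
  have L_diff: "L (\<lambda>x. f x - g x) = L f - L g" if "integrable M f" "integrable M g" for f g
    using L_add[of f "\<lambda>x. -1 * g x"] L_scale[of g "-1"] that by simp
  have L_0: "L (\<lambda>x. 0) = 0" using L_scale[of "\<lambda>x. 0" 0] by simp
  have l_abs: "\<bar>l f\<bar> \<le> C * (\<integral>x. \<bar>f x\<bar> \<partial>M)" if "integrable M f" for f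
    using bound[OF that] bound[of "\<lambda>x. -1 * f x"] scale[of f "-1"] that by simp
  have L_abs: "\<bar>L f\<bar> \<le> 2 * C * (\<integral>x. \<bar>f x\<bar> \<partial>M)" if "integrable M f" for f
  proof -
    have "\<bar>C * (\<integral>x. f x \<partial>M)\<bar> \<le> C * (\<integral>x. \<bar>f x\<bar> \<partial>M)"
      using C integral_abs_bound[of M f] by (simp add: abs_mult mult_left_mono)
    with l_abs[OF that] show ?thesis unfolding L_def by linarith
  qed
  have L_nonneg: "0 \<le> L f" if "integrable M f" "\<And>x. 0 \<le> f x" for f
  proof -
    have "(\<integral>x. \<bar>f x\<bar> \<partial>M) = (\<integral>x. f x \<partial>M)" using that(2) by simp
    with l_abs[OF that(1)] show ?thesis by (simp add: L_def)
  qed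
  have L_null: "(\<lambda>i. L (F i)) \<longlonglongrightarrow> 0"
    if "\<And>i. integrable M (F i)" "(\<lambda>i. \<integral>x. \<bar>F i x\<bar> \<partial>M) \<longlonglongrightarrow> 0" for F :: "nat \<Rightarrow> 'a \<Rightarrow> real"
  proof (rule Lim_null_comparison)
    show "\<forall>\<^sub>F i in sequentially. norm (L (F i)) \<le> 2 * C * (\<integral>x. \<bar>F i x\<bar> \<partial>M)"
      using L_abs[OF that(1)] by simp
    show "(\<lambda>i. 2 * C * (\<integral>x. \<bar>F i x\<bar> \<partial>M)) \<longlonglongrightarrow> 0"
      by (rule tendsto_mult_right_zero[OF that(2)])
  qed
  obtain \<rho> :: "'a \<Rightarrow> real" where [measurable]: "\<rho> \<in> borel_measurable M" and \<rho>_pos: "\<And>x. 0 < \<rho> x"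
    and \<rho>_int: "integrable M \<rho>"
    using obtain_positive_integrable_function by metis
  have int_A: "integrable M (\<lambda>x. indicat_real A x * \<rho> x)" if "A \<in> sets M" for A
    using integrable_mult_indicator[OF that \<rho>_int] by simp
  \<comment> \<open>The weight gives every measurable set finite mass, even where the constant 1 is
    not integrable. Passing to \<open>ennreal\<close> loses nothing, as \<open>L\<close> is
    nonnegative on nonnegative functions.\<close>
  define m where "m A = ennreal (L (\<lambda>x. indicat_real A x * \<rho> x))" for A
  have m_fin: "m A \<noteq> \<infinity>" for A by (simp add: m_def)
  have "countably_additive (sets M) m"
  \<comment> \<open>For a finite additive set function, continuity at the empty set gives countable
    additivity; it follows by dominated convergence with majorant \<open>\<rho>\<close>.\<close>
  proof (rule sets.empty_continuous_imp_countably_additive)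
    show "positive (sets M) m" by (simp add: positive_def m_def L_0)
    show "additive (sets M) m"
      unfolding additive_def
    proof (intro ballI impI)
      fix A B assume AB: "A \<in> sets M" "B \<in> sets M" "A \<inter> B = {}"
      have "(\<lambda>x. indicat_real (A \<union> B) x * \<rho> x) = (\<lambda>x. indicat_real A x * \<rho> x + indicat_real B x * \<rho> x)"
        using AB(3) by (auto simp: fun_eq_iff indicator_def)
      then have "L (\<lambda>x. indicat_real (A \<union> B) x * \<rho> x)
          = L (\<lambda>x. indicat_real A x * \<rho> x) + L (\<lambda>x. indicat_real B x * \<rho> x)"
        using L_add[OF int_A[OF AB(1)] int_A[OF AB(2)]] by simp
      then show "m (A \<union> B) = m A + m B"
        unfolding m_def using AB \<rho>_pos
        by (simp add: L_nonneg int_A less_imp_le flip: ennreal_plus)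
    qed
    show "(\<lambda>i. m (A i)) \<longlonglongrightarrow> 0" if A: "range A \<subseteq> sets M" "decseq A" "(\<Inter>i. A i) = {}" for A
    proof -
      have "(\<lambda>i. \<integral>x. indicat_real (A i) x * \<rho> x \<partial>M) \<longlonglongrightarrow> (\<integral>x. 0 \<partial>M)"
      proof (rule integral_dominated_convergence[where w=\<rho>])
        show "AE x in M. (\<lambda>i. indicat_real (A i) x * \<rho> x) \<longlonglongrightarrow> 0"
        proof (rule AE_I2)
          fix x
          obtain i where "x \<notin> A i" using A(3) by auto
          then have "indicat_real (A j) x * \<rho> x = 0" if "j \<ge> i" for j
            using A(2) that unfolding decseq_def by (auto simp: indicator_def)
          then show "(\<lambda>i. indicat_real (A i) x * \<rho> x) \<longlonglongrightarrow> 0"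
            by (intro tendsto_eventually) (auto simp: eventually_sequentially)
        qed
      qed (use A \<rho>_int \<rho>_pos in \<open>auto simp: indicator_def less_imp_le\<close>)
      then have "(\<lambda>i. L (\<lambda>x. indicat_real (A i) x * \<rho> x)) \<longlonglongrightarrow> 0"
        using A(1) \<rho>_pos by (intro L_null int_A) (auto simp: abs_mult abs_of_pos)
      then show ?thesis unfolding m_def using tendsto_ennrealI by fastforce
    qed
  qed (simp_all add: m_def)
  moreover have "positive (sets M) m" by (simp add: positive_def m_def L_0)
  moreover define N where "N = measure_of (space M) (sets M) m"
  ultimately have N: "emeasure N A = m A" if "A \<in> sets M" for A
    using that emeasure_measure_of_sigma sets.sigma_algebra_axioms by metis
  have sets_N: "sets N = sets M" unfolding N_def by simp
  have "absolutely_continuous M N"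
    unfolding absolutely_continuous_def
  proof
    fix A assume A: "A \<in> null_sets M"
    have "AE x in M. indicat_real A x * \<rho> x = 0"
      using AE_not_in[OF A] by eventually_elim (auto simp: indicator_def)
    then have "(\<integral>x. \<bar>indicat_real A x * \<rho> x\<bar> \<partial>M) = 0"
      by (intro integral_eq_zero_AE) auto
    then have "m A = 0" using L_abs[OF int_A[of A]] A unfolding m_def by auto
    then show "A \<in> null_sets N" using A N[of A] sets_N by (auto simp: null_sets_def)
  qed
  then obtain D where [measurable]: "D \<in> borel_measurable M" and D: "density M D = N"
    using Radon_Nikodym[OF _ sets_N] by blast
  have mD: "m A = (\<integral>\<^sup>+x. D x * indicator A x \<partial>M)" if "A \<in> sets M" for A
    using N[OF that] D emeasure_density[of D M A] that by simp
  define d where "d x = enn2real (D x)" for x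
  have [measurable]: "d \<in> borel_measurable M" unfolding d_def by measurable
  have "(\<integral>\<^sup>+x. D x \<partial>M) \<noteq> \<infinity>" 
    using mD[of "space M"] m_fin[of "space M"] by (simp cong: nn_integral_cong)
  then have "AE x in M. D x \<noteq> \<infinity>" by (intro nn_integral_PInf_AE) simp_all
  then have Dd: "AE x in M. D x = ennreal (d x)" unfolding d_def by eventually_elim (simp add: less_top)
  have d_nonneg: "0 \<le> d x" for x by (simp add: d_def)
  have d_int: "integrable M d"
  proof (rule integrableI_nonneg)
    have "(\<integral>\<^sup>+x. ennreal (d x) \<partial>M) = (\<integral>\<^sup>+x. D x \<partial>M)"
      using Dd by (intro nn_integral_cong_AE) auto
    then show "(\<integral>\<^sup>+x. ennreal (d x) \<partial>M) < \<infinity>"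
      using \<open>(\<integral>\<^sup>+x. D x \<partial>M) \<noteq> \<infinity>\<close> by (simp add: less_top)
  qed (simp_all add: d_nonneg)
  have Ld: "L (\<lambda>x. indicat_real A x * \<rho> x) = (\<integral>x. indicat_real A x * d x \<partial>M)" if "A \<in> sets M" for A
  proof -
    have "ennreal (L (\<lambda>x. indicat_real A x * \<rho> x)) = (\<integral>\<^sup>+x. ennreal (indicat_real A x * d x) \<partial>M)"
      using Dd that unfolding m_def[symmetric] mD[OF that]
      by (intro nn_integral_cong_AE) (auto simp: indicator_def elim!: eventually_mono)
    also have "\<dots> = ennreal (\<integral>x. indicat_real A x * d x \<partial>M)"
      using integrable_mult_indicator[OF that d_int] d_nonneg by (intro nn_integral_eq_integral) auto
    finally show ?thesis
      using L_nonneg[OF int_A[OF that]] \<rho>_pos d_nonneg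
      by (subst (asm) ennreal_inj) (auto intro!: integral_nonneg simp: less_imp_le)
  qed
  \<comment> \<open>The constant \<open>2 C\<close> is that of \<open>L_abs\<close>: one
    \<open>C\<close> from \<open>l\<close> and one from the added integral.\<close>
  have d_le: "AE x in M. d x \<le> 2 * C * \<rho> x"
  proof -
    have "AE x in M. 0 \<le> 2 * C * \<rho> x - d x"
    proof (rule density_nonneg)
      show int: "integrable M (\<lambda>x. 2 * C * \<rho> x - d x)" using \<rho>_int d_int by simp
      fix A assume A: "A \<in> sets M"
      have "set_lebesgue_integral M A (\<lambda>x. 2 * C * \<rho> x - d x)
          = (\<integral>x. 2 * C * (indicat_real A x * \<rho> x) - indicat_real A x * d x \<partial>M)"
        unfolding set_lebesgue_integral_def by (simp add: algebra_simps)
      also have "\<dots> = 2 * C * (\<integral>x. indicat_real A x * \<rho> x \<partial>M) - L (\<lambda>x. indicat_real A x * \<rho> x)"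
        using int_A[OF A] integrable_mult_indicator[OF A d_int] by (simp add: Ld[OF A])
      also have "\<dots> \<ge> 0" using L_abs[OF int_A[OF A]] \<rho>_pos by (simp add: abs_mult abs_of_pos)
      finally show "set_lebesgue_integral M A (\<lambda>x. 2 * C * \<rho> x - d x) \<ge> 0" .
    qed
    then show ?thesis by simp
  qed
  \<comment> \<open>With respect to the density \<open>\<rho>\<close>, the indicators from which
    \<open>integrable_induct\<close> starts correspond to the functions
    \<open>indicat_real A x * \<rho> x\<close>, on which \<open>L\<close> is already known by
    \<open>Ld\<close>.\<close>
  define M' where "M' = density M (\<lambda>x. ennreal (\<rho> x))"
  have M'_int: "integrable M' q \<longleftrightarrow> integrable M (\<lambda>x. \<rho> x * q x)" if "q \<in> borel_measurable M"
    for q :: "'a \<Rightarrow> real"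
    unfolding M'_def using integrable_density[of q M \<rho>] that \<rho>_pos by (simp add: less_imp_le)
  have meas: "q \<in> borel_measurable M" if "integrable M' q" for q :: "'a \<Rightarrow> real"
    using borel_measurable_integrable[OF that] by (simp add: M'_def)
  have dq_int: "integrable M (\<lambda>x. d x * q x)" if "integrable M' q" for q
  proof (rule Bochner_Integration.integrable_bound)
    show "integrable M (\<lambda>x. 2 * C * (\<rho> x * q x))" using M'_int[OF meas[OF that]] that by simp
    show "AE x in M. norm (d x * q x) \<le> norm (2 * C * (\<rho> x * q x))"
      using d_le
    proof eventually_elim
      case (elim x)
      then have "d x * \<bar>q x\<bar> \<le> 2 * C * \<rho> x * \<bar>q x\<bar>" by (intro mult_right_mono) auto
      then show ?case using d_nonneg[of x] \<rho>_pos[of x] C by (simp add: abs_mult algebra_simps)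
    qed
    show "(\<lambda>x. d x * q x) \<in> borel_measurable M" using meas[OF that] by measurable
  qed
  have L_eq: "L (\<lambda>x. \<rho> x * q x) = (\<integral>x. d x * q x \<partial>M)" if "integrable M' q" for q
    using that
  proof (induction q rule: integrable_induct)
    case (base A c)
    then have A: "A \<in> sets M" by (simp add: M'_def)
    have "L (\<lambda>x. c * (indicat_real A x * \<rho> x)) = c * (\<integral>x. indicat_real A x * d x \<partial>M)"
      using L_scale[OF int_A[OF A]] Ld[OF A] by simp
    moreover have "(\<lambda>x. \<rho> x * indicat_real A x *\<^sub>R c) = (\<lambda>x. c * (indicat_real A x * \<rho> x))"
      "(\<lambda>x. d x * indicat_real A x *\<^sub>R c) = (\<lambda>x. c * (indicat_real A x * d x))"
      by (auto simp: fun_eq_iff)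
    ultimately show ?case by (simp only: integral_mult_right_zero)
  next
    case (add f g)
    have "integrable M (\<lambda>x. \<rho> x * f x)" "integrable M (\<lambda>x. \<rho> x * g x)"
      using M'_int[OF meas] add(1,2) by blast+
    then have "L (\<lambda>x. \<rho> x * f x + \<rho> x * g x) = (\<integral>x. d x * f x \<partial>M) + (\<integral>x. d x * g x \<partial>M)"
      using L_add add(3,4) by simp
    also have "\<dots> = (\<integral>x. d x * f x + d x * g x \<partial>M)"
      using dq_int add(1,2) by simp
    finally show ?case by (simp only: distrib_left)
  next
    case (lim f s)
    have [measurable]: "f \<in> borel_measurable M" "\<And>i. s i \<in> borel_measurable M"
      using lim by (auto intro: meas)
    have sp: "space M' = space M" by (simp add: M'_def)
    have fi: "integrable M (\<lambda>x. \<rho> x * f x)" and si: "\<And>i. integrable M (\<lambda>x. \<rho> x * s i x)"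
      using lim M'_int by auto
    have "(\<lambda>i. \<integral>x. d x * s i x \<partial>M) \<longlonglongrightarrow> (\<integral>x. d x * f x \<partial>M)"
    proof (rule integral_dominated_convergence[where w="\<lambda>x. 2 * \<bar>d x * f x\<bar>"])
      show "AE x in M. (\<lambda>i. d x * s i x) \<longlonglongrightarrow> d x * f x"
        using lim sp by (intro AE_I2 tendsto_mult_left) auto
      show "AE x in M. norm (d x * s i x) \<le> 2 * \<bar>d x * f x\<bar>" for i
      proof (rule AE_I2)
        fix x assume "x \<in> space M"
        then have "\<bar>s i x\<bar> \<le> 2 * \<bar>f x\<bar>" using lim(3) sp by auto
        then have "d x * \<bar>s i x\<bar> \<le> d x * (2 * \<bar>f x\<bar>)"
          using d_nonneg by (intro mult_left_mono) auto
        then show "norm (d x * s i x) \<le> 2 * \<bar>d x * f x\<bar>"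
          using d_nonneg[of x] by (simp add: abs_mult)
      qed
      show "integrable M (\<lambda>x. 2 * \<bar>d x * f x\<bar>)" using dq_int[OF lim(4)] by simp
    qed auto
    moreover have "(\<lambda>i. L (\<lambda>x. \<rho> x * s i x)) \<longlonglongrightarrow> L (\<lambda>x. \<rho> x * f x)"
    proof -
      \<comment> \<open>\<open>integrable_induct\<close> supplies \<open>|s i| \<le> 2 |f|\<close>,
        hence the majorant with factor 3 for the difference.\<close>
      have "(\<lambda>i. \<integral>x. \<bar>\<rho> x * s i x - \<rho> x * f x\<bar> \<partial>M) \<longlonglongrightarrow> (\<integral>x. 0 \<partial>M)"
      proof (rule integral_dominated_convergence[where w="\<lambda>x. 3 * \<bar>\<rho> x * f x\<bar>"])
        show "AE x in M. (\<lambda>i. \<bar>\<rho> x * s i x - \<rho> x * f x\<bar>) \<longlonglongrightarrow> 0"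
        proof (rule AE_I2)
          fix x assume "x \<in> space M"
          then have "(\<lambda>i. \<bar>\<rho> x * s i x - \<rho> x * f x\<bar>) \<longlonglongrightarrow> \<bar>\<rho> x * f x - \<rho> x * f x\<bar>"
            using lim(2) sp by (intro tendsto_intros) auto
          then show "(\<lambda>i. \<bar>\<rho> x * s i x - \<rho> x * f x\<bar>) \<longlonglongrightarrow> 0" by simp
        qed
        show "AE x in M. norm \<bar>\<rho> x * s i x - \<rho> x * f x\<bar> \<le> 3 * \<bar>\<rho> x * f x\<bar>" for i
        proof (rule AE_I2)
          fix x assume "x \<in> space M"
          then have "\<bar>s i x\<bar> \<le> 2 * \<bar>f x\<bar>" using lim(3) sp by auto
          then have "\<bar>s i x - f x\<bar> \<le> 3 * \<bar>f x\<bar>" by linarith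
          then have "\<rho> x * \<bar>s i x - f x\<bar> \<le> \<rho> x * (3 * \<bar>f x\<bar>)"
            using \<rho>_pos by (intro mult_left_mono) (auto simp: less_imp_le)
          moreover have "\<rho> x * s i x - \<rho> x * f x = \<rho> x * (s i x - f x)"
            by (simp add: algebra_simps)
          ultimately show "norm \<bar>\<rho> x * s i x - \<rho> x * f x\<bar> \<le> 3 * \<bar>\<rho> x * f x\<bar>"
            using \<rho>_pos[of x] by (simp add: abs_mult mult_ac)
        qed
        show "integrable M (\<lambda>x. 3 * \<bar>\<rho> x * f x\<bar>)" using fi by simp
      qed auto
      then have "(\<lambda>i. L (\<lambda>x. \<rho> x * s i x - \<rho> x * f x)) \<longlonglongrightarrow> 0"
        using fi si by (intro L_null) auto
      then show ?thesis using L_diff fi si by (simp add: LIM_zero_iff)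
    qed
    ultimately show ?case using lim(5) by (simp add: LIMSEQ_unique)
  qed
  \<comment> \<open>This undoes both modifications: the weight is divided out, and the
    \<open>C\<close> that made \<open>L\<close> positive is subtracted. The bounds
    \<open>0 \<le> d \<le> 2 C \<rho>\<close> become \<open>|g| \<le> C\<close>.\<close>
  define g where "g x = d x / \<rho> x - C" for x
  show ?thesis
  proof (rule that[of g])
    show "g \<in> borel_measurable M" unfolding g_def by measurable
    show "AE x in M. \<bar>g x\<bar> \<le> C"
      using d_le
    proof eventually_elim
      case (elim x)
      then have "d x / \<rho> x \<le> 2 * C" "0 \<le> d x / \<rho> x"
        using \<rho>_pos[of x] d_nonneg[of x] by (auto simp: field_simps)
      then show ?case unfolding g_def by linarith
    qed
    fix f :: "'a \<Rightarrow> real" assume f: "integrable M f"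
    have eq: "\<rho> x * (f x / \<rho> x) = f x" for x using \<rho>_pos[of x] by simp
    have [measurable]: "f \<in> borel_measurable M" using f by auto
    have "(\<lambda>x. f x / \<rho> x) \<in> borel_measurable M" by measurable
    from M'_int[OF this] have f': "integrable M' (\<lambda>x. f x / \<rho> x)" using f by (simp only: eq)
    have "(\<integral>x. g x * f x \<partial>M) = (\<integral>x. d x * (f x / \<rho> x) - C * f x \<partial>M)"
      unfolding g_def by (simp add: algebra_simps)
    also have "\<dots> = L f - C * (\<integral>x. f x \<partial>M)"
      using dq_int[OF f'] f L_eq[OF f', unfolded eq] by simp
    finally show "l f = (\<integral>x. g x * f x \<partial>M)" by (simp add: L_def)
  qed
qed

subsection \<open>Test functions and convolution\<close>

text \<open>Continuity is asked only of the derivatives along basis vectors; in finite dimension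
  this is the same as continuity of the derivative in the operator norm.\<close>

lemma C1cI:
  fixes \<psi> :: "'a::euclidean_space \<Rightarrow> 'b::euclidean_space"
  assumes D: "\<And>x. (\<psi> has_derivative D x) (at x)"
    and cont: "\<And>i. i \<in> Basis \<Longrightarrow> continuous_on UNIV (\<lambda>x. D x i)"
    and supp: "\<And>x. norm x > r \<Longrightarrow> \<psi> x = 0"
  shows "C1c \<psi>"
  unfolding C1c_def
proof (intro conjI exI[of _ "\<lambda>x. Blinfun (D x)"] allI)
  have app: "blinfun_apply (Blinfun (D x)) = D x" for x
    using bounded_linear_Blinfun_apply[OF has_derivative_bounded_linear[OF D]] .
  show "(\<psi> has_derivative blinfun_apply (Blinfun (D x))) (at x)" for x
    using D by (simp add: app)
  show "continuous_on UNIV (\<lambda>x. Blinfun (D x))"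
    by (rule continuous_on_blinfun_componentwise) (simp add: app cont)
  have "{x. \<psi> x \<noteq> 0} \<subseteq> cball 0 r" using supp by (metis (mono_tags, lifting) mem_Collect_eq mem_cball_0 not_le subsetI)
  then have "bounded {x. \<psi> x \<noteq> 0}" by (rule bounded_subset[OF bounded_cball])
  then show "compact (closure {x. \<psi> x \<noteq> 0})"
    by (simp add: compact_closure)
qed

lemma C1c_has_derivative: "C1c \<psi> \<Longrightarrow> (\<psi> has_derivative frechet_derivative \<psi> (at x)) (at x)"
  unfolding C1c_def using frechet_derivative_at by metis

lemma C1c_continuous_derivative:
  assumes "C1c \<psi>" shows "continuous_on UNIV (\<lambda>x. frechet_derivative \<psi> (at x) h)"
proof -
  obtain D where D: "\<And>x. (\<psi> has_derivative blinfun_apply (D x)) (at x)" "continuous_on UNIV D"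
    using assms unfolding C1c_def by auto
  have "frechet_derivative \<psi> (at x) = blinfun_apply (D x)" for x
    using frechet_derivative_at[OF D(1)] by simp
  then show ?thesis using D(2) by (auto intro!: continuous_intros)
qed

lemma C1c_continuous: "C1c \<psi> \<Longrightarrow> continuous_on UNIV \<psi>"
  using C1c_has_derivative has_derivative_continuous continuous_at_imp_continuous_on by metis

text \<open>The strict inequality \<open>norm x > r\<close> describes an open set, and a function
  vanishing on an open set has vanishing derivative there.\<close>

lemma C1c_support:
  assumes "C1c \<psi>"
  obtains r where "r > 0" "\<And>x. norm x > r \<Longrightarrow> \<psi> x = 0"
    "\<And>x h. norm x > r \<Longrightarrow> frechet_derivative \<psi> (at x) h = 0"
proof -
  have "bounded {x. \<psi> x \<noteq> 0}" using assms unfolding C1c_def by (simp add: compact_closure)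
  then obtain r where r: "r > 0" "\<forall>x\<in>{x. \<psi> x \<noteq> 0}. norm x \<le> r" unfolding bounded_pos by blast
  then have 0: "\<psi> x = 0" if "norm x > r" for x using that by force
  have "frechet_derivative \<psi> (at x) h = 0" if "norm x > r" for x h
  proof -
    have "open {x. norm x > r}" by (intro open_Collect_less continuous_intros)
    then have "(\<psi> has_derivative (\<lambda>h. 0)) (at x)"
      by (rule has_derivative_transform_within_open[OF has_derivative_const[of 0]]) (use that 0 in auto)
    from fun_cong[OF frechet_derivative_at[OF this], of h] show ?thesis by simp
  qed
  with r(1) 0 that show ?thesis by blast
qed

lemma continuous_compact_support_bounded:
  fixes k :: "'a::euclidean_space \<Rightarrow> 'b::real_normed_vector"
  assumes "continuous_on UNIV k" "\<And>x. norm x > r \<Longrightarrow> k x = 0"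
  obtains B where "B \<ge> 0" "\<And>x. norm (k x) \<le> B"
proof -
  have "compact (k ` cball 0 r)"
    by (intro compact_continuous_image compact_cball continuous_on_subset[OF assms(1)]) auto
  then have "bounded (k ` cball 0 r)" by (rule compact_imp_bounded)
  then obtain B where B: "B > 0" "\<forall>y\<in>k ` cball 0 r. norm y \<le> B" unfolding bounded_pos by auto
  have "norm (k x) \<le> B" for x
    using B assms(2)[of x] by (cases "norm x \<le> r") auto
  then show ?thesis using B(1) by (intro that[of B]) auto
qed

lemma integrable_continuous_compact_support:
  fixes k :: "'a::euclidean_space \<Rightarrow> 'b::euclidean_space"
  assumes "continuous_on UNIV k" "\<And>x. norm x > r \<Longrightarrow> k x = 0"
  shows "integrable lborel k"
proof -
  have "integrable lborel (\<lambda>x. indicator (cball 0 r) x *\<^sub>R k x)"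
    by (intro borel_integrable_compact compact_cball continuous_on_subset[OF assms(1)]) auto
  moreover have "(\<lambda>x. indicator (cball 0 r) x *\<^sub>R k x) = k"
    using assms(2) by (auto simp: fun_eq_iff indicator_def)
  ultimately show ?thesis by simp
qed

lemma C1c_integrable: "C1c \<psi> \<Longrightarrow> integrable lborel \<psi>"
  using C1c_support[of \<psi>] integrable_continuous_compact_support[OF C1c_continuous] by metis

lemma C1c_integrable_derivative: "C1c \<psi> \<Longrightarrow> integrable lborel (\<lambda>x. frechet_derivative \<psi> (at x) h)"
  using C1c_support[of \<psi>] integrable_continuous_compact_support[OF C1c_continuous_derivative] by metis

lemma C1c_derivative_bound:
  assumes "C1c \<psi>"
  obtains B where "B \<ge> 0" "\<And>x h. norm (frechet_derivative \<psi> (at x) h) \<le> B * norm h"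
proof -
  obtain D where D: "\<And>x. (\<psi> has_derivative blinfun_apply (D x)) (at x)" "continuous_on UNIV D"
    using assms unfolding C1c_def by auto
  have eq: "frechet_derivative \<psi> (at x) = blinfun_apply (D x)" for x
    using frechet_derivative_at[OF D(1)] by simp
  obtain r where r: "\<And>x h. norm x > r \<Longrightarrow> frechet_derivative \<psi> (at x) h = 0"
    using C1c_support[OF assms] by metis
  have "D x = 0" if "norm x > r" for x
    using r[OF that] by (intro blinfun_eqI) (simp add: eq)
  then obtain B where "B \<ge> 0" "\<And>x. norm (D x) \<le> B"
    using continuous_compact_support_bounded[OF D(2)] by metis
  then show ?thesis
    by (intro that[of B]) (auto simp: eq intro: order_trans[OF norm_blinfun mult_right_mono])
qed

lemma C1c_lipschitz:
  assumes "C1c \<psi>"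
  obtains B where "B \<ge> 0" "\<And>x h. norm (\<psi> (x + h) - \<psi> x) \<le> B * norm h"
    "\<And>x h. norm (frechet_derivative \<psi> (at x) h) \<le> B * norm h"
proof -
  obtain B where B: "B \<ge> 0" "\<And>x h. norm (frechet_derivative \<psi> (at x) h) \<le> B * norm h"
    using C1c_derivative_bound[OF assms] by metis
  have "norm (\<psi> (x + h) - \<psi> x) \<le> B * norm (x + h - x)" for x h
    by (rule differentiable_bound[of UNIV \<psi> "\<lambda>x. frechet_derivative \<psi> (at x)"])
      (auto simp: C1c_has_derivative[OF assms] intro!: onorm_le B)
  with B show ?thesis by (intro that[of B]) auto
qed

lemma C1c_translate:
  assumes "C1c k"
  shows "C1c (\<lambda>y. k (x - y))"
    and "frechet_derivative (\<lambda>y. k (x - y)) (at y) h = - frechet_derivative k (at (x - y)) h"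
proof -
  have D: "((\<lambda>y. k (x - y)) has_derivative (\<lambda>h. - frechet_derivative k (at (x - y)) h)) (at y)" for y
  proof -
    have "((\<lambda>y. k (x - y)) has_derivative (\<lambda>h. frechet_derivative k (at (x - y)) (- h))) (at y)"
      by (rule has_derivative_compose[OF _ C1c_has_derivative[OF assms]]) (auto intro!: derivative_eq_intros)
    moreover have "frechet_derivative k (at (x - y)) (- h) = - frechet_derivative k (at (x - y)) h" for h
      using has_derivative_linear[OF C1c_has_derivative[OF assms]] by (simp add: linear_neg)
    ultimately show ?thesis by simp
  qed
  show "frechet_derivative (\<lambda>y. k (x - y)) (at y) h = - frechet_derivative k (at (x - y)) h"
    using frechet_derivative_at[OF D] by metis
  obtain r where r: "\<And>x. norm x > r \<Longrightarrow> k x = 0" using C1c_support[OF assms] by metis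
  show "C1c (\<lambda>y. k (x - y))"
  proof (rule C1cI[OF D])
    show "continuous_on UNIV (\<lambda>y. - frechet_derivative k (at (x - y)) i)" for i
      by (intro continuous_on_minus continuous_on_compose2[OF C1c_continuous_derivative[OF assms]]
          continuous_on_diff continuous_on_const continuous_on_id) auto
    show "k (x - y) = 0" if "norm y > norm x + r" for y
      using that norm_triangle_sub[of y x] by (intro r) (simp add: norm_minus_commute)
  qed
qed

lemma LIMSEQ_norm_bound:
  fixes X :: "nat \<Rightarrow> 'a::real_normed_vector"
  assumes "X \<longlonglongrightarrow> x" obtains R where "\<And>n. norm (X n) \<le> R"
  using convergent_imp_Bseq[OF convergentI[OF assms]] unfolding Bseq_def by auto

section \<open>Convolution of a bounded Borel function with a continuous or C1 kernel\<close>

context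
  fixes v :: "'a::euclidean_space \<Rightarrow> 'b::euclidean_space" and C :: real
  assumes v_meas [measurable]: "v \<in> borel_measurable borel" and v_bound: "\<And>y. norm (v y) \<le> C"
begin

lemma integrable_convolution:
  fixes q :: "'a \<Rightarrow> real"
  assumes q: "continuous_on UNIV q" and r: "\<And>x. norm x > r \<Longrightarrow> q x = 0"
  shows "integrable lborel (\<lambda>y. q (x - y) *\<^sub>R v y)"
proof (rule Bochner_Integration.integrable_bound)
  have [measurable]: "q \<in> borel_measurable borel"
    using q by (rule borel_measurable_continuous_onI)
  have "integrable lborel (\<lambda>y. q (x - y))"
  proof (rule integrable_continuous_compact_support)
    show "continuous_on UNIV (\<lambda>y. q (x - y))"
      by (rule continuous_on_compose2[OF q]) (auto intro!: continuous_intros)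
    show "q (x - y) = 0" if "norm y > norm x + r" for y
      using that norm_triangle_sub[of y x] by (intro r) (simp add: norm_minus_commute)
  qed
  then show "integrable lborel (\<lambda>y. C * q (x - y))" by simp
  show "AE y in lborel. norm (q (x - y) *\<^sub>R v y) \<le> norm (C * q (x - y))"
  proof (rule AE_I2)
    fix y
    have "\<bar>q (x - y)\<bar> * norm (v y) \<le> \<bar>q (x - y)\<bar> * \<bar>C\<bar>"
      using v_bound[of y] by (intro mult_left_mono) auto
    then show "norm (q (x - y) *\<^sub>R v y) \<le> norm (C * q (x - y))" by (simp add: abs_mult mult.commute)
  qed
  show "(\<lambda>y. q (x - y) *\<^sub>R v y) \<in> borel_measurable lborel" by measurable
qed

lemma continuous_convolution:
  fixes q :: "'a \<Rightarrow> real"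
  assumes q: "continuous_on UNIV q" and r: "\<And>x. norm x > r \<Longrightarrow> q x = 0"
  shows "continuous_on UNIV (\<lambda>x. \<integral>y. q (x - y) *\<^sub>R v y \<partial>lborel)"
proof (rule continuous_at_imp_continuous_on, intro ballI)
  fix x
  show "isCont (\<lambda>x. \<integral>y. q (x - y) *\<^sub>R v y \<partial>lborel) x"
    unfolding continuous_at_sequentially
  proof (intro allI impI)
    fix X assume X: "X \<longlonglongrightarrow> x"
    obtain R where R: "\<And>n. norm (X n) \<le> R" using LIMSEQ_norm_bound[OF X] by metis
    obtain B where B: "B \<ge> 0" "\<And>x. norm (q x) \<le> B"
      using continuous_compact_support_bounded[OF q r] by metis
    have [measurable]: "q \<in> borel_measurable borel"
      using q by (rule borel_measurable_continuous_onI)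
    have "(\<lambda>n. \<integral>y. q (X n - y) *\<^sub>R v y \<partial>lborel) \<longlonglongrightarrow> (\<integral>y. q (x - y) *\<^sub>R v y \<partial>lborel)"
    proof (rule integral_dominated_convergence[where w="\<lambda>y. (B * C) * indicator (cball 0 (R + r)) y"])
      show "AE y in lborel. (\<lambda>n. q (X n - y) *\<^sub>R v y) \<longlonglongrightarrow> q (x - y) *\<^sub>R v y"
        by (intro AE_I2 tendsto_scaleR tendsto_const continuous_on_tendsto_compose[OF q] tendsto_diff X) auto
      show "AE y in lborel. norm (q (X n - y) *\<^sub>R v y) \<le> (B * C) * indicator (cball 0 (R + r)) y" for n
      proof (rule AE_I2)
        fix y
        show "norm (q (X n - y) *\<^sub>R v y) \<le> (B * C) * indicator (cball 0 (R + r)) y"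
        proof (cases "norm y \<le> R + r")
          case True
          then show ?thesis using B v_bound[of y] by (auto intro!: mult_mono)
        next
          case False
          then have "norm (X n - y) > r"
            using R[of n] norm_triangle_sub[of y "X n"] by (simp add: norm_minus_commute)
          then show ?thesis using False by (simp add: r)
        qed
      qed
      show "integrable lborel (\<lambda>y. (B * C) * indicator (cball 0 (R + r)) y)"
        using emeasure_lborel_cball_finite[of 0 "R + r"]
        by (intro integrable_mult_right integrable_real_indicator) auto
    qed auto
    then show "((\<lambda>x. \<integral>y. q (x - y) *\<^sub>R v y \<partial>lborel) \<circ> X) \<longlonglongrightarrow> (\<integral>y. q (x - y) *\<^sub>R v y \<partial>lborel)"
      by (simp add: comp_def)
  qed
qed

text \<open>Dominated convergence for the normalised remainders \<open>Q\<close>, taken along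
  sequences \<open>H\<close> tending to 0. The majorant is \<open>2 B C\<close> on one fixed ball:
  one \<open>B\<close> for the increment of \<open>k\<close>, one for its derivative, and radius
  \<open>norm x + R + r\<close> since \<open>H\<close> stays within \<open>R\<close> and the kernel
  within \<open>r\<close>.\<close>

lemma has_derivative_convolution:
  fixes k :: "'a \<Rightarrow> real"
  assumes k: "C1c k"
  shows "((\<lambda>x. \<integral>y. k (x - y) *\<^sub>R v y \<partial>lborel) has_derivative
    (\<lambda>h. \<integral>y. frechet_derivative k (at (x - y)) h *\<^sub>R v y \<partial>lborel)) (at x)"
proof -
  define k' where "k' = (\<lambda>x. frechet_derivative k (at x))"
  have kD: "(k has_derivative k' x) (at x)" for x
    unfolding k'_def by (rule C1c_has_derivative[OF k])
  have lin: "linear (k' x)" for x using has_derivative_linear[OF kD] .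
  have contk: "continuous_on UNIV k" and contk': "continuous_on UNIV (\<lambda>x. k' x h)" for h
    unfolding k'_def by (rule C1c_continuous[OF k], rule C1c_continuous_derivative[OF k])
  have [measurable]: "k \<in> borel_measurable borel" "(\<lambda>x. k' x h) \<in> borel_measurable borel" for h
    using contk contk' by (auto intro: borel_measurable_continuous_onI)
  obtain r where r: "r > 0" "\<And>x. norm x > r \<Longrightarrow> k x = 0" "\<And>x h. norm x > r \<Longrightarrow> k' x h = 0"
    unfolding k'_def using C1c_support[OF k] by metis
  obtain B where B: "B \<ge> 0" "\<And>x h. norm (k (x + h) - k x) \<le> B * norm h" "\<And>x h. norm (k' x h) \<le> B * norm h"
    unfolding k'_def using C1c_lipschitz[OF k] by metis
  have int: "integrable lborel (\<lambda>y. k (x - y) *\<^sub>R v y)" "integrable lborel (\<lambda>y. k' (x - y) h *\<^sub>R v y)" for x h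
    using integrable_convolution[OF contk r(2)] integrable_convolution[OF contk' r(3)] by auto
  define F where "F = (\<lambda>x. \<integral>y. k (x - y) *\<^sub>R v y \<partial>lborel)"
  define G where "G = (\<lambda>h. \<integral>y. k' (x - y) h *\<^sub>R v y \<partial>lborel)"
  have "(F has_derivative G) (at x)"
    unfolding has_derivative_at
  proof
    have "linear G"
    proof (rule linearI)
      show "G (a + b) = G a + G b" for a b
        using int by (simp add: G_def linear_add[OF lin] scaleR_add_left)
      show "G (c *\<^sub>R a) = c *\<^sub>R G a" for c a
        by (simp add: G_def linear_scale[OF lin] flip: scaleR_scaleR)
    qed
    then show "bounded_linear G" by (simp add: linear_conv_bounded_linear)
    define Q where "Q = (\<lambda>h y. ((k (x - y + h) - k (x - y) - k' (x - y) h) / norm h) *\<^sub>R v y)"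
    have e: "x - y + h = x + h - y" for y h by simp
    have FQ: "norm (F (x + h) - F x - G h) / norm h = norm (\<integral>y. Q h y \<partial>lborel)" for h
    proof -
      have "(\<integral>y. Q h y \<partial>lborel)
          = (\<integral>y. (1 / norm h) *\<^sub>R (k (x + h - y) *\<^sub>R v y - k (x - y) *\<^sub>R v y - k' (x - y) h *\<^sub>R v y) \<partial>lborel)"
        by (intro Bochner_Integration.integral_cong)
          (simp_all add: Q_def e flip: scaleR_diff_left)
      also have "\<dots> = (1 / norm h) *\<^sub>R (F (x + h) - F x - G h)"
        using int unfolding F_def G_def by simp
      finally show ?thesis by simp
    qed
    show "(\<lambda>h. norm (F (x + h) - F x - G h) / norm h) \<midarrow>0\<rightarrow> 0"
      unfolding FQ LIMSEQ_SEQ_conv[symmetric]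
    proof (intro allI impI)
      fix H :: "nat \<Rightarrow> 'a" assume H: "(\<forall>n. H n \<noteq> 0) \<and> H \<longlonglongrightarrow> 0"
      then obtain R where R: "\<And>n. norm (H n) \<le> R" using LIMSEQ_norm_bound by blast
      have R0: "R \<ge> 0" using R[of 0] norm_ge_zero order_trans by blast
      have "(\<lambda>n. \<integral>y. Q (H n) y \<partial>lborel) \<longlonglongrightarrow> (\<integral>y. 0 \<partial>(lborel :: 'a measure))"
      proof (rule integral_dominated_convergence[where w="\<lambda>y. (2 * B * C) * indicator (cball 0 (norm x + R + r)) y"])
        show "AE y in lborel. (\<lambda>n. Q (H n) y) \<longlonglongrightarrow> 0"
        proof (rule AE_I2)
          fix y
          have "(\<lambda>h. norm (k (x - y + h) - k (x - y) - k' (x - y) h) / norm h) \<midarrow>0\<rightarrow> 0"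
            using kD[of "x - y"] unfolding has_derivative_at by auto
          then have "(\<lambda>n. norm (k (x - y + H n) - k (x - y) - k' (x - y) (H n)) / norm (H n)) \<longlonglongrightarrow> 0"
            using H unfolding LIMSEQ_SEQ_conv[symmetric] by blast
          then have "(\<lambda>n. (k (x - y + H n) - k (x - y) - k' (x - y) (H n)) / norm (H n)) \<longlonglongrightarrow> 0"
            by (subst tendsto_norm_zero_iff[symmetric]) (simp add: abs_divide)
          from tendsto_scaleR[OF this tendsto_const[of "v y"]]
          show "(\<lambda>n. Q (H n) y) \<longlonglongrightarrow> 0" unfolding Q_def by simp
        qed
        show "AE y in lborel. norm (Q (H n) y) \<le> (2 * B * C) * indicator (cball 0 (norm x + R + r)) y" for n
        proof (rule AE_I2)
          fix y
          show "norm (Q (H n) y) \<le> (2 * B * C) * indicator (cball 0 (norm x + R + r)) y"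
          proof (cases "norm y \<le> norm x + R + r")
            case True
            have "\<bar>k (x - y + H n) - k (x - y) - k' (x - y) (H n)\<bar> \<le> 2 * B * norm (H n)"
              using B(2)[of "x - y" "H n"] B(3)[of "x - y" "H n"] by simp
            then have "\<bar>(k (x - y + H n) - k (x - y) - k' (x - y) (H n)) / norm (H n)\<bar> \<le> 2 * B"
              using H by (simp add: abs_divide divide_le_eq)
            then have "norm (Q (H n) y) \<le> 2 * B * C"
              unfolding Q_def norm_scaleR using B(1) v_bound[of y] by (intro mult_mono) auto
            then show ?thesis using True by simp
          next
            case False
            then have "norm (x - y) > r" "norm (x - y + H n) > r"
              using R[of n] R0 norm_triangle_sub[of y x] norm_triangle_sub[of y "x + H n"]
                norm_triangle_ineq[of x "H n"]
              by (auto simp: norm_minus_commute algebra_simps)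
            then show ?thesis using False by (simp add: r Q_def)
          qed
        qed
        show "integrable lborel (\<lambda>y. (2 * B * C) * indicator (cball 0 (norm x + R + r)) y)"
          using emeasure_lborel_cball_finite[of 0 "norm x + R + r"]
          by (intro integrable_mult_right integrable_real_indicator) auto
      qed (auto simp: Q_def)
      then show "(\<lambda>n. norm (\<integral>y. Q (H n) y \<partial>lborel)) \<longlonglongrightarrow> 0"
        by (simp add: tendsto_norm_zero_iff)
    qed
  qed
  then show ?thesis unfolding F_def G_def k'_def .
qed

end

lemma lborel_integral_reflect:
  fixes f :: "'a::euclidean_space \<Rightarrow> 'b::euclidean_space"
  assumes [measurable]: "f \<in> borel_measurable borel"
  shows "(\<integral>y. f (c - y) \<partial>lborel) = (\<integral>y. f y \<partial>lborel)"
proof -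
  have "(lborel :: 'a measure) = distr lborel borel (\<lambda>x. c - x)"
    using lborel_affine[of "-1" c] by (simp add: density_1)
  then have "(\<integral>y. f y \<partial>lborel) = (\<integral>y. f y \<partial>distr lborel borel (\<lambda>x. c - x))" by metis
  also have "\<dots> = (\<integral>y. f (c - y) \<partial>lborel)" by (intro integral_distr) auto
  finally show ?thesis by simp
qed

text \<open>The convolution of \<open>k\<close> with \<open>1\<close> is constant, so its derivative vanishes.\<close>
lemma C1c_integral_derivative_eq_0:
  fixes k :: "'a::euclidean_space \<Rightarrow> real"
  assumes k: "C1c k"
  shows "(\<integral>x. frechet_derivative k (at x) h \<partial>lborel) = 0"
proof -
  have [measurable]: "k \<in> borel_measurable borel" "(\<lambda>x. frechet_derivative k (at x) h) \<in> borel_measurable borel" for h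
    by (auto intro: borel_measurable_continuous_onI C1c_continuous[OF k] C1c_continuous_derivative[OF k])
  have "((\<lambda>x. \<integral>y. k (x - y) \<partial>lborel) has_derivative
      (\<lambda>h. \<integral>y. frechet_derivative k (at (0 - y)) h \<partial>lborel)) (at 0)"
    using has_derivative_convolution[of "\<lambda>_. 1::real" 1 k 0] k by simp
  moreover have "(\<lambda>x. \<integral>y. k (x - y) \<partial>lborel) = (\<lambda>x. \<integral>y. k y \<partial>lborel)"
    by (simp add: lborel_integral_reflect)
  ultimately have "((\<lambda>x::'a. \<integral>y. k y \<partial>lborel) has_derivative
      (\<lambda>h. \<integral>y. frechet_derivative k (at (0 - y)) h \<partial>lborel)) (at 0)" by metis
  from has_derivative_unique[OF this has_derivative_const]
  have "(\<integral>y. frechet_derivative k (at (0 - y)) h \<partial>lborel) = 0" by metis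
  then show ?thesis
    using lborel_integral_reflect[of "\<lambda>x. frechet_derivative k (at x) h" 0] by simp
qed

section \<open>Gradient, divergence and integration by parts\<close>

lemma grad_inner:
  assumes "(g has_derivative D) (at x)"
  shows "grad g x \<bullet> y = D y"
proof -
  have "D y = D (\<Sum>i\<in>Basis. (y \<bullet> i) *\<^sub>R i)" by (simp add: euclidean_representation)
  also have "\<dots> = (\<Sum>i\<in>Basis. (y \<bullet> i) * D i)"
    using has_derivative_linear[OF assms] by (simp add: linear_sum linear_scale)
  finally show ?thesis
    unfolding grad_def frechet_derivative_at[OF assms, symmetric]
    by (simp add: inner_sum_left inner_commute[of y] mult.commute)
qed

lemma C1c_grad_inner: "C1c g \<Longrightarrow> grad g x \<bullet> y = frechet_derivative g (at x) y"
  by (simp add: grad_inner[OF C1c_has_derivative])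

lemma C1c_continuous_grad: "C1c g \<Longrightarrow> continuous_on UNIV (grad g)"
  unfolding grad_def by (intro continuous_on_sum continuous_on_scaleR continuous_on_const C1c_continuous_derivative)

lemma C1c_continuous_divergence: "C1c \<eta> \<Longrightarrow> continuous_on UNIV (divergence \<eta>)"
  unfolding divergence_def by (intro continuous_on_sum continuous_on_inner continuous_on_const C1c_continuous_derivative)

text \<open>The product rule with the derivative \<open>E\<close> of \<open>v\<close> kept explicit:
  for a mollified field \<open>E\<close> is a convolution integral whose trace is computed
  separately.\<close>

lemma divergence_scaleR:
  assumes \<theta>: "(\<theta> has_derivative D) (at x)" and v: "(v has_derivative E) (at x)"
  shows "divergence (\<lambda>x. \<theta> x *\<^sub>R v x) x = \<theta> x * (\<Sum>i\<in>Basis. E i \<bullet> i) + grad \<theta> x \<bullet> v x"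
proof -
  have "((\<lambda>x. \<theta> x *\<^sub>R v x) has_derivative (\<lambda>h. \<theta> x *\<^sub>R E h + D h *\<^sub>R v x)) (at x)"
    by (rule has_derivative_scaleR[OF \<theta> v])
  from frechet_derivative_at[OF this]
  have "divergence (\<lambda>x. \<theta> x *\<^sub>R v x) x = (\<Sum>i\<in>Basis. (\<theta> x *\<^sub>R E i + D i *\<^sub>R v x) \<bullet> i)"
    unfolding divergence_def by metis
  also have "\<dots> = \<theta> x * (\<Sum>i\<in>Basis. E i \<bullet> i) + (\<Sum>i\<in>Basis. D i * (v x \<bullet> i))"
    by (simp add: inner_add_left sum.distrib sum_distrib_left)
  also have "(\<Sum>i\<in>Basis. D i * (v x \<bullet> i)) = grad \<theta> x \<bullet> v x"
    unfolding grad_def frechet_derivative_at[OF \<theta>, symmetric]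
    by (simp add: inner_sum_left inner_commute[of "v x"])
  finally show ?thesis .
qed

text \<open>The compact support comes from \<open>\<theta>\<close> alone, so \<open>v\<close> may be
  a constant or a mollified field on the whole space.\<close>

lemma C1c_scaleR:
  fixes v :: "'a::euclidean_space \<Rightarrow> 'b::euclidean_space"
  assumes \<theta>: "C1c \<theta>" and v: "\<And>x. (v has_derivative E x) (at x)"
    and E: "\<And>i. i \<in> Basis \<Longrightarrow> continuous_on UNIV (\<lambda>x. E x i)"
  shows "C1c (\<lambda>x. \<theta> x *\<^sub>R v x)"
proof -
  obtain r where r: "\<And>x. norm x > r \<Longrightarrow> \<theta> x = 0" using C1c_support[OF \<theta>] by metis
  have "continuous_on UNIV v"
    using v has_derivative_continuous continuous_at_imp_continuous_on by metis
  then show ?thesis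
    by (intro C1cI[OF has_derivative_scaleR[OF C1c_has_derivative[OF \<theta>] v], of r])
      (auto intro!: continuous_on_add continuous_on_scaleR C1c_continuous[OF \<theta>] C1c_continuous_derivative[OF \<theta>] E simp: r)
qed

text \<open>The divergence theorem on the whole space, one component at a time: each summand is a
  partial derivative of a compactly supported scalar function.\<close>

lemma C1c_integral_divergence_eq_0:
  assumes "C1c \<eta>" shows "(\<integral>x. divergence \<eta> x \<partial>lborel) = 0"
proof -
  have "(\<integral>x. frechet_derivative \<eta> (at x) i \<bullet> i \<partial>lborel) = 0" if "i \<in> Basis" for i
  proof -
    have D: "((\<lambda>x. \<eta> x \<bullet> i) has_derivative (\<lambda>h. frechet_derivative \<eta> (at x) h \<bullet> i)) (at x)" for x
      by (intro has_derivative_inner_left C1c_has_derivative assms)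
    obtain r where r: "\<And>x. norm x > r \<Longrightarrow> \<eta> x = 0" using C1c_support[OF assms] by metis
    have "C1c (\<lambda>x. \<eta> x \<bullet> i)"
      by (rule C1cI[OF D, of r]) (auto intro!: continuous_intros C1c_continuous_derivative assms simp: r)
    from C1c_integral_derivative_eq_0[OF this, of i] show ?thesis
      unfolding frechet_derivative_at[OF D, symmetric] .
  qed
  then show ?thesis
    unfolding divergence_def
    by (subst Bochner_Integration.integral_sum) (auto intro!: integrable_inner_left C1c_integrable_derivative assms)
qed

text \<open>Integration by parts: the divergence of \<open>\<psi> \<eta>\<close> integrates to 0,
  which turns the value of a competitor into the integral of
  \<open>grad \<psi> \<bullet> \<eta>\<close>, bounded pointwise by
  \<open>\<sigma> (grad \<psi>)\<close>. With \<open>\<sigma> = norm\<close> this gives membership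
  in \<open>BV\<close>, with \<open>\<sigma> = \<phi>\<close> the energy estimate.\<close>

lemma TV_K_le_integral_grad:
  fixes \<psi> :: "'a::euclidean_space \<Rightarrow> real"
  assumes \<psi>: "C1c \<psi>" and \<sigma>: "continuous_on UNIV \<sigma>" "\<sigma> 0 = 0"
    and K: "\<And>z y. z \<in> K \<Longrightarrow> z \<bullet> y \<le> \<sigma> y"
  shows "TV_K K \<psi> \<le> ereal (\<integral>x. \<sigma> (grad \<psi> x) \<partial>lborel)"
  unfolding TV_K_def
proof (rule SUP_least, clarsimp)
  fix \<eta> :: "'a \<Rightarrow> 'a" assume \<eta>: "C1c \<eta>" and \<eta>K: "\<forall>x. \<eta> x \<in> K"
  obtain r where r: "\<And>x. norm x > r \<Longrightarrow> \<psi> x = 0" "\<And>x h. norm x > r \<Longrightarrow> frechet_derivative \<psi> (at x) h = 0"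
    using C1c_support[OF \<psi>] by metis
  have gr: "grad \<psi> x = 0" if "norm x > r" for x using r(2)[OF that] by (simp add: grad_def)
  note cont = C1c_continuous[OF \<psi>] C1c_continuous[OF \<eta>] C1c_continuous_grad[OF \<psi>]
    C1c_continuous_divergence[OF \<eta>]
  have i1: "integrable lborel (\<lambda>x. \<psi> x * divergence \<eta> x)"
    by (rule integrable_continuous_compact_support[of _ r]) (auto intro!: continuous_intros cont simp: r)
  have i2: "integrable lborel (\<lambda>x. grad \<psi> x \<bullet> \<eta> x)"
    by (rule integrable_continuous_compact_support[of _ r]) (auto intro!: continuous_intros cont simp: gr)
  have i3: "integrable lborel (\<lambda>x. \<sigma> (grad \<psi> x))"
    by (rule integrable_continuous_compact_support[of _ r])
      (auto intro!: continuous_on_compose2[OF \<sigma>(1)] cont simp: gr \<sigma>(2))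
  have "C1c (\<lambda>x. \<psi> x *\<^sub>R \<eta> x)"
    by (rule C1c_scaleR[OF \<psi> C1c_has_derivative[OF \<eta>] C1c_continuous_derivative[OF \<eta>]])
  from C1c_integral_divergence_eq_0[OF this]
  have "(\<integral>x. \<psi> x * divergence \<eta> x + grad \<psi> x \<bullet> \<eta> x \<partial>lborel) = 0"
    using divergence_scaleR[OF C1c_has_derivative[OF \<psi>] C1c_has_derivative[OF \<eta>]]
    by (simp add: divergence_def)
  then have "- (\<integral>x. \<psi> x * divergence \<eta> x \<partial>lborel) = (\<integral>x. grad \<psi> x \<bullet> \<eta> x \<partial>lborel)"
    using i1 i2 by simp
  also have "\<dots> \<le> (\<integral>x. \<sigma> (grad \<psi> x) \<partial>lborel)"
    using K \<eta>K by (intro integral_mono i2 i3) (auto simp: inner_commute)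
  finally show "- (\<integral>x. \<psi> x * divergence \<eta> x \<partial>lebesgue) \<le> (\<integral>x. \<sigma> (grad \<psi> x) \<partial>lborel)"
    using i1 by (subst integral_completion) auto
qed

subsection \<open>Mollification\<close>

text \<open>Squaring removes the kink of the positive part, which gives the C1 regularity that
  \<open>C1c\<close> asks for. In each of the four sign patterns the remainder is at most the square
  of \<open>h\<close>.\<close>

lemma DERIV_max_0_square: "((\<lambda>s::real. (max 0 s)\<^sup>2) has_real_derivative 2 * max 0 s) (at s)"
  unfolding has_field_derivative_def has_derivative_at
proof
  have bound: "\<bar>(max 0 (s + h))\<^sup>2 - (max 0 s)\<^sup>2 - 2 * max 0 s * h\<bar> \<le> h\<^sup>2" for h :: real
  proof -
    consider "s \<ge> 0" "s + h \<ge> 0" | "s \<ge> 0" "s + h < 0" | "s < 0" "s + h \<ge> 0" | "s < 0" "s + h < 0" by linarith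
    then show ?thesis
    proof cases
      case 1 then show ?thesis by (simp add: power2_eq_square algebra_simps)
    next
      case 2
      then have "0 \<le> s * (- s - 2 * h)" by (intro mult_nonneg_nonneg) auto
      then have "\<bar>(max 0 (s + h))\<^sup>2 - (max 0 s)\<^sup>2 - 2 * max 0 s * h\<bar> = s * (- s - 2 * h)"
        using 2 by (simp add: power2_eq_square algebra_simps)
      also have "\<dots> = h\<^sup>2 - (s + h)\<^sup>2" by (simp add: power2_eq_square algebra_simps)
      finally show ?thesis by simp
    next
      case 3
      then have "(s + h)\<^sup>2 \<le> h\<^sup>2" by (auto simp: abs_le_square_iff[symmetric])
      then show ?thesis using 3 by simp
    next
      case 4 then show ?thesis by simp
    qed
  qed
  show "(\<lambda>h. norm ((max 0 (s + h))\<^sup>2 - (max 0 s)\<^sup>2 - 2 * max 0 s * h) / norm h) \<midarrow>0\<rightarrow> 0"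
  proof (rule Lim_null_comparison)
    show "\<forall>\<^sub>F h in at 0. norm (norm ((max 0 (s + h))\<^sup>2 - (max 0 s)\<^sup>2 - 2 * max 0 s * h) / norm h) \<le> \<bar>h\<bar>"
      unfolding eventually_at_filter
    proof (intro always_eventually allI impI)
      fix h :: real assume "h \<noteq> 0"
      then show "norm (norm ((max 0 (s + h))\<^sup>2 - (max 0 s)\<^sup>2 - 2 * max 0 s * h) / norm h) \<le> \<bar>h\<bar>"
        using bound[of h] by (simp add: divide_le_eq power2_eq_square)
    qed
    show "((\<lambda>h::real. \<bar>h\<bar>) \<longlongrightarrow> 0) (at 0)" by (intro tendsto_rabs_zero tendsto_ident_at)
  qed
qed (rule bounded_linear_mult_right)

text \<open>A polynomial profile in \<open>x \<bullet> x\<close>, hence differentiable at the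
  origin, cut off at radius \<open>r\<close> with a C1 transition. It acts as a mollifying kernel
  for small \<open>r\<close> and as a cutoff for large \<open>r\<close>.\<close>

definition bump :: "real \<Rightarrow> 'a::euclidean_space \<Rightarrow> real" where
  "bump r x = (max 0 (1 - (x \<bullet> x) / r\<^sup>2))\<^sup>2"

lemma bump_has_derivative:
  "(bump r has_derivative (\<lambda>h. - (4 / r\<^sup>2) * max 0 (1 - (x \<bullet> x) / r\<^sup>2) * (x \<bullet> h))) (at x)"
proof -
  have "((\<lambda>x. 1 - (x \<bullet> x) / r\<^sup>2) has_derivative (\<lambda>h. - (2 * (x \<bullet> h)) / r\<^sup>2)) (at x)"
    by (rule has_derivative_eq_rhs[OF has_derivative_diff[OF has_derivative_const
          bounded_linear.has_derivative[OF bounded_linear_divide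
            has_derivative_inner[OF has_derivative_ident has_derivative_ident]]]])
      (auto simp: inner_commute)
  from has_derivative_compose[OF this DERIV_max_0_square[unfolded has_field_derivative_def]]
  show ?thesis by (simp add: bump_def[abs_def] mult_ac)
qed

lemma bump_outside:
  assumes "r > 0" "norm x \<ge> r" shows "max 0 (1 - (x \<bullet> x) / r\<^sup>2) = 0"
proof -
  have "r\<^sup>2 \<le> (norm x)\<^sup>2" using assms by (intro power_mono) auto
  then show ?thesis using assms(1) by (simp add: power2_norm_eq_inner le_divide_eq)
qed

lemma bump_eq_0: "r > 0 \<Longrightarrow> norm x \<ge> r \<Longrightarrow> bump r x = 0"
  unfolding bump_def by (simp only: bump_outside) simp

lemma C1c_bump:
  assumes "r > 0" shows "C1c (bump r)"
proof (rule C1cI[OF bump_has_derivative, where r=r])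
  show "continuous_on UNIV (\<lambda>x. - (4 / r\<^sup>2) * max 0 (1 - (x \<bullet> x) / r\<^sup>2) * (x \<bullet> i))" for i :: 'a
    by (intro continuous_on_mult continuous_on_max continuous_on_diff continuous_on_divide
      continuous_on_inner continuous_on_const continuous_on_id) (use assms in auto)
qed (simp add: bump_eq_0 assms)

lemma bump_nonneg: "0 \<le> bump r x" by (simp add: bump_def)

lemma bump_le_1: "bump r x \<le> 1" unfolding bump_def by (intro power_le_one) auto

text \<open>The inner expression is at least 3/4 there, and 9/16 exceeds 1/2. This is what makes the
  integral of \<open>bump\<close> positive.\<close>

lemma bump_ge_on_half_ball:
  assumes "r > 0" "norm x < r / 2" shows "1 / 2 \<le> bump r x"
proof -
  have "(norm x)\<^sup>2 \<le> (r / 2)\<^sup>2" using assms by (intro power_mono) auto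
  then have "3 / 4 \<le> 1 - (x \<bullet> x) / r\<^sup>2"
    using assms(1) by (simp add: power2_norm_eq_inner power_divide divide_le_eq field_simps)
  then have "(3 / 4)\<^sup>2 \<le> bump r x" unfolding bump_def
    by (intro power_mono) (auto simp: le_max_iff_disj)
  then show ?thesis by (simp add: power2_eq_square)
qed

text \<open>The decay in \<open>r\<close> is the point: the error caused by a cutoff at radius
  \<open>r\<close> vanishes as \<open>r\<close> grows.\<close>

lemma norm_grad_bump_le:
  fixes x :: "'a::euclidean_space"
  assumes "r > 0" shows "norm (grad (bump r) x) \<le> 4 / r"
proof -
  have eq: "grad (bump r) x \<bullet> y = - (4 / r\<^sup>2) * max 0 (1 - (x \<bullet> x) / r\<^sup>2) * (x \<bullet> y)" for y
    by (rule grad_inner[OF bump_has_derivative])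
  then have "grad (bump r) x = (- (4 / r\<^sup>2) * max 0 (1 - (x \<bullet> x) / r\<^sup>2)) *\<^sub>R x"
    by (intro vector_eq_rdot[THEN iffD1]) auto
  then have n: "norm (grad (bump r) x) = 4 / r\<^sup>2 * max 0 (1 - (x \<bullet> x) / r\<^sup>2) * norm x"
    by (simp add: abs_mult)
  show ?thesis
  proof (cases "norm x \<ge> r")
    case True then show ?thesis using n bump_outside[OF assms True] assms by simp
  next
    case False
    have "4 / r\<^sup>2 * max 0 (1 - (x \<bullet> x) / r\<^sup>2) * norm x \<le> 4 / r\<^sup>2 * 1 * r"
      using False assms by (intro mult_mono) auto
    then show ?thesis using n assms by (simp add: power2_eq_square)
  qed
qed

lemma bump_tendsto_1: "(\<lambda>n. bump (real (Suc n)) x) \<longlonglongrightarrow> 1"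
proof -
  have "(\<lambda>n. (x \<bullet> x) * (inverse (real (Suc n)))\<^sup>2) \<longlonglongrightarrow> (x \<bullet> x) * 0\<^sup>2"
    by (intro tendsto_intros LIMSEQ_inverse_real_of_nat)
  then have "(\<lambda>n. (max 0 (1 - (x \<bullet> x) * (inverse (real (Suc n)))\<^sup>2))\<^sup>2) \<longlonglongrightarrow> (max 0 (1 - (x \<bullet> x) * 0\<^sup>2))\<^sup>2"
    by (intro tendsto_power tendsto_max tendsto_diff tendsto_const)
  then show ?thesis by (simp add: bump_def divide_inverse power_inverse)
qed

lemma integral_bump_pos:
  assumes "r > 0" shows "0 < (\<integral>x. bump r (x :: 'a::euclidean_space) \<partial>lborel)"
proof -
  have "0 < (1 / 2) * measure lborel (ball (0::'a) (r / 2))"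
    using content_ball_pos[of "r / 2" "0::'a"] assms by simp
  also have "\<dots> = (\<integral>x. (1 / 2 :: real) * indicator (ball (0::'a) (r / 2)) x \<partial>lborel)" by simp
  also have "\<dots> \<le> (\<integral>x. bump r (x :: 'a) \<partial>lborel)"
  proof (rule integral_mono)
    show "integrable lborel (\<lambda>x. (1 / 2 :: real) * indicator (ball (0::'a) (r / 2)) x)"
      using emeasure_lborel_ball_finite[of "0::'a" "r / 2"]
      by (intro integrable_mult_right integrable_real_indicator) auto
    show "integrable lborel (bump r :: 'a \<Rightarrow> real)" by (rule C1c_integrable[OF C1c_bump[OF assms]])
    show "(1 / 2 :: real) * indicator (ball (0::'a) (r / 2)) x \<le> bump r x" for x
      using bump_ge_on_half_ball[OF assms, of x] bump_nonneg[of r x] by (auto simp: indicator_def)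
  qed
  finally show ?thesis .
qed

lemma mollifier:
  obtains \<eta> :: "nat \<Rightarrow> 'a::euclidean_space \<Rightarrow> real" where
    "\<And>n. C1c (\<eta> n)" "\<And>n x. 0 \<le> \<eta> n x" "\<And>n. (\<integral>x. \<eta> n x \<partial>lborel) = 1"
    "\<And>n x. norm x \<ge> inverse (real (Suc n)) \<Longrightarrow> \<eta> n x = 0"
proof
  define r where "r n = inverse (real (Suc n))" for n
  have r: "r n > 0" for n by (simp add: r_def)
  \<comment> \<open>The normalising factor is written as a constant field on the right of the
    scaling, so that \<open>C1c_scaleR\<close> applies.\<close>
  let ?\<eta> = "\<lambda>n (x::'a). bump (r n) x *\<^sub>R (1 / (\<integral>x. bump (r n) (x::'a) \<partial>lborel))"
  show "C1c (?\<eta> n)" for n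
    by (rule C1c_scaleR[OF C1c_bump[OF r] has_derivative_const]) simp
  show "0 \<le> ?\<eta> n x" for n x 
    using bump_nonneg[of "r n" x] integral_bump_pos[OF r[of n], where 'a='a] by simp
  show "(\<integral>x. ?\<eta> n x \<partial>lborel) = 1" for n 
    using integral_bump_pos[OF r[of n], where 'a='a] by simp
  show "?\<eta> n x = 0" if "norm x \<ge> inverse (real (Suc n))" for n x
    using bump_eq_0[OF r[of n], of x] that by (simp add: r_def)
qed

section \<open>Continuity of translations in L1\<close>

lemma lborel_integral_translate:
  fixes f :: "'a::euclidean_space \<Rightarrow> real"
  assumes [measurable]: "f \<in> borel_measurable borel"
  shows "(\<integral>y. f (y + z) \<partial>lborel) = (\<integral>y. f y \<partial>lborel)"
    and "integrable lborel (\<lambda>y. f (y + z)) \<longleftrightarrow> integrable lborel f"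
proof -
  have "(\<integral>y. f y \<partial>distr lborel borel ((+) z)) = (\<integral>y. f (z + y) \<partial>lborel)"
    by (intro integral_distr) auto
  then show "(\<integral>y. f (y + z) \<partial>lborel) = (\<integral>y. f y \<partial>lborel)"
    by (simp add: lborel_distr_plus add.commute)
  have "integrable (distr lborel borel ((+) z)) f \<longleftrightarrow> integrable lborel (\<lambda>y. f (z + y))"
    by (intro integrable_distr_eq) auto
  then show "integrable lborel (\<lambda>y. f (y + z)) \<longleftrightarrow> integrable lborel f"
    by (simp add: lborel_distr_plus add.commute)
qed

text \<open>A three-epsilon argument: by translation invariance the shifted and the unshifted
  distance of \<open>u\<close> and \<open>w\<close> coincide, each below \<open>e / 4\<close>, which
  leaves \<open>e / 2\<close> for the translation error of \<open>w\<close>.\<close>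

lemma L1_translation_approx:
  fixes u :: "'a::euclidean_space \<Rightarrow> real"
  assumes Z: "Z \<longlonglongrightarrow> 0" and u: "integrable lborel u"
    and approx: "\<And>e. e > 0 \<Longrightarrow> \<exists>w. integrable lborel w \<and> (\<integral>y. \<bar>u y - w y\<bar> \<partial>lborel) < e \<and>
       (\<lambda>n. \<integral>y. \<bar>w (y + Z n) - w y\<bar> \<partial>lborel) \<longlonglongrightarrow> 0"
  shows "(\<lambda>n. \<integral>y. \<bar>u (y + Z n) - u y\<bar> \<partial>lborel) \<longlonglongrightarrow> 0"
proof (rule LIMSEQ_I)
  fix e :: real assume "e > 0"
  then obtain w where w: "integrable lborel w" "(\<integral>y. \<bar>u y - w y\<bar> \<partial>lborel) < e / 4"
    "(\<lambda>n. \<integral>y. \<bar>w (y + Z n) - w y\<bar> \<partial>lborel) \<longlonglongrightarrow> 0"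
    using approx[of "e / 4"] by auto
  have [measurable]: "u \<in> borel_measurable borel" "w \<in> borel_measurable borel"
    using u w(1) by auto
  obtain N where N: "\<And>n. n \<ge> N \<Longrightarrow> (\<integral>y. \<bar>w (y + Z n) - w y\<bar> \<partial>lborel) < e / 2"
    using LIMSEQ_D[OF w(3), of "e / 2"] \<open>e > 0\<close> by auto
  have "(\<integral>y. \<bar>u (y + Z n) - u y\<bar> \<partial>lborel) < e" if n: "n \<ge> N" for n
  proof -
    have i: "integrable lborel (\<lambda>y. u (y + Z n))" "integrable lborel (\<lambda>y. w (y + Z n))"
      using u w(1) by (auto simp: lborel_integral_translate)
    have "(\<integral>y. \<bar>u (y + Z n) - u y\<bar> \<partial>lborel)
        \<le> (\<integral>y. \<bar>u (y + Z n) - w (y + Z n)\<bar> + \<bar>w (y + Z n) - w y\<bar> + \<bar>u y - w y\<bar> \<partial>lborel)"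
      using i u w(1) by (intro integral_mono) auto
    also have "\<dots> = (\<integral>y. \<bar>u (y + Z n) - w (y + Z n)\<bar> \<partial>lborel)
        + (\<integral>y. \<bar>w (y + Z n) - w y\<bar> \<partial>lborel) + (\<integral>y. \<bar>u y - w y\<bar> \<partial>lborel)"
      using i u w(1) by simp
    also have "(\<integral>y. \<bar>u (y + Z n) - w (y + Z n)\<bar> \<partial>lborel) = (\<integral>y. \<bar>u y - w y\<bar> \<partial>lborel)"
      by (rule lborel_integral_translate(1)[of "\<lambda>y. \<bar>u y - w y\<bar>"]) measurable
    finally show ?thesis using N[OF n] w(2) by linarith
  qed
  then show "\<exists>N. \<forall>n\<ge>N. norm ((\<integral>y. \<bar>u (y + Z n) - u y\<bar> \<partial>lborel) - 0) < e"
    by (intro exI[of _ N]) (auto simp: abs_of_nonneg)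
qed

text \<open>Pointwise convergence of the shifted indicators can fail at boundary points of
  \<open>U\<close>, but after multiplication by the indicator of \<open>U\<close> it holds
  everywhere, because \<open>U\<close> is open. For indicators
  \<open>|a - b| = a + b - 2 a b\<close>, and translation invariance then reduces the claim to that
  product.\<close>

lemma L1_translation_open:
  fixes U :: "'a::euclidean_space set"
  assumes Z: "Z \<longlonglongrightarrow> 0" and U: "open U" "emeasure lborel U < \<infinity>"
  shows "(\<lambda>n. \<integral>y. \<bar>indicat_real U (y + Z n) - indicat_real U y\<bar> \<partial>lborel) \<longlonglongrightarrow> 0"
proof -
  have [measurable]: "U \<in> sets borel" using U(1) by simp
  have i: "integrable lborel (indicat_real U)" using U(2) by (intro integrable_real_indicator) auto
  then have it: "integrable lborel (\<lambda>y. indicat_real U (y + Z n))" for n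
    by (subst lborel_integral_translate) auto
  have ip: "integrable lborel (\<lambda>y. indicat_real U (y + Z n) * indicat_real U y)" for n
    by (rule Bochner_Integration.integrable_bound[OF i]) (auto simp: indicator_def)
  have "(\<lambda>n. \<integral>y. indicat_real U (y + Z n) * indicat_real U y \<partial>lborel) \<longlonglongrightarrow> (\<integral>y. indicat_real U y \<partial>lborel)"
  proof (rule integral_dominated_convergence[where w="indicat_real U"])
    show "AE y in lborel. (\<lambda>n. indicat_real U (y + Z n) * indicat_real U y) \<longlonglongrightarrow> indicat_real U y"
    proof (rule AE_I2)
      fix y
      show "(\<lambda>n. indicat_real U (y + Z n) * indicat_real U y) \<longlonglongrightarrow> indicat_real U y"
      proof (cases "y \<in> U")
        case True
        have "(\<lambda>n. y + Z n) \<longlonglongrightarrow> y + 0" by (intro tendsto_intros Z)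
        then have "\<forall>\<^sub>F n in sequentially. y + Z n \<in> U" using topological_tendstoD[OF _ U(1)] True by auto
        then have "\<forall>\<^sub>F n in sequentially. indicat_real U (y + Z n) * indicat_real U y = indicat_real U y"
          by eventually_elim (use True in auto)
        then show ?thesis by (rule tendsto_eventually)
      qed simp
    qed
  qed (use i in \<open>auto simp: indicator_def\<close>)
  then have "(\<lambda>n. 2 * (\<integral>y. indicat_real U y \<partial>lborel) - 2 * (\<integral>y. indicat_real U (y + Z n) * indicat_real U y \<partial>lborel))
      \<longlonglongrightarrow> 2 * (\<integral>y. indicat_real U y \<partial>lborel) - 2 * (\<integral>y. indicat_real U y \<partial>lborel)"
    by (intro tendsto_diff tendsto_mult tendsto_const)
  moreover have "(\<integral>y. \<bar>indicat_real U (y + Z n) - indicat_real U y\<bar> \<partial>lborel)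
      = 2 * (\<integral>y. indicat_real U y \<partial>lborel) - 2 * (\<integral>y. indicat_real U (y + Z n) * indicat_real U y \<partial>lborel)" for n
  proof -
    have "(\<integral>y. \<bar>indicat_real U (y + Z n) - indicat_real U y\<bar> \<partial>lborel)
      = (\<integral>y. indicat_real U (y + Z n) + indicat_real U y - 2 * (indicat_real U (y + Z n) * indicat_real U y) \<partial>lborel)"
      by (intro Bochner_Integration.integral_cong) (auto simp: indicator_def)
    also have "\<dots> = (\<integral>y. indicat_real U (y + Z n) \<partial>lborel) + (\<integral>y. indicat_real U y \<partial>lborel)
        - 2 * (\<integral>y. indicat_real U (y + Z n) * indicat_real U y \<partial>lborel)"
      using i it ip by simp
    also have "(\<integral>y. indicat_real U (y + Z n) \<partial>lborel) = (\<integral>y. indicat_real U y \<partial>lborel)"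
      by (rule lborel_integral_translate) measurable
    finally show ?thesis by simp
  qed
  ultimately show ?thesis by simp
qed

text \<open>A density argument: measurable sets are approximated from outside by open sets, and the
  property is preserved under sums and L1 limits.\<close>

lemma L1_translation:
  fixes u :: "'a::euclidean_space \<Rightarrow> real"
  assumes "integrable lborel u" and Z: "Z \<longlonglongrightarrow> 0"
  shows "(\<lambda>n. \<integral>y. \<bar>u (y + Z n) - u y\<bar> \<partial>lborel) \<longlonglongrightarrow> 0"
  using assms(1)
proof (induction u rule: integrable_induct)
  case (base A c)
  have [measurable]: "A \<in> sets borel" using base by simp
  have iA: "integrable lborel (indicat_real A)" using base by (intro integrable_real_indicator) auto
  have "(\<lambda>n. \<integral>y. \<bar>indicat_real A (y + Z n) - indicat_real A y\<bar> \<partial>lborel) \<longlonglongrightarrow> 0"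
  proof (rule L1_translation_approx[OF Z iA])
    fix e :: real assume "e > 0"
    moreover have "A \<in> sets lebesgue" using base by simp
    ultimately obtain U where U: "open U" "A \<subseteq> U" "emeasure lebesgue (U - A) < ennreal e"
      using sets_lebesgue_outer_open by metis
    then have [measurable]: "U \<in> sets borel" by simp
    have UA: "emeasure lborel (U - A) < ennreal e" using U by simp
    have "emeasure lborel U = emeasure lborel A + emeasure lborel (U - A)"
      using U by (subst plus_emeasure) (auto simp: Un_absorb1)
    also have "\<dots> < \<infinity>" using base(2) UA by (simp add: order.strict_trans less_top)
    finally have Ufin: "emeasure lborel U < \<infinity>" .
    then have iU: "integrable lborel (indicat_real U)" by (intro integrable_real_indicator) auto
    have "(\<integral>y. \<bar>indicat_real A y - indicat_real U y\<bar> \<partial>lborel) = (\<integral>y. indicat_real (U - A) y \<partial>lborel)"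
      using U(2) by (intro Bochner_Integration.integral_cong) (auto simp: indicator_def)
    also have "\<dots> = measure lborel (U - A)" by simp
    also have "\<dots> < e"
    proof -
      have "emeasure lborel (U - A) = ennreal (measure lborel (U - A))"
        using UA by (intro emeasure_eq_ennreal_measure) auto
      then show ?thesis using UA by (simp add: ennreal_less_iff)
    qed
    finally show "\<exists>w. integrable lborel w \<and> (\<integral>y. \<bar>indicat_real A y - w y\<bar> \<partial>lborel) < e \<and>
       (\<lambda>n. \<integral>y. \<bar>w (y + Z n) - w y\<bar> \<partial>lborel) \<longlonglongrightarrow> 0"
      using iU L1_translation_open[OF Z U(1) Ufin] by blast
  qed
  from tendsto_mult_left[OF this, of "\<bar>c\<bar>"]
  have "(\<lambda>n. \<integral>y. \<bar>c\<bar> * \<bar>indicat_real A (y + Z n) - indicat_real A y\<bar> \<partial>lborel) \<longlonglongrightarrow> 0" by simp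
  moreover have "\<bar>c\<bar> * \<bar>indicat_real A (y + Z n) - indicat_real A y\<bar>
      = \<bar>indicat_real A (y + Z n) *\<^sub>R c - indicat_real A y *\<^sub>R c\<bar>" for y n
    by (simp add: abs_mult flip: left_diff_distrib)
  ultimately show ?case by simp
next
  case (add f g)
  have [measurable]: "f \<in> borel_measurable borel" "g \<in> borel_measurable borel" using add(1,2) by auto
  have i: "integrable lborel (\<lambda>y. f (y + Z n))" "integrable lborel (\<lambda>y. g (y + Z n))" for n
    using add(1,2) by (auto simp: lborel_integral_translate)
  show ?case
  proof (rule Lim_null_comparison)
    show "\<forall>\<^sub>F n in sequentially. norm (\<integral>y. \<bar>f (y + Z n) + g (y + Z n) - (f y + g y)\<bar> \<partial>lborel)
        \<le> (\<integral>y. \<bar>f (y + Z n) - f y\<bar> \<partial>lborel) + (\<integral>y. \<bar>g (y + Z n) - g y\<bar> \<partial>lborel)"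
    proof (intro always_eventually allI)
      fix n
      have "(\<integral>y. \<bar>f (y + Z n) + g (y + Z n) - (f y + g y)\<bar> \<partial>lborel)
          \<le> (\<integral>y. \<bar>f (y + Z n) - f y\<bar> + \<bar>g (y + Z n) - g y\<bar> \<partial>lborel)"
        using i add(1,2) by (intro integral_mono) auto
      then show "norm (\<integral>y. \<bar>f (y + Z n) + g (y + Z n) - (f y + g y)\<bar> \<partial>lborel)
        \<le> (\<integral>y. \<bar>f (y + Z n) - f y\<bar> \<partial>lborel) + (\<integral>y. \<bar>g (y + Z n) - g y\<bar> \<partial>lborel)"
        using i add(1,2) by (simp add: abs_of_nonneg)
    qed
    show "(\<lambda>n. (\<integral>y. \<bar>f (y + Z n) - f y\<bar> \<partial>lborel) + (\<integral>y. \<bar>g (y + Z n) - g y\<bar> \<partial>lborel)) \<longlonglongrightarrow> 0"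
      using tendsto_add[OF add(3,4)] by simp
  qed
next
  case (lim f s)
  have [measurable]: "f \<in> borel_measurable borel" "\<And>i. s i \<in> borel_measurable borel" using lim by auto
  have "(\<lambda>i. \<integral>y. \<bar>f y - s i y\<bar> \<partial>lborel) \<longlonglongrightarrow> (\<integral>y. 0 \<partial>(lborel :: 'a measure))"
  proof (rule integral_dominated_convergence[where w="\<lambda>y. 3 * \<bar>f y\<bar>"])
    show "AE y in lborel. (\<lambda>i. \<bar>f y - s i y\<bar>) \<longlonglongrightarrow> 0"
    proof (rule AE_I2)
      fix y
      have "(\<lambda>i. \<bar>f y - s i y\<bar>) \<longlonglongrightarrow> \<bar>f y - f y\<bar>" using lim(2) by (intro tendsto_intros) auto
      then show "(\<lambda>i. \<bar>f y - s i y\<bar>) \<longlonglongrightarrow> 0" by simp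
    qed
    show "AE y in lborel. norm \<bar>f y - s i y\<bar> \<le> 3 * \<bar>f y\<bar>" for i
    proof (rule AE_I2)
      fix y show "norm \<bar>f y - s i y\<bar> \<le> 3 * \<bar>f y\<bar>" using lim(3)[of y i] by simp
    qed
  qed (use lim(4) in auto)
  then have L: "(\<lambda>i. \<integral>y. \<bar>f y - s i y\<bar> \<partial>lborel) \<longlonglongrightarrow> 0" by simp
  show ?case
  proof (rule L1_translation_approx[OF Z lim(4)])
    fix e :: real assume "e > 0"
    then obtain i where "(\<integral>y. \<bar>f y - s i y\<bar> \<partial>lborel) < e" using LIMSEQ_D[OF L] by force
    then show "\<exists>w. integrable lborel w \<and> (\<integral>y. \<bar>f y - w y\<bar> \<partial>lborel) < e \<and>
       (\<lambda>n. \<integral>y. \<bar>w (y + Z n) - w y\<bar> \<partial>lborel) \<longlonglongrightarrow> 0"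
      using lim(1,5) by blast
  qed
qed

text \<open>Fubini and the substitution \<open>z = x - y\<close> move the shift from the kernel to
  \<open>U\<close>. Mollifications of a merely bounded \<open>g\<close> need not converge uniformly,
  whereas translations of an integrable \<open>U\<close> are continuous in L1.\<close>

lemma integral_mult_convolution:
  fixes U g \<eta> :: "'a::euclidean_space \<Rightarrow> real"
  assumes U: "integrable lborel U" and \<eta>: "integrable lborel \<eta>"
    and g[measurable]: "g \<in> borel_measurable borel" and C: "\<And>y. \<bar>g y\<bar> \<le> C"
  shows "(\<integral>x. U x * (\<integral>y. \<eta> (x - y) * g y \<partial>lborel) \<partial>lborel)
    = (\<integral>z. \<eta> z * (\<integral>y. U (y + z) * g y \<partial>lborel) \<partial>lborel)"
    and "integrable lborel (\<lambda>z. \<eta> z * (\<integral>y. U (y + z) * g y \<partial>lborel))"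
proof -
  have [measurable]: "U \<in> borel_measurable borel" "\<eta> \<in> borel_measurable borel" using U \<eta> by auto
  have trans: "(\<integral>y. U (y + z) * g y \<partial>lborel) = (\<integral>x. U x * g (x - z) \<partial>lborel)" for z
    using lborel_integral_translate(1)[of "\<lambda>x. U x * g (x - z)" z] by simp
  have bound: "\<bar>U x * \<eta> z * g (x - z)\<bar> \<le> \<bar>U x * \<eta> z * C\<bar>" for x z
    using C[of "x - z"] unfolding abs_mult by (intro mult_left_mono) auto
  have int: "integrable (lborel \<Otimes>\<^sub>M lborel) (\<lambda>(x, z). U x * \<eta> z * g (x - z))"
  proof (rule Bochner_Integration.integrable_bound)
    show "integrable (lborel \<Otimes>\<^sub>M lborel) (\<lambda>(x, z). U x * \<eta> z * C)"
    proof (rule lborel_pair.Fubini_integrable)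
      show "AE x in lborel. integrable lborel (\<lambda>z. case (x, z) of (x, z) \<Rightarrow> U x * \<eta> z * C)"
        using \<eta> by simp
      show "integrable lborel (\<lambda>x. \<integral>z. norm (case (x, z) of (x, z) \<Rightarrow> U x * \<eta> z * C) \<partial>lborel)"
        using U by (simp add: abs_mult)
    qed measurable
    show "AE p in lborel \<Otimes>\<^sub>M lborel. norm (case p of (x, z) \<Rightarrow> U x * \<eta> z * g (x - z))
        \<le> norm (case p of (x, z) \<Rightarrow> U x * \<eta> z * C)"
      using bound by (intro AE_I2) auto
  qed measurable
  have "(\<integral>x. U x * (\<integral>y. \<eta> (x - y) * g y \<partial>lborel) \<partial>lborel) = (\<integral>x. (\<integral>z. U x * \<eta> z * g (x - z) \<partial>lborel) \<partial>lborel)"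
  proof (rule Bochner_Integration.integral_cong)
    fix x
    have "(\<integral>y. \<eta> (x - y) * g y \<partial>lborel) = (\<integral>z. \<eta> z * g (x - z) \<partial>lborel)"
      using lborel_integral_reflect[of "\<lambda>z. \<eta> z * g (x - z)" x] by simp
    then show "U x * (\<integral>y. \<eta> (x - y) * g y \<partial>lborel) = (\<integral>z. U x * \<eta> z * g (x - z) \<partial>lborel)"
      by (simp add: mult.assoc)
  qed simp
  also have "\<dots> = (\<integral>z. (\<integral>x. U x * \<eta> z * g (x - z) \<partial>lborel) \<partial>lborel)"
    using lborel_pair.Fubini_integral[OF int] by simp
  also have eq: "(\<lambda>z. \<integral>x. U x * \<eta> z * g (x - z) \<partial>lborel) = (\<lambda>z. \<eta> z * (\<integral>y. U (y + z) * g y \<partial>lborel))"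
    unfolding trans by (simp add: mult_ac fun_eq_iff flip: integral_mult_right_zero)
  finally show "(\<integral>x. U x * (\<integral>y. \<eta> (x - y) * g y \<partial>lborel) \<partial>lborel)
    = (\<integral>z. \<eta> z * (\<integral>y. U (y + z) * g y \<partial>lborel) \<partial>lborel)" .
  show "integrable lborel (\<lambda>z. \<eta> z * (\<integral>y. U (y + z) * g y \<partial>lborel))"
    using lborel_pair.integrable_snd[OF int] unfolding eq[symmetric] by simp
qed

text \<open>The function \<open>G\<close> is continuous at 0 by L1 continuity of translations, and
  \<open>\<eta> n\<close> is a probability density concentrating at the origin.\<close>

lemma mollification_tendsto:
  fixes U g :: "'a::euclidean_space \<Rightarrow> real"
  assumes U: "integrable lborel U"
    and g[measurable]: "g \<in> borel_measurable borel" and C: "\<And>y. \<bar>g y\<bar> \<le> C"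
    and \<eta>: "\<And>n. C1c (\<eta> n)" "\<And>n x. 0 \<le> \<eta> n x" "\<And>n. (\<integral>x. \<eta> n x \<partial>lborel) = 1"
      "\<And>n x. norm x \<ge> inverse (real (Suc n)) \<Longrightarrow> \<eta> n x = 0"
  shows "(\<lambda>n. \<integral>x. U x * (\<integral>y. \<eta> n (x - y) * g y \<partial>lborel) \<partial>lborel) \<longlonglongrightarrow> (\<integral>x. U x * g x \<partial>lborel)"
proof -
  have [measurable]: "U \<in> borel_measurable borel" using U by auto
  have i\<eta>: "integrable lborel (\<eta> n)" for n by (rule C1c_integrable[OF \<eta>(1)])
  define G where "G z = (\<integral>y. U (y + z) * g y \<partial>lborel)" for z
  have iU: "integrable lborel (\<lambda>y. U (y + z))" for z using U by (simp add: lborel_integral_translate)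
  have bnd: "integrable lborel (\<lambda>y. w y * g y)" if "integrable lborel w" for w
  proof (rule Bochner_Integration.integrable_bound)
    show "integrable lborel (\<lambda>y. w y * C)" using that by simp
    show "AE y in lborel. norm (w y * g y) \<le> norm (w y * C)"
    proof (rule AE_I2)
      fix y show "norm (w y * g y) \<le> norm (w y * C)"
        using C[of y] unfolding norm_mult by (intro mult_left_mono) auto
    qed
  qed (use that in measurable)
  have diff: "\<bar>G z - G 0\<bar> \<le> C * (\<integral>y. \<bar>U (y + z) - U y\<bar> \<partial>lborel)" for z
  proof -
    have "G z - G 0 = (\<integral>y. (U (y + z) - U y) * g y \<partial>lborel)"
      using bnd[OF iU] bnd[OF U] by (simp add: G_def left_diff_distrib)
    also have "\<bar>\<dots>\<bar> \<le> (\<integral>y. \<bar>(U (y + z) - U y) * g y\<bar> \<partial>lborel)" by (rule integral_abs_bound)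
    also have "\<dots> \<le> (\<integral>y. C * \<bar>U (y + z) - U y\<bar> \<partial>lborel)"
    proof (rule integral_mono)
      show "integrable lborel (\<lambda>y. \<bar>(U (y + z) - U y) * g y\<bar>)" using bnd[of "\<lambda>y. U (y + z) - U y"] iU U by simp
      show "\<bar>(U (y + z) - U y) * g y\<bar> \<le> C * \<bar>U (y + z) - U y\<bar>" for y
        using C[of y] unfolding abs_mult by (subst mult.commute) (intro mult_right_mono, auto)
    qed (use iU U in auto)
    finally show ?thesis by simp
  qed
  have "G \<midarrow>0\<rightarrow> G 0"
    unfolding LIMSEQ_SEQ_conv[symmetric]
  proof (intro allI impI)
    fix Z :: "nat \<Rightarrow> 'a" assume "(\<forall>n. Z n \<noteq> 0) \<and> Z \<longlonglongrightarrow> 0"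
    then have "(\<lambda>n. \<integral>y. \<bar>U (y + Z n) - U y\<bar> \<partial>lborel) \<longlonglongrightarrow> 0" using L1_translation[OF U] by blast
    then have "(\<lambda>n. C * (\<integral>y. \<bar>U (y + Z n) - U y\<bar> \<partial>lborel)) \<longlonglongrightarrow> 0" by (rule tendsto_mult_right_zero)
    then have "(\<lambda>n. G (Z n) - G 0) \<longlonglongrightarrow> 0" by (rule Lim_null_comparison[rotated]) (simp add: diff)
    then show "(\<lambda>n. G (Z n)) \<longlonglongrightarrow> G 0" by (simp add: LIM_zero_iff)
  qed
  then have G: "\<exists>d>0. \<forall>z. norm z < d \<longrightarrow> \<bar>G z - G 0\<bar> < e" if "e > 0" for e
    using LIM_D[of G "G 0" 0 e] that by (metis abs_0 diff_self diff_zero real_norm_def)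
  have "(\<lambda>n. \<integral>z. \<eta> n z * G z \<partial>lborel) \<longlonglongrightarrow> G 0"
  proof (rule LIMSEQ_I)
    fix e :: real assume "e > 0"
    then obtain d where d: "d > 0" "\<And>z. norm z < d \<Longrightarrow> \<bar>G z - G 0\<bar> < e / 2" using G[of "e / 2"] by auto
    obtain N where N: "inverse (real (Suc N)) < d" using reals_Archimedean[OF d(1)] by auto
    have "norm ((\<integral>z. \<eta> n z * G z \<partial>lborel) - G 0) < e" if n: "n \<ge> N" for n
    proof -
      have "inverse (real (Suc n)) \<le> inverse (real (Suc N))" using n by (intro le_imp_inverse_le) auto
      then have r: "inverse (real (Suc n)) < d" using N by linarith
      have i: "integrable lborel (\<lambda>z. \<eta> n z * G z)"
        unfolding G_def by (rule integral_mult_convolution(2)[OF U i\<eta> g C])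
      have "(\<integral>z. \<eta> n z * G z \<partial>lborel) - G 0 = (\<integral>z. \<eta> n z * (G z - G 0) \<partial>lborel)"
        using i i\<eta>[of n] \<eta>(3)[of n] by (simp add: right_diff_distrib)
      also have "\<bar>\<dots>\<bar> \<le> (\<integral>z. \<bar>\<eta> n z * (G z - G 0)\<bar> \<partial>lborel)" by (rule integral_abs_bound)
      also have "\<dots> \<le> (\<integral>z. \<eta> n z * (e / 2) \<partial>lborel)"
      proof (rule integral_mono)
        show "integrable lborel (\<lambda>z. \<bar>\<eta> n z * (G z - G 0)\<bar>)"
          using i i\<eta>[of n] by (simp add: right_diff_distrib)
        show "\<bar>\<eta> n z * (G z - G 0)\<bar> \<le> \<eta> n z * (e / 2)" for z
        proof (cases "norm z < inverse (real (Suc n))")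
          case True
          then have "\<bar>G z - G 0\<bar> \<le> e / 2" using d(2)[of z] r by simp
          then show ?thesis using \<eta>(2)[of n z] unfolding abs_mult by (intro mult_mono) auto
        next
          case False then show ?thesis using \<eta>(4)[of n z] by simp
        qed
      qed (use i\<eta> in simp)
      also have "\<dots> = e / 2" using \<eta>(3)[of n] by simp
      finally show ?thesis using \<open>e > 0\<close> by simp
    qed
    then show "\<exists>N. \<forall>n\<ge>N. norm ((\<integral>z. \<eta> n z * G z \<partial>lborel) - G 0) < e" by blast
  qed
  moreover have "(\<integral>x. U x * (\<integral>y. \<eta> n (x - y) * g y \<partial>lborel) \<partial>lborel) = (\<integral>z. \<eta> n z * G z \<partial>lborel)" for n
    unfolding G_def by (rule integral_mult_convolution(1)[OF U i\<eta> g C])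
  ultimately show ?thesis by (simp add: G_def)
qed

subsection \<open>Total variation and weak divergence\<close>

text \<open>The test function is \<open>y \<mapsto> k (x - y)\<close>. Two signs cancel: one from
  differentiating the reflected kernel, one from the definition of weak divergence.\<close>

lemma mollified_weak_divergence:
  fixes v :: "'a::euclidean_space \<Rightarrow> 'a" and g :: "'a \<Rightarrow> real"
  assumes v: "v \<in> borel_measurable borel" "\<And>y. norm (v y) \<le> C"
    and weak: "\<And>\<psi>. C1c \<psi> \<Longrightarrow> (\<integral>x. v x \<bullet> grad \<psi> x \<partial>lborel) = - (\<integral>x. g x * \<psi> x \<partial>lborel)"
    and k: "C1c k"
  shows "(\<Sum>i\<in>Basis. (\<integral>y. frechet_derivative k (at (x - y)) i *\<^sub>R v y \<partial>lborel) \<bullet> i)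
    = (\<integral>y. k (x - y) * g y \<partial>lborel)"
proof -
  obtain r where r: "\<And>x h. norm x > r \<Longrightarrow> frechet_derivative k (at x) h = 0"
    using C1c_support[OF k] by metis
  have int: "integrable lborel (\<lambda>y. frechet_derivative k (at (x - y)) i *\<^sub>R v y)" for i
    by (rule integrable_convolution[OF v C1c_continuous_derivative[OF k] r])
  have "(\<Sum>i\<in>Basis. (\<integral>y. frechet_derivative k (at (x - y)) i *\<^sub>R v y \<partial>lborel) \<bullet> i)
      = (\<Sum>i\<in>Basis. (\<integral>y. (frechet_derivative k (at (x - y)) i *\<^sub>R v y) \<bullet> i \<partial>lborel))"
    by (intro sum.cong refl integral_inner_left[symmetric] int)
  also have "\<dots> = (\<integral>y. (\<Sum>i\<in>Basis. (frechet_derivative k (at (x - y)) i *\<^sub>R v y) \<bullet> i) \<partial>lborel)"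
    using int by (intro Bochner_Integration.integral_sum[symmetric] integrable_inner_left) auto
  also have "\<dots> = (\<integral>y. - (v y \<bullet> grad (\<lambda>y. k (x - y)) y) \<partial>lborel)"
  proof (rule Bochner_Integration.integral_cong)
    fix y
    have "v y \<bullet> grad (\<lambda>y. k (x - y)) y = grad (\<lambda>y. k (x - y)) y \<bullet> v y" by (rule inner_commute)
    also have "\<dots> = frechet_derivative (\<lambda>y. k (x - y)) (at y) (v y)"
      by (rule C1c_grad_inner[OF C1c_translate(1)[OF k]])
    also have "\<dots> = - (grad k (x - y) \<bullet> v y)"
      by (simp only: C1c_translate(2)[OF k] C1c_grad_inner[OF k])
    also have "grad k (x - y) \<bullet> v y = (\<Sum>i\<in>Basis. (frechet_derivative k (at (x - y)) i *\<^sub>R v y) \<bullet> i)"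
      by (simp add: grad_def inner_sum_left inner_commute[of "v y"])
    finally show "(\<Sum>i\<in>Basis. (frechet_derivative k (at (x - y)) i *\<^sub>R v y) \<bullet> i)
        = - (v y \<bullet> grad (\<lambda>y. k (x - y)) y)" by simp
  qed simp
  also have "\<dots> = (\<integral>y. k (x - y) * g y \<partial>lborel)"
    using weak[OF C1c_translate(1)[OF k]] by (simp add: mult.commute)
  finally show ?thesis .
qed

text \<open>The mollifications of \<open>g\<close> and \<open>h\<close> are both the divergence of
  the same mollified field, hence equal, and the limit transfers this to the integrals. It
  reconciles the divergence hidden in \<open>calV\<close> with the one named in the theorem.\<close>

lemma integral_weak_divergence_unique:
  fixes v :: "'a::euclidean_space \<Rightarrow> 'a" and g h U :: "'a \<Rightarrow> real"
  assumes v: "v \<in> borel_measurable borel" "\<And>y. norm (v y) \<le> C"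
    and g: "g \<in> borel_measurable borel" "\<And>y. \<bar>g y\<bar> \<le> A"
      "\<And>\<psi>. C1c \<psi> \<Longrightarrow> (\<integral>x. v x \<bullet> grad \<psi> x \<partial>lborel) = - (\<integral>x. g x * \<psi> x \<partial>lborel)"
    and h: "h \<in> borel_measurable borel" "\<And>y. \<bar>h y\<bar> \<le> B"
      "\<And>\<psi>. C1c \<psi> \<Longrightarrow> (\<integral>x. v x \<bullet> grad \<psi> x \<partial>lborel) = - (\<integral>x. h x * \<psi> x \<partial>lborel)"
    and U: "integrable lborel U"
  shows "(\<integral>x. U x * g x \<partial>lborel) = (\<integral>x. U x * h x \<partial>lborel)"
proof -
  obtain \<eta> :: "nat \<Rightarrow> 'a \<Rightarrow> real" where \<eta>: "\<And>n. C1c (\<eta> n)" "\<And>n x. 0 \<le> \<eta> n x"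
    "\<And>n. (\<integral>x. \<eta> n x \<partial>lborel) = 1" "\<And>n x. norm x \<ge> inverse (real (Suc n)) \<Longrightarrow> \<eta> n x = 0"
    using mollifier by blast
  have "(\<lambda>n. \<integral>x. U x * (\<integral>y. \<eta> n (x - y) * g y \<partial>lborel) \<partial>lborel) \<longlonglongrightarrow> (\<integral>x. U x * g x \<partial>lborel)"
    by (rule mollification_tendsto[OF U g(1,2) \<eta>])
  moreover have "(\<lambda>n. \<integral>x. U x * (\<integral>y. \<eta> n (x - y) * h y \<partial>lborel) \<partial>lborel) \<longlonglongrightarrow> (\<integral>x. U x * h x \<partial>lborel)"
    by (rule mollification_tendsto[OF U h(1,2) \<eta>])
  moreover have "(\<integral>y. \<eta> n (x - y) * g y \<partial>lborel) = (\<integral>y. \<eta> n (x - y) * h y \<partial>lborel)" for n x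
    using mollified_weak_divergence[OF v g(3) \<eta>(1)] mollified_weak_divergence[OF v h(3) \<eta>(1)] by metis
  ultimately show ?thesis by (simp add: LIMSEQ_unique)
qed

text \<open>Mollifying \<open>v\<close> and multiplying by a cutoff yields competitors for \<open>TV_K\<close>, because the set is
  convex and contains \<open>0\<close>.\<close>
lemma TV_K_ge_borel:
  fixes v :: "'a::euclidean_space \<Rightarrow> 'a" and g u \<phi> :: "'a \<Rightarrow> real"
  assumes \<phi>: "\<And>y. 0 \<le> \<phi> y"
    and v: "v \<in> borel_measurable borel" "\<And>y. norm (v y) \<le> C" "\<And>x y. v x \<bullet> y \<le> \<phi> y"
    and g: "g \<in> borel_measurable borel" "\<And>y. \<bar>g y\<bar> \<le> A"
      "\<And>\<psi>. C1c \<psi> \<Longrightarrow> (\<integral>x. v x \<bullet> grad \<psi> x \<partial>lborel) = - (\<integral>x. g x * \<psi> x \<partial>lborel)"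
    and u: "integrable lborel u"
  shows "ereal (- (\<integral>x. u x * g x \<partial>lborel)) \<le> TV_K {z. \<forall>y. z \<bullet> y \<le> \<phi> y} u"
proof -
  note [measurable] = v(1) g(1)
  have [measurable]: "u \<in> borel_measurable borel" using u by auto
  obtain \<eta> :: "nat \<Rightarrow> 'a \<Rightarrow> real" where \<eta>: "\<And>n. C1c (\<eta> n)" "\<And>n x. 0 \<le> \<eta> n x"
    "\<And>n. (\<integral>x. \<eta> n x \<partial>lborel) = 1" "\<And>n x. norm x \<ge> inverse (real (Suc n)) \<Longrightarrow> \<eta> n x = 0"
    using mollifier by blast
  have \<eta>_supp: "\<eta> n x = 0" if "norm x > 1" for n x
    using that le_imp_inverse_le[of 1 "real (Suc n)"] by (intro \<eta>(4)) auto
  have [measurable]: "\<eta> n \<in> borel_measurable borel" for n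
    by (rule borel_measurable_continuous_onI[OF C1c_continuous[OF \<eta>(1)]])
  define V where "V n x = (\<integral>y. \<eta> n (x - y) *\<^sub>R v y \<partial>lborel)" for n x
  define E where "E n x h = (\<integral>y. frechet_derivative (\<eta> n) (at (x - y)) h *\<^sub>R v y \<partial>lborel)" for n x h
  define G where "G n x = (\<integral>y. \<eta> n (x - y) * g y \<partial>lborel)" for n x
  have VE: "(V n has_derivative E n x) (at x)" for n x
    unfolding V_def[abs_def] E_def[abs_def] by (rule has_derivative_convolution[OF v(1,2) \<eta>(1)])
  have contE: "continuous_on UNIV (\<lambda>x. E n x h)" for n h
  proof -
    obtain r where r: "\<And>x h. norm x > r \<Longrightarrow> frechet_derivative (\<eta> n) (at x) h = 0"
      using C1c_support[OF \<eta>(1)] by metis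
    show ?thesis
      unfolding E_def by (rule continuous_convolution[OF v(1,2) C1c_continuous_derivative[OF \<eta>(1)] r])
  qed
  have contV: "continuous_on UNIV (V n)" for n
    unfolding V_def by (rule continuous_convolution[OF v(1,2) C1c_continuous[OF \<eta>(1)] \<eta>_supp])
  have contG: "continuous_on UNIV (G n)" for n
  proof -
    have "continuous_on UNIV (\<lambda>x. \<integral>y. \<eta> n (x - y) *\<^sub>R g y \<partial>lborel)"
      by (rule continuous_convolution[where r=1 and C=A, OF g(1) _ C1c_continuous[OF \<eta>(1)] \<eta>_supp]) (simp_all add: g(2))
    then show ?thesis by (simp add: G_def[abs_def])
  qed
  have [measurable]: "V n \<in> borel_measurable borel" "G n \<in> borel_measurable borel" for n
    using contV contG by (auto intro: borel_measurable_continuous_onI)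
  have EG: "(\<Sum>i\<in>Basis. E n x i \<bullet> i) = G n x" for n x
    unfolding E_def G_def by (rule mollified_weak_divergence[OF v(1,2) g(3) \<eta>(1)])
  have int\<eta>: "integrable lborel (\<lambda>y. \<eta> n (x - y))" for n x
    by (rule C1c_integrable[OF C1c_translate(1)[OF \<eta>(1)]])
  have one: "(\<integral>y. \<eta> n (x - y) \<partial>lborel) = 1" for n x
    using lborel_integral_reflect[of "\<eta> n" x] \<eta>(3) by simp
  have intV: "integrable lborel (\<lambda>y. \<eta> n (x - y) *\<^sub>R v y)" for n x
    by (rule integrable_convolution[OF v(1,2) C1c_continuous[OF \<eta>(1)] \<eta>_supp])
  have Vle: "V n x \<bullet> z \<le> \<phi> z" for n x z
  proof -
    have "V n x \<bullet> z = (\<integral>y. (\<eta> n (x - y) *\<^sub>R v y) \<bullet> z \<partial>lborel)"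
      unfolding V_def by (rule integral_inner_left[symmetric]) (rule intV)
    also have "\<dots> \<le> (\<integral>y. \<eta> n (x - y) * \<phi> z \<partial>lborel)"
    proof (rule integral_mono)
      show "integrable lborel (\<lambda>y. (\<eta> n (x - y) *\<^sub>R v y) \<bullet> z)" using intV by (rule integrable_inner_left)
      show "(\<eta> n (x - y) *\<^sub>R v y) \<bullet> z \<le> \<eta> n (x - y) * \<phi> z" for y
        using v(3) \<eta>(2) by (simp add: mult_left_mono)
    qed (use int\<eta> in simp)
    also have "\<dots> = \<phi> z" using one by simp
    finally show ?thesis .
  qed
  have Vnorm: "norm (V n x) \<le> C" for n x
  proof -
    have "norm (V n x) \<le> (\<integral>y. norm (\<eta> n (x - y) *\<^sub>R v y) \<partial>lborel)"
      unfolding V_def by (rule integral_norm_bound)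
    also have "\<dots> \<le> (\<integral>y. \<eta> n (x - y) * C \<partial>lborel)"
    proof (rule integral_mono)
      show "integrable lborel (\<lambda>y. norm (\<eta> n (x - y) *\<^sub>R v y))" using intV by (rule integrable_norm)
      show "norm (\<eta> n (x - y) *\<^sub>R v y) \<le> \<eta> n (x - y) * C" for y
        using v(2) \<eta>(2) by (simp add: mult_left_mono)
    qed (use int\<eta> in simp)
    also have "\<dots> = C" using one by simp
    finally show ?thesis .
  qed
  define K where "K = {z. \<forall>y. z \<bullet> y \<le> \<phi> y}"
  have C: "C \<ge> 0" using v(2) norm_ge_zero order_trans by blast
  have ub: "integrable lborel (\<lambda>x. u x * bump R x)" if "R > 0" for R :: real
  proof (rule Bochner_Integration.integrable_bound[OF u])
    have [measurable]: "bump R \<in> borel_measurable (borel :: 'a measure)"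
      by (rule borel_measurable_continuous_onI[OF C1c_continuous[OF C1c_bump[OF that]]])
    show "(\<lambda>x. u x * bump R x) \<in> borel_measurable lborel" by measurable
    show "AE x in lborel. norm (u x * bump R x) \<le> norm (u x)"
    proof (rule AE_I2)
      fix x
      have "\<bar>u x\<bar> * \<bar>bump R x\<bar> \<le> \<bar>u x\<bar> * 1"
        using bump_nonneg[of R x] bump_le_1[of R x] by (intro mult_left_mono) auto
      then show "norm (u x * bump R x) \<le> norm (u x)" by (simp add: abs_mult)
    qed
  qed
  \<comment> \<open>Two limits are taken in succession: \<open>n\<close> tends to infinity for fixed
    \<open>R\<close>, and then \<open>R\<close> grows. The subtracted term bounds the contribution
    of the gradient of the cutoff, uniformly in \<open>n\<close>.\<close>
  have step: "ereal (- (\<integral>x. (u x * bump R x) * G n x \<partial>lborel) - 4 / R * C * (\<integral>x. \<bar>u x\<bar> \<partial>lborel)) \<le> TV_K K u"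
    if R: "R > 0" for n and R :: real
  proof -
    let ?\<psi> = "\<lambda>x. bump R x *\<^sub>R V n x"
    have \<psi>: "C1c ?\<psi>" by (rule C1c_scaleR[OF C1c_bump[OF R] VE contE])
    have "?\<psi> x \<in> K" for x
    proof -
      have "bump R x * (V n x \<bullet> y) \<le> \<phi> y" for y
      proof -
        have "bump R x * (V n x \<bullet> y) \<le> bump R x * \<phi> y"
          using Vle bump_nonneg by (rule mult_left_mono)
        also have "\<dots> \<le> 1 * \<phi> y" using bump_le_1 \<phi> by (rule mult_right_mono)
        finally show ?thesis by simp
      qed
      then show ?thesis by (simp add: K_def)
    qed
    with \<psi> have "ereal (- (\<integral>x. u x * divergence ?\<psi> x \<partial>lebesgue)) \<le> TV_K K u"
      unfolding TV_K_def by (intro SUP_upper) auto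
    have dv: "divergence ?\<psi> x = bump R x * G n x + grad (bump R) x \<bullet> V n x" for x
      using divergence_scaleR[OF C1c_has_derivative[OF C1c_bump[OF R]] VE] by (simp add: EG)
    have [measurable]: "bump R \<in> borel_measurable (borel :: 'a measure)"
      "grad (bump R) \<in> borel_measurable (borel :: 'a measure)"
      using C1c_continuous[OF C1c_bump[OF R]] C1c_continuous_grad[OF C1c_bump[OF R]]
      by (auto intro: borel_measurable_continuous_onI)
    have bd: "\<bar>grad (bump R) x \<bullet> V n x\<bar> \<le> 4 / R * C" for x
      using Cauchy_Schwarz_ineq2[of "grad (bump R) x" "V n x"] norm_grad_bump_le[OF R, of x] Vnorm[of n x]
        mult_mono[of "norm (grad (bump R) x)" "4 / R" "norm (V n x)" C] R by auto
    have i2: "integrable lborel (\<lambda>x. u x * (grad (bump R) x \<bullet> V n x))"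
    proof (rule Bochner_Integration.integrable_bound)
      show "integrable lborel (\<lambda>x. u x * (4 / R * C))" using u by simp
      show "AE x in lborel. norm (u x * (grad (bump R) x \<bullet> V n x)) \<le> norm (u x * (4 / R * C))"
      proof (rule AE_I2)
        fix x
        show "norm (u x * (grad (bump R) x \<bullet> V n x)) \<le> norm (u x * (4 / R * C))"
          using order_trans[OF bd[of x] abs_ge_self] unfolding norm_mult[of "u x"]
          by (intro mult_left_mono) (simp_all only: real_norm_def abs_ge_zero)
      qed
    qed measurable
    have i1: "integrable lborel (\<lambda>x. (u x * bump R x) * G n x)"
    proof (rule Bochner_Integration.integrable_bound)
      show "integrable lborel (\<lambda>x. u x * bump R x * A)" using ub[OF R] by simp
      show "AE x in lborel. norm ((u x * bump R x) * G n x) \<le> norm (u x * bump R x * A)"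
      proof (rule AE_I2)
        fix x
        have "\<bar>G n x\<bar> \<le> (\<integral>y. \<bar>\<eta> n (x - y) * g y\<bar> \<partial>lborel)"
          unfolding G_def by (rule integral_abs_bound)
        also have "\<dots> \<le> (\<integral>y. \<eta> n (x - y) * A \<partial>lborel)"
        proof (rule integral_mono)
          have "integrable lborel (\<lambda>y. \<eta> n (x - y) *\<^sub>R g y)"
            by (rule integrable_convolution[where r=1 and C=A, OF g(1) _ C1c_continuous[OF \<eta>(1)] \<eta>_supp]) (simp_all add: g(2))
          then show "integrable lborel (\<lambda>y. \<bar>\<eta> n (x - y) * g y\<bar>)" by simp
          show "\<bar>\<eta> n (x - y) * g y\<bar> \<le> \<eta> n (x - y) * A" for y
            using g(2) \<eta>(2) by (simp add: abs_mult mult_left_mono)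
        qed (use int\<eta> in simp)
        also have "\<dots> = A" using one by simp
        finally show "norm ((u x * bump R x) * G n x) \<le> norm (u x * bump R x * A)"
          unfolding norm_mult[of "u x * bump R x"] by (intro mult_left_mono) auto
      qed
    qed measurable
    have "(\<integral>x. u x * divergence ?\<psi> x \<partial>lebesgue) = (\<integral>x. u x * divergence ?\<psi> x \<partial>lborel)"
      by (rule integral_completion) (simp add: dv)
    also have "\<dots> = (\<integral>x. (u x * bump R x) * G n x + u x * (grad (bump R) x \<bullet> V n x) \<partial>lborel)"
      by (simp add: dv algebra_simps)
    also have "\<dots> = (\<integral>x. (u x * bump R x) * G n x \<partial>lborel) + (\<integral>x. u x * (grad (bump R) x \<bullet> V n x) \<partial>lborel)"
      using i1 i2 by (rule Bochner_Integration.integral_add)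
    also have "(\<integral>x. u x * (grad (bump R) x \<bullet> V n x) \<partial>lborel) \<le> (\<integral>x. 4 / R * C * \<bar>u x\<bar> \<partial>lborel)"
    proof (rule integral_mono[OF i2])
      show "u x * (grad (bump R) x \<bullet> V n x) \<le> 4 / R * C * \<bar>u x\<bar>" for x
      proof -
        have "u x * (grad (bump R) x \<bullet> V n x) \<le> \<bar>u x\<bar> * \<bar>grad (bump R) x \<bullet> V n x\<bar>"
          using abs_ge_self[of "u x * (grad (bump R) x \<bullet> V n x)"] by (simp add: abs_mult)
        also have "\<dots> \<le> \<bar>u x\<bar> * (4 / R * C)" using bd by (intro mult_left_mono) auto
        finally show ?thesis by (simp add: mult.commute)
      qed
    qed (use u in simp)
    finally have "- (\<integral>x. (u x * bump R x) * G n x \<partial>lborel) - 4 / R * C * (\<integral>x. \<bar>u x\<bar> \<partial>lborel)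
        \<le> - (\<integral>x. u x * divergence ?\<psi> x \<partial>lebesgue)" by simp
    then have "ereal (- (\<integral>x. (u x * bump R x) * G n x \<partial>lborel) - 4 / R * C * (\<integral>x. \<bar>u x\<bar> \<partial>lborel))
        \<le> ereal (- (\<integral>x. u x * divergence ?\<psi> x \<partial>lebesgue))" by simp
    also have "\<dots> \<le> TV_K K u" by fact
    finally show ?thesis .
  qed
  have "ereal (- (\<integral>x. (u x * bump R x) * g x \<partial>lborel) - 4 / R * C * (\<integral>x. \<bar>u x\<bar> \<partial>lborel)) \<le> TV_K K u"
    if R: "R > 0" for R :: real
  proof (rule LIMSEQ_le_const2)
    have "(\<lambda>n. \<integral>x. (u x * bump R x) * G n x \<partial>lborel) \<longlonglongrightarrow> (\<integral>x. (u x * bump R x) * g x \<partial>lborel)"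
      unfolding G_def by (rule mollification_tendsto[OF ub[OF R] g(1,2) \<eta>])
    then show "(\<lambda>n. ereal (- (\<integral>x. (u x * bump R x) * G n x \<partial>lborel) - 4 / R * C * (\<integral>x. \<bar>u x\<bar> \<partial>lborel)))
      \<longlonglongrightarrow> ereal (- (\<integral>x. (u x * bump R x) * g x \<partial>lborel) - 4 / R * C * (\<integral>x. \<bar>u x\<bar> \<partial>lborel))"
      by (intro tendsto_ereal tendsto_diff tendsto_minus tendsto_const)
  qed (use step[OF R] in auto)
  then have le: "ereal (- (\<integral>x. (u x * bump (real (Suc n)) x) * g x \<partial>lborel)
      - 4 / real (Suc n) * C * (\<integral>x. \<bar>u x\<bar> \<partial>lborel)) \<le> TV_K K u" for n by simp
  have "(\<lambda>n. \<integral>x. (u x * bump (real (Suc n)) x) * g x \<partial>lborel) \<longlonglongrightarrow> (\<integral>x. u x * g x \<partial>lborel)"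
  proof (rule integral_dominated_convergence[where w="\<lambda>x. \<bar>u x\<bar> * A"])
    show "AE x in lborel. (\<lambda>n. (u x * bump (real (Suc n)) x) * g x) \<longlonglongrightarrow> u x * g x"
    proof (rule AE_I2)
      fix x
      have "(\<lambda>n. (u x * bump (real (Suc n)) x) * g x) \<longlonglongrightarrow> (u x * 1) * g x"
        by (intro tendsto_mult tendsto_const bump_tendsto_1)
      then show "(\<lambda>n. (u x * bump (real (Suc n)) x) * g x) \<longlonglongrightarrow> u x * g x" by simp
    qed
    show "AE x in lborel. norm ((u x * bump (real (Suc n)) x) * g x) \<le> \<bar>u x\<bar> * A" for n
    proof (rule AE_I2)
      fix x
      have "\<bar>u x\<bar> * bump (real (Suc n)) x * \<bar>g x\<bar> \<le> \<bar>u x\<bar> * 1 * A"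
        using g(2)[of x] bump_le_1[of _ x] bump_nonneg[of _ x] by (intro mult_mono) auto
      then show "norm ((u x * bump (real (Suc n)) x) * g x) \<le> \<bar>u x\<bar> * A"
        using bump_nonneg[of _ x] by (simp add: abs_mult)
    qed
    show "(\<lambda>x. (u x * bump (real (Suc n)) x) * g x) \<in> borel_measurable lborel" for n
      using borel_measurable_integrable[OF ub[of "real (Suc n)"]] by measurable
  qed (use u in simp_all)
  moreover have "(\<lambda>n. 4 / real (Suc n) * C * (\<integral>x. \<bar>u x\<bar> \<partial>lborel)) \<longlonglongrightarrow> 4 * 0 * C * (\<integral>x. \<bar>u x\<bar> \<partial>lborel)"
    unfolding divide_inverse by (intro tendsto_mult tendsto_const LIMSEQ_inverse_real_of_nat)
  ultimately have "(\<lambda>n. - (\<integral>x. (u x * bump (real (Suc n)) x) * g x \<partial>lborel)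
      - 4 / real (Suc n) * C * (\<integral>x. \<bar>u x\<bar> \<partial>lborel)) \<longlonglongrightarrow>
      - (\<integral>x. u x * g x \<partial>lborel) - 4 * 0 * C * (\<integral>x. \<bar>u x\<bar> \<partial>lborel)"
    by (intro tendsto_diff tendsto_minus)
  from tendsto_ereal[OF this] have "ereal (- (\<integral>x. u x * g x \<partial>lborel) - 4 * 0 * C * (\<integral>x. \<bar>u x\<bar> \<partial>lborel)) \<le> TV_K K u"
    by (rule LIMSEQ_le_const2) (use le in auto)
  then show ?thesis by (simp add: K_def)
qed

section \<open>From Borel functions to Lebesgue measurable functions\<close>

lemma lebesgue_borel_representative:
  fixes f :: "'a::euclidean_space \<Rightarrow> 'b::euclidean_space"
  assumes "f \<in> borel_measurable lebesgue"
  obtains f' where "f' \<in> borel_measurable borel" "AE x in lebesgue. f x = f' x"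
proof -
  have "\<exists>h\<in>borel_measurable lborel. AE x in lborel. f x \<bullet> i = h x" for i
    using assms by (intro completion_ex_borel_measurable_real) simp
  then obtain h where h: "\<And>i. h i \<in> borel_measurable lborel" "\<And>i. AE x in lborel. f x \<bullet> i = h i x"
    by metis
  have "AE x in lborel. \<forall>i\<in>Basis. f x \<bullet> i = h i x"
    using h(2) by (intro AE_finite_allI) auto
  then have "AE x in lborel. f x = (\<Sum>i\<in>Basis. h i x *\<^sub>R i)"
  proof eventually_elim
    case (elim x)
    have "f x = (\<Sum>i\<in>Basis. (f x \<bullet> i) *\<^sub>R i)" by (simp add: euclidean_representation)
    then show ?case using elim by simp
  qed
  moreover have "(\<lambda>x. \<Sum>i\<in>Basis. h i x *\<^sub>R i) \<in> borel_measurable borel"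
    using h(1) by simp
  ultimately show ?thesis using that AE_completion by blast
qed

text \<open>Values that violate a constraint occur only on a null set and are replaced by 0, which
  lies in \<open>S\<close>. Constraints known almost everywhere thereby hold at every point, as the
  Borel versions of the estimates require.\<close>

lemma Linf_borel_representative:
  fixes f :: "'a::euclidean_space \<Rightarrow> 'b::euclidean_space"
  assumes "Linf f" and S: "closed S" "0 \<in> S" and ae: "AE x in lebesgue. f x \<in> S"
  shows "\<exists>f' C. f' \<in> borel_measurable borel \<and> (\<forall>x. f' x \<in> S) \<and> (\<forall>x. norm (f' x) \<le> C) \<and>
    (AE x in lebesgue. f x = f' x)"
proof -
  obtain C where f: "f \<in> borel_measurable lebesgue" and C: "AE x in lebesgue. norm (f x) \<le> C"
    using assms(1) unfolding Linf_def by auto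
  obtain h where [measurable]: "h \<in> borel_measurable borel" and h: "AE x in lebesgue. f x = h x"
    using lebesgue_borel_representative[OF f] by metis
  let ?B = "S \<inter> cball 0 C"
  have [measurable]: "?B \<in> sets borel" using S(1) by simp
  show ?thesis
  \<comment> \<open>The absolute value makes the bound valid for the default value 0 whatever the
    sign of \<open>C\<close>.\<close>
  proof (intro exI[of _ "\<lambda>x. if h x \<in> ?B then h x else 0"] exI[of _ "\<bar>C\<bar>"] conjI allI)
    show "(\<lambda>x. if h x \<in> ?B then h x else 0) \<in> borel_measurable borel" by measurable
    show "(if h x \<in> ?B then h x else 0) \<in> S" for x using S(2) by auto
    show "norm (if h x \<in> ?B then h x else 0) \<le> \<bar>C\<bar>" for x by auto
    show "AE x in lebesgue. f x = (if h x \<in> ?B then h x else 0)"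
      using h C ae by eventually_elim auto
  qed
qed

lemma Linf_bounded_borel_representative:
  fixes f :: "'a::euclidean_space \<Rightarrow> 'b::euclidean_space"
  assumes "Linf f"
  shows "\<exists>f' C. f' \<in> borel_measurable borel \<and> (\<forall>x. norm (f' x) \<le> C) \<and> (AE x in lebesgue. f x = f' x)"
  using Linf_borel_representative[OF assms closed_UNIV] by simp

lemma borel_measurable_lebesgueI: "f \<in> borel_measurable borel \<Longrightarrow> f \<in> borel_measurable lebesgue"
  by (rule measurable_completion) simp

lemma lebesgue_integral_eq_borel:
  fixes f h :: "'a::euclidean_space \<Rightarrow> real"
  assumes "AE x in lebesgue. f x = h x" "h \<in> borel_measurable borel"
    "f \<in> borel_measurable lebesgue"
  shows "(\<integral>x. f x \<partial>lebesgue) = (\<integral>x. h x \<partial>lborel)"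
proof -
  have "(\<integral>x. f x \<partial>lebesgue) = (\<integral>x. h x \<partial>lebesgue)"
    using assms by (intro integral_cong_AE) (auto intro: borel_measurable_lebesgueI)
  then show ?thesis using assms(2) by (simp add: integral_completion)
qed

lemma weak_divergence_borel:
  fixes v w :: "'a::euclidean_space \<Rightarrow> 'a" and g h :: "'a \<Rightarrow> real"
  assumes wd: "weak_divergence v g" and vg: "Linf v" "Linf g"
    and w: "w \<in> borel_measurable borel" "AE x in lebesgue. v x = w x"
    and h: "h \<in> borel_measurable borel" "AE x in lebesgue. g x = h x" and \<psi>: "C1c \<psi>"
  shows "(\<integral>x. w x \<bullet> grad \<psi> x \<partial>lborel) = - (\<integral>x. h x * \<psi> x \<partial>lborel)"
proof -
  note [measurable] = w(1) h(1)
  have m[measurable]: "\<psi> \<in> borel_measurable borel" "grad \<psi> \<in> borel_measurable borel"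
    using C1c_continuous[OF \<psi>] C1c_continuous_grad[OF \<psi>] by (auto intro: borel_measurable_continuous_onI)
  have [measurable]: "v \<in> borel_measurable lebesgue" "g \<in> borel_measurable lebesgue"
    using vg by (auto simp: Linf_def)
  note [measurable] = m[THEN borel_measurable_lebesgueI]
  have "(\<integral>x. v x \<bullet> grad \<psi> x \<partial>lebesgue) = (\<integral>x. w x \<bullet> grad \<psi> x \<partial>lborel)"
    using w(2) by (intro lebesgue_integral_eq_borel) (auto elim!: eventually_mono)
  moreover have "(\<integral>x. g x * \<psi> x \<partial>lebesgue) = (\<integral>x. h x * \<psi> x \<partial>lborel)"
    using h(2) by (intro lebesgue_integral_eq_borel) (auto elim!: eventually_mono)
  ultimately show ?thesis using wd \<psi> unfolding weak_divergence_def by simp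
qed

lemma integrable_borel_representative:
  fixes u :: "'a::euclidean_space \<Rightarrow> real"
  assumes "integrable lebesgue u"
  obtains w where "integrable lborel w" "w \<in> borel_measurable borel" "AE x in lebesgue. u x = w x"
proof -
  obtain w where w: "w \<in> borel_measurable borel" "AE x in lebesgue. u x = w x"
    using lebesgue_borel_representative[OF borel_measurable_integrable[OF assms]] by metis
  have "integrable lebesgue w"
    using w assms by (subst integrable_cong_AE[of w _ u]) (auto intro: borel_measurable_lebesgueI elim: eventually_mono)
  then show ?thesis using w that by (simp add: integrable_completion)
qed

lemma weak_divergence_integral_unique:
  fixes v :: "'a::euclidean_space \<Rightarrow> 'a" and g h u :: "'a \<Rightarrow> real"
  assumes "Linf v" "weak_divergence v g" "Linf g" "weak_divergence v h" "Linf h"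
    and u: "integrable lebesgue u"
  shows "(\<integral>x. u x * g x \<partial>lebesgue) = (\<integral>x. u x * h x \<partial>lebesgue)"
proof -
  obtain v' C where v': "v' \<in> borel_measurable borel" "\<And>x. norm (v' x) \<le> C" "AE x in lebesgue. v x = v' x"
    using Linf_bounded_borel_representative[OF assms(1)] by blast
  obtain g' A where g': "g' \<in> borel_measurable borel" "\<And>x. norm (g' x) \<le> A" "AE x in lebesgue. g x = g' x"
    using Linf_bounded_borel_representative[OF assms(3)] by blast
  obtain h' B where h': "h' \<in> borel_measurable borel" "\<And>x. norm (h' x) \<le> B" "AE x in lebesgue. h x = h' x"
    using Linf_bounded_borel_representative[OF assms(5)] by blast
  obtain u' where u': "integrable lborel u'" "u' \<in> borel_measurable borel" "AE x in lebesgue. u x = u' x"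
    using integrable_borel_representative[OF u] by metis
  have [measurable]: "u \<in> borel_measurable lebesgue" "g \<in> borel_measurable lebesgue" "h \<in> borel_measurable lebesgue"
    using assms(3,5) u by (auto simp: Linf_def)
  note [measurable] = u'(2) g'(1) h'(1)
  have "(\<integral>x. u' x * g' x \<partial>lborel) = (\<integral>x. u' x * h' x \<partial>lborel)"
    by (rule integral_weak_divergence_unique[OF v'(1,2) g'(1) _ weak_divergence_borel[OF assms(2,1,3) v'(1,3) g'(1,3)]
          h'(1) _ weak_divergence_borel[OF assms(4,1,5) v'(1,3) h'(1,3)] u'(1)])
      (use g'(2) h'(2) in auto)
  moreover have "(\<integral>x. u x * g x \<partial>lebesgue) = (\<integral>x. u' x * g' x \<partial>lborel)"
    using u'(3) g'(3) by (intro lebesgue_integral_eq_borel) (auto elim!: eventually_elim2)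
  moreover have "(\<integral>x. u x * h x \<partial>lebesgue) = (\<integral>x. u' x * h' x \<partial>lborel)"
    using u'(3) h'(3) by (intro lebesgue_integral_eq_borel) (auto elim!: eventually_elim2)
  ultimately show ?thesis by simp
qed

text \<open>Only the almost-everywhere classes of \<open>v\<close>, \<open>g\<close> and
  \<open>u\<close> enter, so all three are replaced by Borel representatives. The constraint set is
  closed as an intersection of half-spaces, which lets the representative of \<open>v\<close> take
  its values there everywhere.\<close>

lemma TV_K_ge:
  fixes v :: "'a::euclidean_space \<Rightarrow> 'a" and g u \<phi> :: "'a \<Rightarrow> real"
  assumes \<phi>: "\<And>y. 0 \<le> \<phi> y"
    and v: "Linf v" "AE x in lebesgue. v x \<in> {z. \<forall>y. z \<bullet> y \<le> \<phi> y}"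
    and g: "weak_divergence v g" "Linf g" and u: "integrable lebesgue u"
  shows "ereal (- (\<integral>x. u x * g x \<partial>lebesgue)) \<le> TV_K {z. \<forall>y. z \<bullet> y \<le> \<phi> y} u"
proof -
  let ?K = "{z. \<forall>y. z \<bullet> y \<le> \<phi> y}"
  have "?K = (\<Inter>y. {z. z \<bullet> y \<le> \<phi> y})" by auto
  moreover have "closed (\<Inter>y. {z. z \<bullet> y \<le> \<phi> y})"
    by (intro closed_INT ballI closed_Collect_le continuous_intros)
  ultimately have closed: "closed ?K" by simp
  have 0: "0 \<in> ?K" using \<phi> by simp
  obtain v' C where v': "v' \<in> borel_measurable borel" "\<And>x. v' x \<in> ?K" "\<And>x. norm (v' x) \<le> C"
    "AE x in lebesgue. v x = v' x"
    using Linf_borel_representative[OF v(1) closed 0 v(2)] by blast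
  obtain g' A where g': "g' \<in> borel_measurable borel" "\<And>x. norm (g' x) \<le> A" "AE x in lebesgue. g x = g' x"
    using Linf_bounded_borel_representative[OF g(2)] by blast
  obtain u' where u': "integrable lborel u'" "u' \<in> borel_measurable borel" "AE x in lebesgue. u x = u' x"
    using integrable_borel_representative[OF u] by metis
  have [measurable]: "u \<in> borel_measurable lebesgue" "g \<in> borel_measurable lebesgue"
    using g(2) u by (auto simp: Linf_def)
  note [measurable] = u'(2) g'(1)
  have "(\<integral>x. u x * divergence \<psi> x \<partial>lebesgue) = (\<integral>x. u' x * divergence \<psi> x \<partial>lebesgue)" if "C1c \<psi>" for \<psi>
  proof -
    have m[measurable]: "divergence \<psi> \<in> borel_measurable borel"
      by (rule borel_measurable_continuous_onI[OF C1c_continuous_divergence[OF that]])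
    note [measurable] = borel_measurable_lebesgueI[OF m]
    have "(\<integral>x. u x * divergence \<psi> x \<partial>lebesgue) = (\<integral>x. u' x * divergence \<psi> x \<partial>lborel)"
      using u'(3) by (intro lebesgue_integral_eq_borel) (auto elim!: eventually_mono)
    then show ?thesis by (simp add: integral_completion)
  qed
  then have "TV_K ?K u = TV_K ?K u'"
    unfolding TV_K_def by (intro SUP_cong) auto
  moreover have "ereal (- (\<integral>x. u' x * g' x \<partial>lborel)) \<le> TV_K ?K u'"
    by (rule TV_K_ge_borel[OF \<phi> v'(1,3) _ g'(1) _ weak_divergence_borel[OF g(1) v(1) g(2) v'(1,4) g'(1,3)] u'(1)])
      (use v'(2) g'(2) in auto)
  moreover have "(\<integral>x. u x * g x \<partial>lebesgue) = (\<integral>x. u' x * g' x \<partial>lborel)"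
    using u'(3) g'(3) by (intro lebesgue_integral_eq_borel) (auto elim!: eventually_elim2)
  ultimately show ?thesis by simp
qed

subsection \<open>Duality\<close>

lemma admissible_anisoD:
  assumes "admissible_aniso \<phi>"
  shows "0 \<le> \<phi> y" "\<phi> 0 = 0" "\<alpha> \<ge> 0 \<Longrightarrow> \<phi> (\<alpha> *\<^sub>R y) = \<alpha> * \<phi> y"
    "\<phi> (y + z) \<le> \<phi> y + \<phi> z" "continuous_on UNIV \<phi>"
proof -
  have hom: "\<alpha> > 0 \<Longrightarrow> \<phi> (\<alpha> *\<^sub>R y) = \<alpha> * \<phi> y" for \<alpha> y
    using assms by (simp add: admissible_aniso_def)
  have conv: "convex_on UNIV \<phi>" using assms by (simp add: admissible_aniso_def)
  show "0 \<le> \<phi> y" and z: "\<phi> 0 = 0" using assms by (simp_all add: admissible_aniso_def)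
  show "\<alpha> \<ge> 0 \<Longrightarrow> \<phi> (\<alpha> *\<^sub>R y) = \<alpha> * \<phi> y"
    using hom z by (cases "\<alpha> = 0") auto
  show "continuous_on UNIV \<phi>" by (rule convex_on_continuous[OF open_UNIV conv])
  \<comment> \<open>Convexity at the midpoint of \<open>2 y\<close> and \<open>2 z\<close>;
    homogeneity then removes the factor 2.\<close>
  have "\<phi> ((1 - 1/2) *\<^sub>R (2 *\<^sub>R y) + (1/2) *\<^sub>R (2 *\<^sub>R z)) \<le> (1 - 1/2) * \<phi> (2 *\<^sub>R y) + (1/2) * \<phi> (2 *\<^sub>R z)"
    by (rule convex_onD[OF conv]) auto
  then show "\<phi> (y + z) \<le> \<phi> y + \<phi> z" by (simp add: hom)
qed

text \<open>Homogeneity extends a bound on the compact unit sphere to the whole space. The constant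
  \<open>B\<close> later bounds the separating functional in L1.\<close>

lemma admissible_aniso_linear_bound:
  fixes \<phi> :: "'a::euclidean_space \<Rightarrow> real"
  assumes "admissible_aniso \<phi>"
  obtains B where "B \<ge> 0" "\<And>y. \<phi> y \<le> B * norm y"
proof -
  note \<phi> = admissible_anisoD[OF assms]
  have "compact (\<phi> ` sphere 0 1)"
    by (intro compact_continuous_image compact_sphere continuous_on_subset[OF \<phi>(5)]) auto
  then obtain B where B: "B > 0" "\<forall>t\<in>\<phi> ` sphere 0 1. norm t \<le> B"
    using compact_imp_bounded bounded_pos by metis
  have "\<phi> y \<le> B * norm y" for y
  proof (cases "y = 0")
    case False
    then have "\<phi> (norm y *\<^sub>R sgn y) = norm y * \<phi> (sgn y)" by (intro \<phi>(3)) simp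
    moreover have "norm y *\<^sub>R sgn y = y" using False by (simp add: sgn_div_norm)
    moreover have "\<phi> (sgn y) \<le> B"
      using B(2) False by (auto simp: norm_sgn dest!: bspec[of _ _ "sgn y"])
    ultimately have "\<phi> y = norm y * \<phi> (sgn y)" by simp
    also have "\<dots> \<le> norm y * B" using \<open>\<phi> (sgn y) \<le> B\<close> by (rule mult_left_mono) simp
    finally show ?thesis by (simp add: mult.commute)
  qed (simp add: \<phi>)
  then show ?thesis using B(1) by (intro that[of B]) auto
qed

text \<open>The two reflections cancel, so the pointwise constraint becomes a family of half-space
  conditions with no sign left to track, although \<open>\<phi>\<close> need not be even.\<close>

lemma minus_wulff_eq: "uminus ` wulff \<phi> = {z. \<forall>y. z \<bullet> y \<le> \<phi> y}"
proof (intro equalityI subsetI)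
  fix z assume "z \<in> {z. \<forall>y. z \<bullet> y \<le> \<phi> y}"
  then have "- z \<in> wulff \<phi>" by (simp add: wulff_def)
  then show "z \<in> uminus ` wulff \<phi>" by (intro image_eqI[of _ _ "- z"]) auto
qed (auto simp: wulff_def)

lemma C1c_zero: "C1c (\<lambda>x. 0)"
  by (rule C1cI[where D="\<lambda>x h. 0" and r=0]) auto

lemma C1c_cmult:
  fixes f :: "'a::euclidean_space \<Rightarrow> real"
  assumes f: "C1c f" shows "C1c (\<lambda>x. c * f x)" and "grad (\<lambda>x. c * f x) x = c *\<^sub>R grad f x"
proof -
  have D: "((\<lambda>x. c * f x) has_derivative (\<lambda>h. c * frechet_derivative f (at x) h)) (at x)" for x
    by (intro has_derivative_mult_right C1c_has_derivative f)
  obtain r where r: "\<And>x. norm x > r \<Longrightarrow> f x = 0" using C1c_support[OF f] by metis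
  show "C1c (\<lambda>x. c * f x)"
    by (rule C1cI[OF D, where r=r]) (auto intro!: continuous_on_mult_left C1c_continuous_derivative f simp: r)
  show "grad (\<lambda>x. c * f x) x = c *\<^sub>R grad f x"
    unfolding grad_def frechet_derivative_at[OF D, symmetric] by (simp add: scaleR_sum_right)
qed

lemma C1c_add:
  fixes f g :: "'a::euclidean_space \<Rightarrow> real"
  assumes f: "C1c f" and g: "C1c g"
  shows "C1c (\<lambda>x. f x + g x)" and "grad (\<lambda>x. f x + g x) x = grad f x + grad g x"
proof -
  have D: "((\<lambda>x. f x + g x) has_derivative
      (\<lambda>h. frechet_derivative f (at x) h + frechet_derivative g (at x) h)) (at x)" for x
    by (intro has_derivative_add C1c_has_derivative f g)
  obtain r where r: "\<And>x. norm x > r \<Longrightarrow> f x = 0" using C1c_support[OF f] by metis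
  obtain s where s: "\<And>x. norm x > s \<Longrightarrow> g x = 0" using C1c_support[OF g] by metis
  show "C1c (\<lambda>x. f x + g x)"
    by (rule C1cI[OF D, where r="max r s"])
      (auto intro!: continuous_on_add C1c_continuous_derivative f g simp: r s)
  show "grad (\<lambda>x. f x + g x) x = grad f x + grad g x"
    unfolding grad_def frechet_derivative_at[OF D, symmetric] by (simp add: scaleR_add_left sum.distrib)
qed

lemma grad_zero: "grad (\<lambda>x. 0) x = 0"
  using C1c_cmult(2)[OF C1c_zero, of 0 x] by simp

lemma integrable_lebesgueI:
  fixes f :: "'a::euclidean_space \<Rightarrow> 'b::euclidean_space"
  shows "integrable lborel f \<Longrightarrow> integrable lebesgue f"
  by (simp add: integrable_completion)

lemma C1c_integrable_lebesgue: "C1c \<psi> \<Longrightarrow> integrable lebesgue \<psi>"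
  by (intro integrable_lebesgueI C1c_integrable)

lemma C1c_integrable_grad:
  assumes "C1c \<psi>" shows "integrable lborel (grad \<psi>)"
proof -
  obtain r where "\<And>x h. norm x > r \<Longrightarrow> frechet_derivative \<psi> (at x) h = 0" using C1c_support[OF assms] by metis
  then have "grad \<psi> x = 0" if "norm x > r" for x using that by (simp add: grad_def)
  then show ?thesis by (rule integrable_continuous_compact_support[OF C1c_continuous_grad[OF assms]])
qed

lemma C1c_BV:
  fixes \<psi> :: "'a::euclidean_space \<Rightarrow> real"
  assumes "C1c \<psi>" shows "\<psi> \<in> BV"
proof -
  have "TV_K (cball 0 1) \<psi> \<le> ereal (\<integral>x. norm (grad \<psi> x) \<partial>lborel)"
  proof (rule TV_K_le_integral_grad[OF assms])
    fix z y :: 'a assume "z \<in> cball 0 1"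
    then have "norm z * norm y \<le> 1 * norm y" by (intro mult_right_mono) auto
    then show "z \<bullet> y \<le> norm y" using norm_cauchy_schwarz[of z y] by linarith
  qed (auto intro: continuous_intros)
  also have "\<dots> < \<infinity>" by simp
  finally show ?thesis using C1c_integrable_lebesgue[OF assms] by (simp add: BV_def)
qed

lemma integrable_Linf_mult:
  fixes g u :: "'a::euclidean_space \<Rightarrow> real"
  assumes "Linf g" "integrable lebesgue u" shows "integrable lebesgue (\<lambda>x. g x * u x)"
proof -
  obtain C where C: "AE x in lebesgue. norm (g x) \<le> C" and [measurable]: "g \<in> borel_measurable lebesgue"
    using assms(1) by (auto simp: Linf_def)
  show ?thesis
  proof (rule Bochner_Integration.integrable_bound)
    show "integrable lebesgue (\<lambda>x. C * u x)" using assms(2) by simp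
    show "AE x in lebesgue. norm (g x * u x) \<le> norm (C * u x)"
      using C
    proof eventually_elim
      case (elim x)
      then show ?case unfolding norm_mult by (intro mult_right_mono) auto
    qed
  qed (use assms(2) in measurable)
qed

lemma integrable_aniso:
  fixes F :: "'a::euclidean_space \<Rightarrow> 'a"
  assumes "admissible_aniso \<phi>" "integrable lebesgue F"
  shows "integrable lebesgue (\<lambda>x. \<phi> (F x))"
proof -
  note \<phi> = admissible_anisoD[OF assms(1)]
  obtain B where B: "B \<ge> 0" "\<And>y. \<phi> y \<le> B * norm y" using admissible_aniso_linear_bound[OF assms(1)] by metis
  have [measurable]: "\<phi> \<in> borel_measurable borel" using \<phi>(5) by (rule borel_measurable_continuous_onI)
  have [measurable]: "F \<in> borel_measurable lebesgue" using assms(2) by auto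
  show ?thesis
  proof (rule Bochner_Integration.integrable_bound)
    show "integrable lebesgue (\<lambda>x. B * norm (F x))" using assms(2) by simp
    show "AE x in lebesgue. norm (\<phi> (F x)) \<le> norm (B * norm (F x))" using B \<phi>(1) by (intro AE_I2) simp
  qed measurable
qed

lemma sigma_finite_lebesgue: "sigma_finite_measure (lebesgue :: 'a::euclidean_space measure)"
proof
  obtain A :: "'a set set" where "countable A" "A \<subseteq> sets lborel" "\<Union>A = space lborel"
    "\<forall>a\<in>A. emeasure lborel a \<noteq> \<infinity>"
    using lborel.sigma_finite_countable by blast
  then show "\<exists>A::'a set set. countable A \<and> A \<subseteq> sets lebesgue \<and> \<Union>A = space lebesgue \<and>
      (\<forall>a\<in>A. emeasure lebesgue a \<noteq> \<infinity>)"
    by (intro exI[of _ A]) (auto simp: subset_eq)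
qed

text \<open>Testing with indicators, weighted by a positive integrable function, gives the
  inequality almost everywhere for each single \<open>y\<close>. The null set depends on
  \<open>y\<close>; a countable dense set of directions repairs this, because by continuity of
  \<open>\<phi>\<close> a violation at one \<open>y\<close> is a violation on an open set of
  them.\<close>

lemma AE_inner_le_of_integral_le:
  fixes v :: "'a::euclidean_space \<Rightarrow> 'a" and \<phi> :: "'a \<Rightarrow> real"
  assumes \<phi>: "continuous_on UNIV \<phi>" and v: "Linf v"
    and le: "\<And>y k. integrable lebesgue k \<Longrightarrow> (\<And>x. 0 \<le> k x) \<Longrightarrow>
      (\<integral>x. k x * (v x \<bullet> y) \<partial>lebesgue) \<le> (\<integral>x. k x * \<phi> y \<partial>lebesgue)"
  shows "AE x in lebesgue. \<forall>y. v x \<bullet> y \<le> \<phi> y"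
proof -
  interpret sigma_finite_measure "lebesgue :: 'a measure" by (rule sigma_finite_lebesgue)
  have [measurable]: "v \<in> borel_measurable lebesgue" using v by (simp add: Linf_def)
  obtain C where C: "AE x in lebesgue. norm (v x) \<le> C" using v by (auto simp: Linf_def)
  have lin: "Linf (\<lambda>x. v x \<bullet> y)" for y
    unfolding Linf_def
  proof
    show "\<exists>A. AE x in lebesgue. norm (v x \<bullet> y) \<le> A"
      using C
    proof (intro exI, eventually_elim)
      case (elim x)
      have "\<bar>v x \<bullet> y\<bar> \<le> norm (v x) * norm y" by (rule Cauchy_Schwarz_ineq2)
      also have "\<dots> \<le> C * norm y" by (intro mult_right_mono elim) simp
      finally show "norm (v x \<bullet> y) \<le> C * norm y" by simp
    qed
  qed measurable
  obtain \<rho> :: "'a \<Rightarrow> real" where \<rho>: "\<And>x. 0 < \<rho> x" "integrable lebesgue \<rho>"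
    using obtain_positive_integrable_function by metis
  have AEy: "AE x in lebesgue. v x \<bullet> y \<le> \<phi> y" for y
  proof -
    have i1: "integrable lebesgue (\<lambda>x. k x * (v x \<bullet> y))" if "integrable lebesgue k" for k
      using integrable_Linf_mult[OF lin that] by (simp add: mult.commute)
    have "AE x in lebesgue. 0 \<le> \<rho> x * \<phi> y - \<rho> x * (v x \<bullet> y)"
    proof (rule density_nonneg)
      show "integrable lebesgue (\<lambda>x. \<rho> x * \<phi> y - \<rho> x * (v x \<bullet> y))" using \<rho>(2) i1 by simp
      fix A :: "'a set" assume A: "A \<in> sets lebesgue"
      let ?k = "\<lambda>x. indicat_real A x * \<rho> x"
      have k: "integrable lebesgue ?k" using integrable_mult_indicator[OF A \<rho>(2)] by simp
      have "set_lebesgue_integral lebesgue A (\<lambda>x. \<rho> x * \<phi> y - \<rho> x * (v x \<bullet> y))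
          = (\<integral>x. ?k x * \<phi> y - ?k x * (v x \<bullet> y) \<partial>lebesgue)"
        unfolding set_lebesgue_integral_def by (simp add: algebra_simps)
      also have "\<dots> = (\<integral>x. ?k x * \<phi> y \<partial>lebesgue) - (\<integral>x. ?k x * (v x \<bullet> y) \<partial>lebesgue)"
        using k i1[OF k] by (intro Bochner_Integration.integral_diff) auto
      also have "\<dots> \<ge> 0" using le[OF k, of y] \<rho>(1) by (simp add: less_imp_le)
      finally show "0 \<le> set_lebesgue_integral lebesgue A (\<lambda>x. \<rho> x * \<phi> y - \<rho> x * (v x \<bullet> y))" .
    qed
    then show ?thesis
    proof eventually_elim
      case (elim x)
      then show ?case using \<rho>(1)[of x] by simp
    qed
  qed
  obtain D :: "'a set" where D: "countable D" "\<And>X. open X \<Longrightarrow> X \<noteq> {} \<Longrightarrow> \<exists>d\<in>D. d \<in> X"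
    using countable_dense_setE by blast
  have "AE x in lebesgue. \<forall>y\<in>D. v x \<bullet> y \<le> \<phi> y"
    using AEy by (simp add: AE_ball_countable[OF D(1)])
  then show ?thesis
  proof eventually_elim
    case (elim x)
    show ?case
    proof (rule ccontr)
      assume "\<not> (\<forall>y. v x \<bullet> y \<le> \<phi> y)"
      then have "{y. \<phi> y < v x \<bullet> y} \<noteq> {}" by (auto simp: not_le)
      moreover have "open {y. \<phi> y < v x \<bullet> y}" by (intro open_Collect_less \<phi> continuous_intros)
      ultimately obtain d where "d \<in> D" "\<phi> d < v x \<bullet> d" using D(2) by blast
      then show False using elim by force
    qed
  qed
qed

lemma TV_K_nonneg:
  assumes "0 \<in> K" shows "0 \<le> TV_K K u"
proof -
  have "divergence (\<lambda>x::'a. 0) x = 0" for x by (simp add: divergence_def)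
  then have "ereal (- (\<integral>x. u x * divergence (\<lambda>x. 0) x \<partial>lebesgue)) = 0" by simp
  moreover have "ereal (- (\<integral>x. u x * divergence (\<lambda>x. 0) x \<partial>lebesgue)) \<le> TV_K K u"
    unfolding TV_K_def using assms by (intro SUP_upper) (auto intro: C1c_zero)
  ultimately show ?thesis by (simp only:)
qed

lemma integrable_Pair:
  fixes a :: "'a \<Rightarrow> 'b::euclidean_space" and b :: "'a \<Rightarrow> 'c::euclidean_space"
  assumes "integrable M a" "integrable M b" shows "integrable M (\<lambda>x. (a x, b x))"
proof -
  have "integrable M (\<lambda>x. (a x, 0) + (0, b x))"
    by (intro Bochner_Integration.integrable_add integrable_bounded_linear[OF _ assms(1)]
        integrable_bounded_linear[OF _ assms(2)] bounded_linear_Pair bounded_linear_zero bounded_linear_ident)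
  then show ?thesis by simp
qed

text \<open>The convex functional \<open>(w, k) \<mapsto> \<integral> \<phi>(w) + lam \<integral> |k|\<close> on \<open>L\<^sup>1\<close> is separated from the cone of
  all \<open>((\<nabla>\<psi>, \<psi> - t f), t m)\<close>; the separating functional is given by a pair \<open>(v, g)\<close>.\<close>
lemma dual_field_exists:
  fixes \<phi> :: "'a::euclidean_space \<Rightarrow> real" and f :: "'a \<Rightarrow> real"
  assumes adm: "admissible_aniso \<phi>" and lam: "lam > 0" and f: "integrable lebesgue f" and m: "m \<ge> 0"
    and le: "\<forall>\<psi>. C1c \<psi> \<longrightarrow>
      m \<le> (\<integral>x. \<phi> (grad \<psi> x) \<partial>lebesgue) + lam * (\<integral>x. \<bar>\<psi> x - f x\<bar> \<partial>lebesgue)"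
  shows "\<exists>v g. Linf v \<and> (AE x in lebesgue. v x \<in> {z. \<forall>y. z \<bullet> y \<le> \<phi> y}) \<and> weak_divergence v g \<and>
    Linf g \<and> (AE x in lebesgue. \<bar>g x\<bar> \<le> lam) \<and> m \<le> - (\<integral>x. g x * f x \<partial>lebesgue)"
proof -
  note \<phi> = admissible_anisoD[OF adm]
  obtain B where B: "B \<ge> 0" "\<And>y. \<phi> y \<le> B * norm y" using admissible_aniso_linear_bound[OF adm] by metis
  interpret sigma_finite_measure "lebesgue :: 'a measure" by (rule sigma_finite_lebesgue)
  define X where "X = {F :: 'a \<Rightarrow> 'a \<times> real. integrable lebesgue F}"
  define p where "p F = (\<integral>x. \<phi> (fst (F x)) \<partial>lebesgue) + lam * (\<integral>x. \<bar>snd (F x)\<bar> \<partial>lebesgue)"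
    for F :: "'a \<Rightarrow> 'a \<times> real"
  define S where "S = {((\<lambda>x. (grad \<psi> x, \<psi> x - t * f x)), t * m) | \<psi> t. C1c \<psi> \<and> t \<ge> 0}"
  have gi: "integrable lebesgue (grad \<psi>)" if "C1c \<psi>" for \<psi> :: "'a \<Rightarrow> real"
    by (intro integrable_lebesgueI C1c_integrable_grad that)
  have S_I: "((\<lambda>x. (grad \<psi> x, \<psi> x - t * f x)), t * m) \<in> S" if "C1c \<psi>" "t \<ge> 0" for \<psi> t
    using that unfolding S_def by blast
  have S_E: "\<exists>\<psi> t. C1c \<psi> \<and> t \<ge> 0 \<and> a = ((\<lambda>x. (grad \<psi> x, \<psi> x - t * f x)), t * m)" if "a \<in> S" for a
    using that unfolding S_def by blast
  have Xsub: "subspace X"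
    unfolding X_def by (rule subspaceI) (auto simp: zero_fun_def plus_fun_def scaleR_fun_def)
  have \<phi>i: "integrable lebesgue (\<lambda>x. \<phi> (fst (F x)))" if "F \<in> X" for F
    using that by (intro integrable_aniso[OF adm]) (auto simp: X_def)
  have si: "integrable lebesgue (\<lambda>x. \<bar>snd (F x)\<bar>)" if "F \<in> X" for F
    using that by (auto simp: X_def)
  have p_sub: "sublinear_on X p"
    unfolding sublinear_on_def
  proof (intro conjI ballI allI impI)
    fix F G assume FG: "F \<in> X" "G \<in> X"
    have "(\<integral>x. \<phi> (fst ((F + G) x)) \<partial>lebesgue) \<le> (\<integral>x. \<phi> (fst (F x)) + \<phi> (fst (G x)) \<partial>lebesgue)"
      using \<phi>i[OF subspace_add[OF Xsub FG]] \<phi>i FG \<phi>(4)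
      by (intro integral_mono) (auto simp: plus_fun_def)
    moreover have "(\<integral>x. \<bar>snd ((F + G) x)\<bar> \<partial>lebesgue) \<le> (\<integral>x. \<bar>snd (F x)\<bar> + \<bar>snd (G x)\<bar> \<partial>lebesgue)"
      using si[OF subspace_add[OF Xsub FG]] si FG
      by (intro integral_mono) (auto simp: plus_fun_def)
    then have "lam * (\<integral>x. \<bar>snd ((F + G) x)\<bar> \<partial>lebesgue) \<le> lam * (\<integral>x. \<bar>snd (F x)\<bar> + \<bar>snd (G x)\<bar> \<partial>lebesgue)"
      using lam by (intro mult_left_mono) auto
    ultimately show "p (F + G) \<le> p F + p G"
      using \<phi>i si FG by (simp add: p_def algebra_simps)
  next
    fix F and c :: real assume "F \<in> X" "c > 0"
    then show "p (c *\<^sub>R F) \<le> c * p F"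
      by (simp add: p_def scaleR_fun_def \<phi>(3) abs_mult algebra_simps)
  qed
  have S_add: "a + b \<in> S" if ab: "a \<in> S" "b \<in> S" for a b
  proof -
    obtain \<psi> s \<theta> t where *: "C1c \<psi>" "s \<ge> 0" "a = ((\<lambda>x. (grad \<psi> x, \<psi> x - s * f x)), s * m)"
      "C1c \<theta>" "t \<ge> 0" "b = ((\<lambda>x. (grad \<theta> x, \<theta> x - t * f x)), t * m)"
      using ab unfolding S_def by blast
    have "a + b = ((\<lambda>x. (grad (\<lambda>x. \<psi> x + \<theta> x) x, (\<psi> x + \<theta> x) - (s + t) * f x)), (s + t) * m)"
      using * by (auto simp: plus_fun_def C1c_add(2) algebra_simps)
    also have "\<dots> \<in> S" using * by (intro S_I C1c_add(1)) auto
    finally show ?thesis .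
  qed
  have S_scale: "c *\<^sub>R a \<in> S" if a: "a \<in> S" "c > 0" for a and c :: real
  proof -
    obtain \<psi> s where *: "C1c \<psi>" "s \<ge> 0" "a = ((\<lambda>x. (grad \<psi> x, \<psi> x - s * f x)), s * m)"
      using a unfolding S_def by blast
    have "c *\<^sub>R a = ((\<lambda>x. (grad (\<lambda>x. c * \<psi> x) x, c * \<psi> x - (c * s) * f x)), (c * s) * m)"
      using * by (auto simp: scaleR_fun_def C1c_cmult(2) algebra_simps)
    also have "\<dots> \<in> S" using * a(2) by (intro S_I C1c_cmult(1)) auto
    finally show ?thesis .
  qed
  have S_zero: "0 \<in> S"
    using S_I[OF C1c_zero, of 0] by (simp add: grad_zero zero_prod_def zero_fun_def)
  have SX: "F \<in> X" if "(F, c) \<in> S" for F c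
  proof -
    from S_E[OF that] obtain \<psi> t
      where *: "C1c \<psi> \<and> t \<ge> 0 \<and> (F, c) = ((\<lambda>x. (grad \<psi> x, \<psi> x - t * f x)), t * m)"
      by (elim exE)
    have "integrable lebesgue (\<lambda>x. (grad \<psi> x, \<psi> x - t * f x))"
      using * f gi[of \<psi>] C1c_integrable_lebesgue[of \<psi>] by (intro integrable_Pair) auto
    then show ?thesis using * by (simp add: X_def)
  qed
  have Sle: "c \<le> p F" if "(F, c) \<in> S" for F c
  proof -
    from S_E[OF that] obtain \<psi> t
      where **: "C1c \<psi> \<and> t \<ge> 0 \<and> (F, c) = ((\<lambda>x. (grad \<psi> x, \<psi> x - t * f x)), t * m)"
      by (elim exE)
    then have *: "C1c \<psi>" "t \<ge> 0" "F = (\<lambda>x. (grad \<psi> x, \<psi> x - t * f x))" "c = t * m" by auto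
    show ?thesis
    proof (cases "t = 0")
      case True
      have "0 \<le> p F" using \<phi>(1) lam unfolding p_def by (intro add_nonneg_nonneg mult_nonneg_nonneg integral_nonneg) auto
      then show ?thesis using * True by simp
    next
      case False
      then have t: "t > 0" using * by simp
      \<comment> \<open>Rescaling reduces \<open>t > 0\<close> to the case \<open>t = 1\<close>;
        positive homogeneity of \<open>\<phi>\<close> returns the factor \<open>t\<close>.\<close>
      let ?\<psi> = "\<lambda>x. (1 / t) * \<psi> x"
      have F: "F = (\<lambda>x. (t *\<^sub>R grad ?\<psi> x, t * (?\<psi> x - f x)))"
        unfolding C1c_cmult(2)[OF *(1)] using *(3) t by (simp add: right_diff_distrib)
      have "t * m \<le> t * ((\<integral>x. \<phi> (grad ?\<psi> x) \<partial>lebesgue) + lam * (\<integral>x. \<bar>?\<psi> x - f x\<bar> \<partial>lebesgue))"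
        by (rule mult_left_mono[OF le[rule_format, OF C1c_cmult(1)[OF *(1)]]]) (use t in simp)
      also have "\<dots> = p F"
        using t \<phi>(3)[of t] unfolding p_def F fst_conv snd_conv by (simp only: abs_mult) (simp add: distrib_left)
      finally show ?thesis using * by simp
    qed
  qed
  have "\<exists>l. (\<forall>F\<in>X. \<forall>G\<in>X. l (F + G) = l F + l G) \<and> (\<forall>F\<in>X. \<forall>c. l (c *\<^sub>R F) = c * l F) \<and>
      (\<forall>F\<in>X. l F \<le> p F) \<and> (\<forall>(F, c)\<in>S. c \<le> l F)"
    by (rule mazur_orlicz[OF p_sub Xsub S_zero]) (fact S_add S_scale SX Sle)+
  then obtain l where l: "\<forall>F\<in>X. \<forall>G\<in>X. l (F + G) = l F + l G" "\<forall>F\<in>X. \<forall>c. l (c *\<^sub>R F) = c * l F"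
    "\<forall>F\<in>X. l F \<le> p F" "\<forall>(F, c)\<in>S. c \<le> l F"
    by blast
  have ladd: "l (\<lambda>x. F x + G x) = l F + l G" if "integrable lebesgue F" "integrable lebesgue G" for F G
    using l(1) that by (simp add: X_def plus_fun_def)
  have lscale: "l (\<lambda>x. c *\<^sub>R F x) = c * l F" if "integrable lebesgue F" for c F
    using l(2) that by (simp add: X_def scaleR_fun_def)
  have lle: "l F \<le> p F" if "integrable lebesgue F" for F using l(3) that by (simp add: X_def)
  have lzero: "l (\<lambda>x. 0) = 0" using lscale[of "\<lambda>x. 0" 0] by simp
  \<comment> \<open>In a fixed direction \<open>i\<close>, domination by \<open>p\<close> is an L1
    bound with constant \<open>B * norm i\<close>, so the scalar duality applies to each
    coordinate.\<close>
  have "\<exists>h. h \<in> borel_measurable lebesgue \<and> (AE x in lebesgue. \<bar>h x\<bar> \<le> B * norm i) \<and>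
      (\<forall>k. integrable lebesgue k \<longrightarrow> l (\<lambda>x. (k x *\<^sub>R i, 0)) = (\<integral>x. h x * k x \<partial>lebesgue))" for i :: 'a
  proof -
    have int: "integrable lebesgue (\<lambda>x. (k x *\<^sub>R i, 0::real))" if "integrable lebesgue k" for k :: "'a \<Rightarrow> real"
      using that by (intro integrable_Pair) auto
    obtain h where "h \<in> borel_measurable lebesgue" "AE x in lebesgue. \<bar>h x\<bar> \<le> B * norm i"
      "\<And>k. integrable lebesgue k \<Longrightarrow> l (\<lambda>x. (k x *\<^sub>R i, 0)) = (\<integral>x. h x * k x \<partial>lebesgue)"
    proof (rule L1_dual_representation[of "\<lambda>k. l (\<lambda>x. (k x *\<^sub>R i, 0))" "B * norm i"])
      fix k k' :: "'a \<Rightarrow> real" and c :: real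
      assume k: "integrable lebesgue k"
      show "l (\<lambda>x. ((c * k x) *\<^sub>R i, 0)) = c * l (\<lambda>x. (k x *\<^sub>R i, 0))"
        using lscale[OF int[OF k], of c] by simp
      show "l (\<lambda>x. (k x *\<^sub>R i, 0)) \<le> B * norm i * (\<integral>x. \<bar>k x\<bar> \<partial>lebesgue)"
      proof -
        have "(\<integral>x. \<phi> (k x *\<^sub>R i) \<partial>lebesgue) \<le> (\<integral>x. B * norm i * \<bar>k x\<bar> \<partial>lebesgue)"
        proof (rule integral_mono)
          show "integrable lebesgue (\<lambda>x. \<phi> (k x *\<^sub>R i))" using k by (intro integrable_aniso[OF adm]) simp
          show "\<phi> (k x *\<^sub>R i) \<le> B * norm i * \<bar>k x\<bar>" for x
            using B(2)[of "k x *\<^sub>R i"] by (simp add: mult_ac)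
        qed (use k in simp)
        then show ?thesis using lle[OF int[OF k]] by (simp add: p_def)
      qed
      assume k': "integrable lebesgue k'"
      show "l (\<lambda>x. ((k x + k' x) *\<^sub>R i, 0)) = l (\<lambda>x. (k x *\<^sub>R i, 0)) + l (\<lambda>x. (k' x *\<^sub>R i, 0))"
        using ladd[OF int[OF k] int[OF k']] by (simp add: scaleR_add_left)
    qed (use B(1) in auto)
    then show ?thesis by blast
  qed
  then have "\<forall>i. \<exists>h. h \<in> borel_measurable lebesgue \<and> (AE x in lebesgue. \<bar>h x\<bar> \<le> B * norm i) \<and>
      (\<forall>k. integrable lebesgue k \<longrightarrow> l (\<lambda>x. (k x *\<^sub>R i, 0)) = (\<integral>x. h x * k x \<partial>lebesgue))"
    by blast
  from choice[OF this] obtain h where h: "\<And>i. h i \<in> borel_measurable lebesgue"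
    "\<And>i. AE x in lebesgue. \<bar>h i x\<bar> \<le> B * norm (i::'a)"
    "\<And>i k. integrable lebesgue k \<Longrightarrow> l (\<lambda>x. (k x *\<^sub>R i, 0)) = (\<integral>x. h i x * k x \<partial>lebesgue)"
    by blast
  have int0: "integrable lebesgue (\<lambda>x. (0::'a, k x))" if "integrable lebesgue k" for k :: "'a \<Rightarrow> real"
    using that by (intro integrable_Pair) auto
  obtain g where g: "g \<in> borel_measurable lebesgue" "AE x in lebesgue. \<bar>g x\<bar> \<le> lam"
    "\<And>k. integrable lebesgue k \<Longrightarrow> l (\<lambda>x. (0, k x)) = (\<integral>x. g x * k x \<partial>lebesgue)"
  proof (rule L1_dual_representation[of "\<lambda>k. l (\<lambda>x. (0, k x))" lam])
    fix k k' :: "'a \<Rightarrow> real" and c :: real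
    assume k: "integrable lebesgue k"
    show "l (\<lambda>x. (0, c * k x)) = c * l (\<lambda>x. (0, k x))" using lscale[OF int0[OF k], of c] by simp
    show "l (\<lambda>x. (0, k x)) \<le> lam * (\<integral>x. \<bar>k x\<bar> \<partial>lebesgue)"
      using lle[OF int0[OF k]] by (simp add: p_def \<phi>(2))
    assume k': "integrable lebesgue k'"
    show "l (\<lambda>x. (0, k x + k' x)) = l (\<lambda>x. (0, k x)) + l (\<lambda>x. (0, k' x))"
      using ladd[OF int0[OF k] int0[OF k']] by simp
  qed (use lam in auto)
  define v where "v x = (\<Sum>i\<in>Basis. h i x *\<^sub>R i)" for x
  have Linf_h: "Linf (h i)" for i
    unfolding Linf_def using h(1,2)[of i] by (auto intro!: exI[of _ "B * norm i"])
  have lv: "l (\<lambda>x. (w x, 0)) = (\<integral>x. v x \<bullet> w x \<partial>lebesgue)" if w: "integrable lebesgue w" for w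
  proof -
    \<comment> \<open>\<open>l\<close> is additive for two summands at a time, so the decomposition
      of \<open>w\<close> along \<open>Basis\<close> is handled by induction.\<close>
    have *: "l (\<lambda>x. (\<Sum>i\<in>A. (w x \<bullet> i) *\<^sub>R i, 0)) = (\<Sum>i\<in>A. \<integral>x. h i x * (w x \<bullet> i) \<partial>lebesgue)"
      if "finite A" for A
      using that
    proof (induction A rule: finite_induct)
      case empty
      then show ?case using lzero by (simp add: zero_prod_def)
    next
      case (insert i A)
      have i: "integrable lebesgue (\<lambda>x. ((w x \<bullet> i) *\<^sub>R i, 0::real))"
        using w by (intro integrable_Pair) auto
      have A: "integrable lebesgue (\<lambda>x. (\<Sum>i\<in>A. (w x \<bullet> i) *\<^sub>R i, 0::real))"
        using w by (intro integrable_Pair) auto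
      have "l (\<lambda>x. ((w x \<bullet> i) *\<^sub>R i, 0)) = (\<integral>x. h i x * (w x \<bullet> i) \<partial>lebesgue)"
        using w by (intro h(3)) auto
      then show ?case using ladd[OF i A] insert by simp
    qed
    have "l (\<lambda>x. (w x, 0)) = (\<Sum>i\<in>Basis. \<integral>x. h i x * (w x \<bullet> i) \<partial>lebesgue)"
      using *[OF finite_Basis] by (simp add: euclidean_representation)
    also have "\<dots> = (\<integral>x. (\<Sum>i\<in>Basis. h i x * (w x \<bullet> i)) \<partial>lebesgue)"
      using w by (intro Bochner_Integration.integral_sum[symmetric] integrable_Linf_mult Linf_h) auto
    also have "\<dots> = (\<integral>x. v x \<bullet> w x \<partial>lebesgue)"
      by (simp add: v_def inner_sum_left inner_commute[of "w _"])
    finally show ?thesis .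
  qed
  have Linf_v: "Linf v"
    unfolding Linf_def
  proof
    show "v \<in> borel_measurable lebesgue" unfolding v_def using h(1) by simp
    have "AE x in lebesgue. \<forall>i\<in>Basis. \<bar>h i x\<bar> \<le> B * norm i"
      by (intro AE_finite_allI finite_Basis h(2))
    then have "AE x in lebesgue. norm (v x) \<le> (\<Sum>i\<in>(Basis::'a set). B)"
    proof eventually_elim
      case (elim x)
      then show ?case unfolding v_def by (intro sum_norm_le) auto
    qed
    then show "\<exists>C. AE x in lebesgue. norm (v x) \<le> C" by blast
  qed
  have Linf_g: "Linf g" unfolding Linf_def using g(1,2) by auto
  show ?thesis
  proof (intro exI[of _ v] exI[of _ g] conjI Linf_v Linf_g g(2))
    have "AE x in lebesgue. \<forall>y. v x \<bullet> y \<le> \<phi> y"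
    proof (rule AE_inner_le_of_integral_le[OF \<phi>(5) Linf_v])
      fix y :: 'a and k :: "'a \<Rightarrow> real" assume k: "integrable lebesgue k" "\<And>x. 0 \<le> k x"
      have i: "integrable lebesgue (\<lambda>x. k x *\<^sub>R y)" using k(1) by simp
      have "(\<integral>x. k x * (v x \<bullet> y) \<partial>lebesgue) = l (\<lambda>x. (k x *\<^sub>R y, 0))" using lv[OF i] by simp
      also have "\<dots> \<le> p (\<lambda>x. (k x *\<^sub>R y, 0))" by (intro lle integrable_Pair i) simp
      \<comment> \<open>Homogeneity takes \<open>k x\<close> out of \<open>\<phi>\<close>; the sign
        of \<open>k\<close> matters because \<open>\<phi>\<close> need not be even.\<close>
      also have "\<dots> = (\<integral>x. k x * \<phi> y \<partial>lebesgue)" using k(2) by (simp add: p_def \<phi>(3))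
      finally show "(\<integral>x. k x * (v x \<bullet> y) \<partial>lebesgue) \<le> (\<integral>x. k x * \<phi> y \<partial>lebesgue)" .
    qed
    then show "AE x in lebesgue. v x \<in> {z. \<forall>y. z \<bullet> y \<le> \<phi> y}" by simp
    show "weak_divergence v g"
      unfolding weak_divergence_def
    proof (intro allI impI)
      fix \<psi> :: "'a \<Rightarrow> real" assume \<psi>: "C1c \<psi>"
      have pair: "l (\<lambda>x. (grad \<theta> x, \<theta> x)) = (\<integral>x. v x \<bullet> grad \<theta> x \<partial>lebesgue) + (\<integral>x. g x * \<theta> x \<partial>lebesgue)"
        if \<theta>: "C1c \<theta>" for \<theta>
      proof -
        have "l (\<lambda>x. (grad \<theta> x, 0) + (0, \<theta> x)) = l (\<lambda>x. (grad \<theta> x, 0)) + l (\<lambda>x. (0, \<theta> x))"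
          by (intro ladd integrable_Pair gi \<theta> C1c_integrable_lebesgue[OF \<theta>]) auto
        then show ?thesis using lv[OF gi[OF \<theta>]] g(3)[OF C1c_integrable_lebesgue[OF \<theta>]] by simp
      qed
      \<comment> \<open>Elements of \<open>S\<close> with \<open>t = 0\<close> prescribe the lower
        bound 0; used for \<open>\<psi>\<close> and \<open>- \<psi>\<close>, this forces the value 0
        and hence the divergence equation.\<close>
      have nonneg: "0 \<le> l (\<lambda>x. (grad \<theta> x, \<theta> x))" if \<theta>: "C1c \<theta>" for \<theta>
        using l(4) S_I[OF \<theta>, of 0] by fastforce
      have neg: "l (\<lambda>x. (grad (\<lambda>x. -1 * \<psi> x) x, -1 * \<psi> x)) = - l (\<lambda>x. (grad \<psi> x, \<psi> x))"
        using lscale[OF integrable_Pair[OF gi[OF \<psi>] C1c_integrable_lebesgue[OF \<psi>]], of "-1"]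
        unfolding C1c_cmult(2)[OF \<psi>] by simp
      have "l (\<lambda>x. (grad \<psi> x, \<psi> x)) = 0"
        using nonneg[OF \<psi>] nonneg[OF C1c_cmult(1)[OF \<psi>, of "-1"]] unfolding neg by simp
      then show "(\<integral>x. v x \<bullet> grad \<psi> x \<partial>lebesgue) = - (\<integral>x. g x * \<psi> x \<partial>lebesgue)"
        using pair[OF \<psi>] by simp
    qed
    \<comment> \<open>The element of \<open>S\<close> with \<open>\<psi> = 0\<close> and
      \<open>t = 1\<close>.\<close>
    have "m \<le> l (\<lambda>x. (0, -1 * f x))"
      using l(4) S_I[OF C1c_zero, of 1] by (fastforce simp: grad_zero)
    also have "\<dots> = - (\<integral>x. g x * f x \<partial>lebesgue)" using g(3)[of "\<lambda>x. -1 * f x"] f by simp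
    finally show "m \<le> - (\<integral>x. g x * f x \<partial>lebesgue)" .
  qed
qed

section \<open>The two directions of the characterization\<close>

lemma energy_C1c_le:
  assumes adm: "admissible_aniso \<phi>" and \<psi>: "C1c \<psi>"
  shows "energy \<phi> \<psi> f lam \<le>
    ereal ((\<integral>x. \<phi> (grad \<psi> x) \<partial>lebesgue) + lam * (\<integral>x. \<bar>\<psi> x - f x\<bar> \<partial>lebesgue))"
proof -
  note \<phi> = admissible_anisoD[OF adm]
  have "TV_aniso \<phi> \<psi> \<le> ereal (\<integral>x. \<phi> (grad \<psi> x) \<partial>lborel)"
    unfolding TV_aniso_def minus_wulff_eq by (rule TV_K_le_integral_grad[OF \<psi> \<phi>(5,2)]) auto
  also have "(\<integral>x. \<phi> (grad \<psi> x) \<partial>lborel) = (\<integral>x. \<phi> (grad \<psi> x) \<partial>lebesgue)"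
  proof (rule integral_completion[symmetric])
    have "continuous_on UNIV (\<lambda>x. \<phi> (grad \<psi> x))"
      by (rule continuous_on_compose2[OF \<phi>(5) C1c_continuous_grad[OF \<psi>]]) simp
    then show "(\<lambda>x. \<phi> (grad \<psi> x)) \<in> borel_measurable lborel"
      by (simp add: borel_measurable_continuous_onI)
  qed
  finally have "TV_aniso \<phi> \<psi> + ereal (lam * (\<integral>x. \<bar>\<psi> x - f x\<bar> \<partial>lebesgue))
    \<le> ereal (\<integral>x. \<phi> (grad \<psi> x) \<partial>lebesgue) + ereal (lam * (\<integral>x. \<bar>\<psi> x - f x\<bar> \<partial>lebesgue))"
    by (rule add_right_mono)
  then show ?thesis by (simp add: energy_def)
qed

lemma integral_mult_le:
  fixes g u :: "'a::euclidean_space \<Rightarrow> real"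
  assumes g: "Linf g" "AE x in lebesgue. \<bar>g x\<bar> \<le> lam" and u: "integrable lebesgue u"
  shows "(\<integral>x. g x * u x \<partial>lebesgue) \<le> lam * (\<integral>x. \<bar>u x\<bar> \<partial>lebesgue)"
proof -
  have "(\<integral>x. g x * u x \<partial>lebesgue) \<le> (\<integral>x. lam * \<bar>u x\<bar> \<partial>lebesgue)"
  proof (rule integral_mono_AE)
    show "AE x in lebesgue. g x * u x \<le> lam * \<bar>u x\<bar>"
      using g(2)
    proof eventually_elim
      case (elim x)
      have "g x * u x \<le> \<bar>g x\<bar> * \<bar>u x\<bar>" using abs_ge_self[of "g x * u x"] by (simp add: abs_mult)
      also have "\<dots> \<le> lam * \<bar>u x\<bar>" by (intro mult_right_mono elim) simp
      finally show ?case .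
    qed
  qed (use u integrable_Linf_mult[OF g(1) u] in auto)
  then show ?thesis by simp
qed

lemma minimizer_imp_calibrated:
  fixes \<phi> :: "'a::euclidean_space \<Rightarrow> real" and f u0 :: "'a \<Rightarrow> real"
  assumes adm: "admissible_aniso \<phi>" and f: "integrable lebesgue f" and lam: "lam > 0"
    and min: "is_minimizer \<phi> u0 f lam"
  shows "\<exists>v\<in>calV \<phi> u0. \<exists>g. weak_divergence v g \<and> Linf g \<and>
            (AE x in lebesgue. \<bar>g x\<bar> \<le> lam) \<and>
            (AE x in lebesgue. u0 x > f x \<longrightarrow> g x = lam) \<and>
            (AE x in lebesgue. u0 x < f x \<longrightarrow> g x = - lam)"
proof -
  note \<phi> = admissible_anisoD[OF adm]
  let ?K = "{z. \<forall>y. z \<bullet> y \<le> \<phi> y}"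
  define I where "I = lam * (\<integral>x. \<bar>u0 x - f x\<bar> \<partial>lebesgue)"
  have u0: "integrable lebesgue u0" using min by (simp add: is_minimizer_def BV_def)
  have E: "energy \<phi> u0 f lam = TV_aniso \<phi> u0 + ereal I" by (simp add: energy_def I_def)
  have Ele: "energy \<phi> u0 f lam \<le>
      ereal ((\<integral>x. \<phi> (grad \<psi> x) \<partial>lebesgue) + lam * (\<integral>x. \<bar>\<psi> x - f x\<bar> \<partial>lebesgue))" if "C1c \<psi>" for \<psi>
    using min C1c_BV[OF that] energy_C1c_le[OF adm that, of f lam] unfolding is_minimizer_def
    by (meson order_trans)
  have "0 \<le> TV_aniso \<phi> u0" unfolding TV_aniso_def minus_wulff_eq by (rule TV_K_nonneg) (simp add: \<phi>)
  \<comment> \<open>\<open>BV\<close> is defined through the Euclidean unit ball; finiteness of the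
    anisotropic variation is read off from minimality against the zero function.\<close>
  moreover have "TV_aniso \<phi> u0 \<noteq> \<infinity>" using Ele[OF C1c_zero] unfolding E by auto
  ultimately obtain T where T: "TV_aniso \<phi> u0 = ereal T" "T \<ge> 0" by (cases "TV_aniso \<phi> u0") auto
  have I: "I \<ge> 0" unfolding I_def using lam by simp
  have "\<forall>\<psi>. C1c \<psi> \<longrightarrow>
      T + I \<le> (\<integral>x. \<phi> (grad \<psi> x) \<partial>lebesgue) + lam * (\<integral>x. \<bar>\<psi> x - f x\<bar> \<partial>lebesgue)"
    using Ele unfolding E T by simp
  from dual_field_exists[OF adm lam f add_nonneg_nonneg[OF T(2) I] this] obtain v g where v: "Linf v" "AE x in lebesgue. v x \<in> ?K" and g: "weak_divergence v g" "Linf g"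
    "AE x in lebesgue. \<bar>g x\<bar> \<le> lam" and le: "T + I \<le> - (\<integral>x. g x * f x \<partial>lebesgue)"
    by blast
  have d: "integrable lebesgue (\<lambda>x. u0 x - f x)" using u0 f by simp
  have gd: "(\<integral>x. g x * (u0 x - f x) \<partial>lebesgue) = (\<integral>x. u0 x * g x \<partial>lebesgue) - (\<integral>x. g x * f x \<partial>lebesgue)"
    using integrable_Linf_mult[OF g(2) u0] integrable_Linf_mult[OF g(2) f] by (simp add: algebra_simps)
  have "ereal (- (\<integral>x. u0 x * g x \<partial>lebesgue)) \<le> TV_aniso \<phi> u0"
    unfolding TV_aniso_def minus_wulff_eq by (rule TV_K_ge[OF \<phi>(1) v g(1,2) u0])
  then have T_ge: "- (\<integral>x. u0 x * g x \<partial>lebesgue) \<le> T" unfolding T by simp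
  have I_ge: "(\<integral>x. g x * (u0 x - f x) \<partial>lebesgue) \<le> I"
    unfolding I_def by (rule integral_mult_le[OF g(2,3) d])
  \<comment> \<open>\<open>le\<close> and \<open>gd\<close> bound \<open>T + I\<close> by the sum of
    the two right-hand sides, while \<open>T_ge\<close> and \<open>I_ge\<close> bound these
    separately in the opposite direction.\<close>
  have T_eq: "T = - (\<integral>x. u0 x * g x \<partial>lebesgue)" and I_eq: "I = (\<integral>x. g x * (u0 x - f x) \<partial>lebesgue)"
    using T_ge I_ge le gd by linarith+
  have "v \<in> calV \<phi> u0"
    unfolding calV_def minus_wulff_eq using v g T T_eq by auto
  \<comment> \<open>The difference of the two sides is nonnegative almost everywhere and has
    integral 0. Where \<open>u0\<close> and \<open>f\<close> differ, dividing by
    \<open>u0 x - f x\<close> then yields the two sign conditions on \<open>g\<close>.\<close>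
  moreover have eq: "AE x in lebesgue. lam * \<bar>u0 x - f x\<bar> = g x * (u0 x - f x)"
  proof -
    let ?e = "\<lambda>x. lam * \<bar>u0 x - f x\<bar> - g x * (u0 x - f x)"
    have int: "integrable lebesgue ?e"
      using d integrable_Linf_mult[OF g(2) d] by simp
    have nonneg: "AE x in lebesgue. 0 \<le> ?e x"
      using g(3)
    proof eventually_elim
      case (elim x)
      have "g x * (u0 x - f x) \<le> \<bar>g x\<bar> * \<bar>u0 x - f x\<bar>"
        using abs_ge_self[of "g x * (u0 x - f x)"] by (simp add: abs_mult)
      also have "\<dots> \<le> lam * \<bar>u0 x - f x\<bar>" by (intro mult_right_mono elim) simp
      finally show ?case by simp
    qed
    have "(\<integral>x. ?e x \<partial>lebesgue) = (\<integral>x. lam * \<bar>u0 x - f x\<bar> \<partial>lebesgue) - (\<integral>x. g x * (u0 x - f x) \<partial>lebesgue)"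
      using d integrable_Linf_mult[OF g(2) d] by (intro Bochner_Integration.integral_diff) auto
    also have "\<dots> = 0" using I_eq by (simp add: I_def)
    finally have "(\<integral>x. ?e x \<partial>lebesgue) = 0" .
    then have "AE x in lebesgue. ?e x = 0" using integral_nonneg_eq_0_iff_AE[OF int nonneg] by blast
    then show ?thesis by eventually_elim simp
  qed
  moreover have "AE x in lebesgue. u0 x > f x \<longrightarrow> g x = lam"
    using eq
  proof eventually_elim
    case (elim x)
    show ?case
    proof
      assume gt: "u0 x > f x"
      with elim have "lam * (u0 x - f x) = g x * (u0 x - f x)" by simp
      then show "g x = lam" using gt by simp
    qed
  qed
  moreover have "AE x in lebesgue. u0 x < f x \<longrightarrow> g x = - lam"
    using eq
  proof eventually_elim
    case (elim x)
    show ?case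
    proof
      assume lt: "u0 x < f x"
      with elim have "(- lam) * (u0 x - f x) = g x * (u0 x - f x)" by (simp add: algebra_simps)
      moreover have "u0 x - f x \<noteq> 0" using lt by simp
      ultimately show "g x = - lam" by (metis mult_right_cancel)
    qed
  qed
  ultimately show ?thesis using g by blast
qed

lemma calibrated_imp_minimizer:
  fixes \<phi> :: "'a::euclidean_space \<Rightarrow> real" and f u0 :: "'a \<Rightarrow> real"
  assumes adm: "admissible_aniso \<phi>" and f: "integrable lebesgue f" and u0: "u0 \<in> BV"
    and v: "v \<in> calV \<phi> u0" and g: "weak_divergence v g" "Linf g" "AE x in lebesgue. \<bar>g x\<bar> \<le> lam"
      "AE x in lebesgue. u0 x > f x \<longrightarrow> g x = lam" "AE x in lebesgue. u0 x < f x \<longrightarrow> g x = - lam"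
  shows "is_minimizer \<phi> u0 f lam"
  unfolding is_minimizer_def
proof (intro conjI ballI u0)
  note \<phi> = admissible_anisoD[OF adm]
  have u0i: "integrable lebesgue u0" using u0 by (simp add: BV_def)
  obtain h where h: "Linf v" "AE x in lebesgue. v x \<in> {z. \<forall>y. z \<bullet> y \<le> \<phi> y}" "weak_divergence v h" "Linf h"
    "TV_aniso \<phi> u0 = ereal (- (\<integral>x. u0 x * h x \<partial>lebesgue))"
    using v unfolding calV_def minus_wulff_eq by auto
  \<comment> \<open>\<open>calV\<close> only asserts that some weak divergence \<open>h\<close>
    realises the variation; uniqueness against \<open>u0\<close> passes this on to the given
    \<open>g\<close>.\<close>
  have TV: "TV_aniso \<phi> u0 = ereal (- (\<integral>x. u0 x * g x \<partial>lebesgue))"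
    using weak_divergence_integral_unique[OF h(1) g(1,2) h(3,4) u0i] h(5) by simp
  have split: "(\<integral>x. g x * (u x - f x) \<partial>lebesgue) = (\<integral>x. u x * g x \<partial>lebesgue) - (\<integral>x. g x * f x \<partial>lebesgue)"
    if "integrable lebesgue u" for u
    using integrable_Linf_mult[OF g(2) that] integrable_Linf_mult[OF g(2) f] by (simp add: algebra_simps)
  fix u :: "'a \<Rightarrow> real" assume "u \<in> BV"
  then have u: "integrable lebesgue u" by (simp add: BV_def)
  have [measurable]: "g \<in> borel_measurable lebesgue" "f \<in> borel_measurable lebesgue" "u0 \<in> borel_measurable lebesgue"
    using g(2) f u0i by (auto simp: Linf_def)
  have "lam * (\<integral>x. \<bar>u0 x - f x\<bar> \<partial>lebesgue) = (\<integral>x. lam * \<bar>u0 x - f x\<bar> \<partial>lebesgue)" by simp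
  also have "\<dots> = (\<integral>x. g x * (u0 x - f x) \<partial>lebesgue)"
  proof (rule integral_cong_AE)
    show "AE x in lebesgue. lam * \<bar>u0 x - f x\<bar> = g x * (u0 x - f x)"
      using g(4,5)
    proof eventually_elim
      case (elim x)
      consider "u0 x > f x" | "u0 x < f x" | "u0 x = f x" by linarith
      then show ?case by cases (use elim in \<open>auto simp: algebra_simps\<close>)
    qed
  qed measurable
  finally have "energy \<phi> u0 f lam = ereal (- (\<integral>x. g x * f x \<partial>lebesgue))"
    unfolding energy_def TV using split[OF u0i] by simp
  \<comment> \<open>The total does not involve \<open>u\<close>; it is split so that each summand
    lies below the corresponding part of the energy of \<open>u\<close>.\<close>
  also have "\<dots> = ereal (- (\<integral>x. u x * g x \<partial>lebesgue)) + ereal (\<integral>x. g x * (u x - f x) \<partial>lebesgue)"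
    using split[OF u] by simp
  also have "\<dots> \<le> TV_aniso \<phi> u + ereal (lam * (\<integral>x. \<bar>u x - f x\<bar> \<partial>lebesgue))"
  proof (rule add_mono)
    show "ereal (- (\<integral>x. u x * g x \<partial>lebesgue)) \<le> TV_aniso \<phi> u"
      unfolding TV_aniso_def minus_wulff_eq by (rule TV_K_ge[OF \<phi>(1) h(1,2) g(1,2) u])
    show "ereal (\<integral>x. g x * (u x - f x) \<partial>lebesgue) \<le> ereal (lam * (\<integral>x. \<bar>u x - f x\<bar> \<partial>lebesgue))"
      using integral_mult_le[OF g(2,3), of "\<lambda>x. u x - f x"] u f by simp
  qed
  finally show "energy \<phi> u0 f lam \<le> energy \<phi> u f lam" by (simp add: energy_def)
qed

theorem theorem3p1:
  fixes \<phi> :: "'a::euclidean_space \<Rightarrow> real"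
    and f u0 :: "'a \<Rightarrow> real"
    and lam :: real
  assumes "admissible_aniso \<phi>"
    and "integrable lebesgue f"
    and "lam > 0"
    and "u0 \<in> BV"
  shows "is_minimizer \<phi> u0 f lam \<longleftrightarrow>
         (\<exists>v\<in>calV \<phi> u0. \<exists>g. weak_divergence v g \<and> Linf g \<and>
            (AE x in lebesgue. \<bar>g x\<bar> \<le> lam) \<and>
            (AE x in lebesgue. u0 x > f x \<longrightarrow> g x = lam) \<and>
            (AE x in lebesgue. u0 x < f x \<longrightarrow> g x = - lam))"
  using minimizer_imp_calibrated[OF assms(1-3)] calibrated_imp_minimizer[OF assms(1,2,4)] by blast

end
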